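(* Let $(M_1^{m_1}\times M_2^{m_2},g_1\times g_2)$ be a special Einstein product, with respective standard tractor bundles, metrics and connections $(\mathcal{T}_i,h_i,\nabla^i)$ and Einstein tractors $I_i$, $i=1,2$. Let $\mathcal{T}_i^\perp\subset\mathcal{T}_i$ be the orthogonal complement of $I_i$ and regard all these bundles as bundles over $M_1\times M_2$ by pull-back. Define $\mathcal{T}:=\mathcal{T}_1^\perp\oplus\mathcal{T}_2^\perp$, with bundle metric $h:=h_1\times h_2$, where $h_i$ is restricted to $\mathcal{T}_i^\perp$, and with connection $\nabla:=\nabla^1\oplus\nabla^2$, where $\nabla^i$ is restricted to $\mathcal{T}_i^\perp$. Then $(\mathcal{T},h,\nabla)$ is the normal standard tractor bundle and connection of the conformal manifold $(M_1\times M_2,[g_1\times g_2])$. The canonical tractor $X\in\mathcal{T}[1]$ is given by $X=(X_1^\perp,X_2^\perp)\in\mathcal{T}_1^\perp[1]\oplus\mathcal{T}_2^\perp[1]$, where, for $i=1,2$, $X_i^\perp$ is the orthogonal projection of the canonical tractor $X_i$ of $\mathcal{T}_i$ onto $\mathcal{T}_i^\perp[1]$.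
   Context: All manifolds are smooth and connected, all metrics Riemannian. Density bundles are trivialised by the metrics $g_1$, $g_2$ and $g_1\times g_2$ respectively (so weights such as $[1]$ may be ignored in these scales). Standard tractors of a conformal manifold $(M^d,c)$, $d\ge3$: $\mathcal{E}[w]$ denotes the line bundle whose sections are families $(f_g)_{g\in c}$ with $f_{e^{2\omega}g}=e^{w\omega}f_g$; $\mathbf{g}$ is the conformal metric (represented by $g$ in the scale $g$), used to raise and lower indices; the Schouten tensor $P$ is given by $\mathrm{Ric}=(d-2)P+Jg$, $J=\mathrm{tr}_gP$. Each $g\in c$ identifies the standard tractor bundle with $\mathcal{E}[1]\oplus T^*M[1]\oplus\mathcal{E}[-1]\ni(\sigma,\mu_a,\rho)$, with transformation under $\hat g=e^{2\omega}g$, $\Upsilon=d\omega$: $(\hat\sigma,\hat\mu_b,\hat\rho)=(\sigma,\mu_b+\sigma\Upsilon_b,\rho-\Upsilon^b\mu_b-\tfrac12\sigma\Upsilon^b\Upsilon_b)$. The tractor metric is $h(U,U)=2\sigma\rho+\mu^a\mu_a$, the normal tractor connection is $\nabla_a(\sigma,\mu^b,\rho)=(\nabla_a\sigma-\mu_a,\nabla_a\mu^b+\delta_a{}^b\rho+P_a{}^b\sigma,\nabla_a\rho-P_{ac}\mu^c)$, and the canonical tractor $X$ is the section of $\mathcal{T}[1]$ with $h(X,U)=\sigma$ (i.e. $X=(0,0,1)$). Tractors of an Einstein manifold $(N^m,g)$, $m\geq1$ (for $m=2$, Einstein means constant scalar curvature; for $m=1$ every metric is Einstein): trivialising densities by $g$,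 sections are triples $(s,t^a,r)$ of functions $s,r$ and a vector field $t$, with connection $$\nabla_a(s,t^b,r)=(\nabla_as-t_a,\ \nabla_at^b+\delta_a{}^b(r+\mu s),\ \nabla_ar-\mu t_a),$$ where $\mu=\mathrm{Sc}^g/(2m(m-1))$ if $m\ge2$, while for $m=1$ the number $\mu\in\mathbb{R}$ is part of the chosen data. For $m\geq3$ this agrees with the normal tractor connection above; for $m=1,2$ it is the definition. The metric is $2sr+g(t,t)$, and the canonical tractor is $(0,0,1)$. The Einstein tractor is the parallel tractor $I=(1,0,-\mu)$, with $|I|^2=-2\mu$. A special Einstein product is a product $(M_1^{m_1}\times M_2^{m_2},g_1\times g_2)$ with $m_1,m_2\geq1$, $m_1+m_2\geq3$, where each $(M_i,g_i)$ is Einstein with Einstein tractor $I_i$ and $|I_1|^2=-|I_2|^2\neq0$. *)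

theory Defs
  imports "HOL-Analysis.Analysis"
begin

text \<open>
  Tensors, bundles and connections are given by their local representatives in the charts of an
  atlas, subject to the usual transformation laws.  Local representatives are functions of the
  coordinate point \<open>x\<close>; their values outside the image of the chart are irrelevant.
\<close>

section \<open>Smooth maps and manifolds\<close>

primrec Ck_on :: "nat \<Rightarrow> 'a::euclidean_space set \<Rightarrow> ('a \<Rightarrow> 'b::real_normed_vector) \<Rightarrow> bool" where
  "Ck_on 0 S f \<longleftrightarrow> continuous_on S f"
| "Ck_on (Suc k) S f \<longleftrightarrow>
     (\<forall>x\<in>S. f differentiable (at x)) \<and> (\<forall>v. Ck_on k S (\<lambda>x. frechet_derivative f (at x) v))"

text \<open>Only used for open sets \<open>S\<close>.\<close>

definition smooth_on :: "'a::euclidean_space set \<Rightarrow> ('a \<Rightarrow> 'b::real_normed_vector) \<Rightarrow> bool" where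
  "smooth_on S f \<longleftrightarrow> (\<forall>k. Ck_on k S f)"

text \<open>
  The points of a manifold are all the elements of the type \<open>'p\<close>; its dimension is
  \<open>DIM('e) \<ge> 1\<close>.  Charts are indexed by \<open>'i\<close>, so that the charts of a product are indexed by
  pairs; the atlas need not be maximal.
\<close>

record ('i, 'p, 'e) atlas =
  charts :: "'i set"
  cdom :: "'i \<Rightarrow> 'p set"
  coord :: "'i \<Rightarrow> 'p \<Rightarrow> 'e"

definition param :: "('i, 'p, 'e) atlas \<Rightarrow> 'i \<Rightarrow> 'e \<Rightarrow> 'p" where
  "param M i = inv_into (cdom M i) (coord M i)"

definition cimg :: "('i, 'p, 'e) atlas \<Rightarrow> 'i \<Rightarrow> 'e set" where
  "cimg M i = coord M i ` cdom M i"

definition overlap :: "('i, 'p, 'e) atlas \<Rightarrow> 'i \<Rightarrow> 'i \<Rightarrow> 'e set" where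
  "overlap M i j = coord M i ` (cdom M i \<inter> cdom M j)"

definition change :: "('i, 'p, 'e) atlas \<Rightarrow> 'i \<Rightarrow> 'i \<Rightarrow> 'e \<Rightarrow> 'e" where
  "change M i j = coord M j \<circ> param M i"

definition jacobian :: "('i, 'p, 'e::euclidean_space) atlas \<Rightarrow> 'i \<Rightarrow> 'i \<Rightarrow> 'e \<Rightarrow> 'e \<Rightarrow> 'e" where
  "jacobian M i j x = frechet_derivative (change M i j) (at x)"

definition smooth_manifold ::
  "('i, 'p::{t2_space,second_countable_topology}, 'e::euclidean_space) atlas \<Rightarrow> bool" where
  "smooth_manifold M \<longleftrightarrow>
     connected (UNIV :: 'p set) \<and>
     (\<Union>i\<in>charts M. cdom M i) = UNIV \<and>
     (\<forall>i\<in>charts M. open (cdom M i) \<and> open (cimg M i) \<and>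
        homeomorphism (cdom M i) (cimg M i) (coord M i) (param M i)) \<and>
     (\<forall>i\<in>charts M. \<forall>j\<in>charts M. smooth_on (overlap M i j) (change M i j))"

definition smooth_fun :: "('i, 'p, 'e::euclidean_space) atlas \<Rightarrow> ('p \<Rightarrow> real) \<Rightarrow> bool" where
  "smooth_fun M f \<longleftrightarrow> (\<forall>i\<in>charts M. smooth_on (cimg M i) (f \<circ> param M i))"

definition product_manifold ::
  "('i, 'p, 'e) atlas \<Rightarrow> ('j, 'q, 'f) atlas \<Rightarrow> ('i \<times> 'j, 'p \<times> 'q, 'e \<times> 'f) atlas" where
  "product_manifold M N =
     \<lparr> charts = charts M \<times> charts N,
       cdom = (\<lambda>(i, j). cdom M i \<times> cdom N j),
       coord = (\<lambda>(i, j). map_prod (coord M i) (coord N j)) \<rparr>"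

section \<open>Riemannian metrics and curvature\<close>

text \<open>\<open>G x u v\<close> is the value at the coordinate point \<open>x\<close> of a metric on the vectors with
  coordinate components \<open>u\<close> and \<open>v\<close>.\<close>

type_synonym 'e local_metric = "'e \<Rightarrow> 'e \<Rightarrow> 'e \<Rightarrow> real"

type_synonym ('i, 'e) metric = "'i \<Rightarrow> 'e local_metric"

definition riemannian_metric ::
  "('i, 'p, 'e::euclidean_space) atlas \<Rightarrow> ('i, 'e) metric \<Rightarrow> bool" where
  "riemannian_metric M g \<longleftrightarrow>
     (\<forall>i\<in>charts M. \<forall>x\<in>cimg M i.
        bilinear (g i x) \<and> (\<forall>u v. g i x u v = g i x v u) \<and> (\<forall>u. u \<noteq> 0 \<longrightarrow> g i x u u > 0)) \<and>
     (\<forall>i\<in>charts M. \<forall>u v. smooth_on (cimg M i) (\<lambda>x. g i x u v)) \<and>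
     (\<forall>i\<in>charts M. \<forall>j\<in>charts M. \<forall>x\<in>overlap M i j. \<forall>u v.
        g j (change M i j x) (jacobian M i j x u) (jacobian M i j x v) = g i x u v)"

definition product_metric ::
  "('i, 'e) metric \<Rightarrow> ('j, 'f) metric \<Rightarrow> ('i \<times> 'j, 'e \<times> 'f) metric" where
  "product_metric g g' = (\<lambda>(i, j) (x, y) (u, v) (u', v'). g i x u u' + g' j y v v')"

text \<open>The vector corresponding to a covector, i.e. raising an index.\<close>

definition sharp :: "'e local_metric \<Rightarrow> 'e \<Rightarrow> ('e \<Rightarrow> real) \<Rightarrow> 'e" where
  "sharp G x \<alpha> = (THE z. \<forall>w. G x z w = \<alpha> w)"

definition metric_trace :: "'e::euclidean_space local_metric \<Rightarrow> 'e \<Rightarrow> ('e \<Rightarrow> 'e \<Rightarrow> real) \<Rightarrow> real" where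
  "metric_trace G x B = (\<Sum>b\<in>Basis. sharp G x (B b) \<bullet> b)"

text \<open>\<open>christoffel G x u v\<close> is \<open>\<nabla>\<^sub>u v\<close> for the Levi-Civita connection and constant coordinate
  fields \<open>u\<close>, \<open>v\<close>, by the Koszul formula.\<close>

definition christoffel :: "'e::euclidean_space local_metric \<Rightarrow> 'e \<Rightarrow> 'e \<Rightarrow> 'e \<Rightarrow> 'e" where
  "christoffel G x u v = sharp G x (\<lambda>w.
     (frechet_derivative (\<lambda>y. G y v w) (at x) u
      + frechet_derivative (\<lambda>y. G y u w) (at x) v
      - frechet_derivative (\<lambda>y. G y u v) (at x) w) / 2)"

text \<open>\<open>R(u,v)w = \<nabla>\<^sub>u \<nabla>\<^sub>v w - \<nabla>\<^sub>v \<nabla>\<^sub>u w\<close> for constant coordinate fields.\<close>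

definition curvature :: "'e::euclidean_space local_metric \<Rightarrow> 'e \<Rightarrow> 'e \<Rightarrow> 'e \<Rightarrow> 'e \<Rightarrow> 'e" where
  "curvature G x u v w =
     frechet_derivative (\<lambda>y. christoffel G y v w) (at x) u
     - frechet_derivative (\<lambda>y. christoffel G y u w) (at x) v
     + christoffel G x u (christoffel G x v w) - christoffel G x v (christoffel G x u w)"

definition ricci :: "'e::euclidean_space local_metric \<Rightarrow> 'e \<Rightarrow> 'e \<Rightarrow> 'e \<Rightarrow> real" where
  "ricci G x v w = (\<Sum>b\<in>Basis. curvature G x b v w \<bullet> b)"

definition scalar_curvature :: "'e::euclidean_space local_metric \<Rightarrow> 'e \<Rightarrow> real" where
  "scalar_curvature G x = metric_trace G x (ricci G x)"

text \<open>For \<open>DIM('e) \<ge> 3\<close> the defining equation \<open>Ric = (d - 2) P + J g\<close>, \<open>J = tr P\<close>, has exactly one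
  solution.\<close>

definition schouten :: "'e::euclidean_space local_metric \<Rightarrow> 'e \<Rightarrow> 'e \<Rightarrow> 'e \<Rightarrow> real" where
  "schouten G x = (THE P. \<forall>u v.
     ricci G x u v = (real DIM('e) - 2) * P u v + metric_trace G x P * G x u v)"

text \<open>In dimension 1 every metric is Einstein.\<close>

definition einstein_metric ::
  "('i, 'p, 'e::euclidean_space) atlas \<Rightarrow> ('i, 'e) metric \<Rightarrow> bool" where
  "einstein_metric M g \<longleftrightarrow> riemannian_metric M g \<and>
     (DIM('e) = 2 \<longrightarrow> (\<exists>k. \<forall>i\<in>charts M. \<forall>x\<in>cimg M i. scalar_curvature (g i) x = k)) \<and>
     (DIM('e) \<ge> 3 \<longrightarrow>
        (\<exists>k. \<forall>i\<in>charts M. \<forall>x\<in>cimg M i. \<forall>u v. ricci (g i) x u v = k * g i x u v))"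

section \<open>Vector bundles with metric and connection\<close>

text \<open>
  Over a chart \<open>i\<close> the bundle is a family of subspaces \<open>fib B i x\<close> of \<open>'v\<close> (this accommodates
  subbundles); \<open>transition B i j x\<close> changes from chart \<open>i\<close> to chart \<open>j\<close> at the point with
  \<open>i\<close>-coordinate \<open>x\<close>; \<open>met\<close> is the bundle metric, and \<open>conn\<close> the connection form, i.e.
  \<open>\<nabla>\<^sub>u s = D\<^sub>u s + conn B i x u (s x)\<close>.
\<close>

record ('i, 'e, 'v) vbundle =
  fib :: "'i \<Rightarrow> 'e \<Rightarrow> 'v set"
  transition :: "'i \<Rightarrow> 'i \<Rightarrow> 'e \<Rightarrow> 'v \<Rightarrow> 'v"
  met :: "'i \<Rightarrow> 'e \<Rightarrow> 'v \<Rightarrow> 'v \<Rightarrow> real"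
  conn :: "'i \<Rightarrow> 'e \<Rightarrow> 'e \<Rightarrow> 'v \<Rightarrow> 'v"

definition cov_deriv ::
  "('i, 'e::euclidean_space, 'v::euclidean_space) vbundle \<Rightarrow> 'i \<Rightarrow> ('e \<Rightarrow> 'v) \<Rightarrow> 'e \<Rightarrow> 'e \<Rightarrow> 'v" where
  "cov_deriv B i s x u = frechet_derivative s (at x) u + conn B i x u (s x)"

text \<open>The orthogonal complement of a section \<open>I\<close>, with restricted metric and connection.\<close>

definition perp :: "('i, 'e, 'v) vbundle \<Rightarrow> ('i \<Rightarrow> 'e \<Rightarrow> 'v) \<Rightarrow> ('i, 'e, 'v) vbundle" where
  "perp B I = B\<lparr> fib := (\<lambda>i x. {v \<in> fib B i x. met B i x (I i x) v = 0}) \<rparr>"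

text \<open>
  Pull-backs along the projections of a product manifold to its factors: in the product charts the
  projections are \<open>(x, y) \<mapsto> x\<close> and \<open>(x, y) \<mapsto> y\<close>, and connection forms are pulled back as 1-forms.
\<close>

definition pullback_fst :: "('i, 'e, 'v) vbundle \<Rightarrow> ('i \<times> 'j, 'e \<times> 'f, 'v) vbundle" where
  "pullback_fst B =
     \<lparr> fib = (\<lambda>(i, j) (x, y). fib B i x),
       transition = (\<lambda>(i, j) (i', j') (x, y). transition B i i' x),
       met = (\<lambda>(i, j) (x, y). met B i x),
       conn = (\<lambda>(i, j) (x, y) (u, v). conn B i x u) \<rparr>"

definition pullback_snd :: "('j, 'f, 'v) vbundle \<Rightarrow> ('i \<times> 'j, 'e \<times> 'f, 'v) vbundle" where
  "pullback_snd B =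
     \<lparr> fib = (\<lambda>(i, j) (x, y). fib B j y),
       transition = (\<lambda>(i, j) (i', j') (x, y). transition B j j' y),
       met = (\<lambda>(i, j) (x, y). met B j y),
       conn = (\<lambda>(i, j) (x, y) (u, v). conn B j y v) \<rparr>"

definition direct_sum ::
  "('i, 'e, 'v) vbundle \<Rightarrow> ('i, 'e, 'w) vbundle \<Rightarrow> ('i, 'e, 'v \<times> 'w) vbundle" where
  "direct_sum B C =
     \<lparr> fib = (\<lambda>i x. fib B i x \<times> fib C i x),
       transition = (\<lambda>i j x. map_prod (transition B i j x) (transition C i j x)),
       met = (\<lambda>i x (v, w) (v', w'). met B i x v v' + met C i x w w'),
       conn = (\<lambda>i x u. map_prod (conn B i x u) (conn C i x u)) \<rparr>"

definition orth_proj ::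
  "('v \<Rightarrow> 'v \<Rightarrow> real) \<Rightarrow> 'v set \<Rightarrow> 'v::real_vector \<Rightarrow> 'v" where
  "orth_proj h W v = (THE w. w \<in> W \<and> (\<forall>z\<in>W. h (v - w) z = 0))"

text \<open>Isomorphisms of vector bundles preserving metrics and connections.  The quantification over
  \<open>N\<close> and \<open>s\<close> is over all local sections of \<open>B\<close>.\<close>

definition bundle_isomorphism ::
  "('i, 'p, 'e::euclidean_space) atlas \<Rightarrow> ('i, 'e, 'v::euclidean_space) vbundle
   \<Rightarrow> ('i, 'e, 'w::euclidean_space) vbundle \<Rightarrow> ('i \<Rightarrow> 'e \<Rightarrow> 'v \<Rightarrow> 'w) \<Rightarrow> bool" where
  "bundle_isomorphism M B C \<Phi> \<longleftrightarrow>
     (\<forall>i\<in>charts M. \<forall>x\<in>cimg M i.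
        subspace (fib B i x) \<and>
        (\<forall>a b. \<forall>v\<in>fib B i x. \<forall>w\<in>fib B i x.
           \<Phi> i x (a *\<^sub>R v + b *\<^sub>R w) = a *\<^sub>R \<Phi> i x v + b *\<^sub>R \<Phi> i x w) \<and>
        bij_betw (\<Phi> i x) (fib B i x) (fib C i x) \<and>
        (\<forall>v\<in>fib B i x. \<forall>w\<in>fib B i x. met C i x (\<Phi> i x v) (\<Phi> i x w) = met B i x v w)) \<and>
     (\<forall>i\<in>charts M. \<forall>j\<in>charts M. \<forall>x\<in>overlap M i j. \<forall>v\<in>fib B i x.
        transition B i j x v \<in> fib B j (change M i j x) \<and>
        \<Phi> j (change M i j x) (transition B i j x v) = transition C i j x (\<Phi> i x v)) \<and>
     (\<forall>i\<in>charts M. \<forall>N s. open N \<and> N \<subseteq> cimg M i \<and> (\<forall>x\<in>N. s x \<in> fib B i x) \<longrightarrow>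
        (smooth_on N s \<longleftrightarrow> smooth_on N (\<lambda>x. \<Phi> i x (s x))) \<and>
        (smooth_on N s \<longrightarrow> (\<forall>x\<in>N. \<forall>u.
           cov_deriv B i s x u \<in> fib B i x \<and>
           \<Phi> i x (cov_deriv B i s x u) = cov_deriv C i (\<lambda>y. \<Phi> i y (s y)) x u)))"

section \<open>Tractors\<close>

text \<open>
  With densities trivialised by a metric, a tractor is a triple consisting of a number, a tangent
  vector and a number.  The middle slot \<open>T\<^sup>*M[1]\<close> is written with raised index, \<open>\<mu>\<^sup>a\<close>.
\<close>

type_synonym 'e tractor = "real \<times> 'e \<times> real"

fun tractor_trans ::
  "('i, 'p, 'e::euclidean_space) atlas \<Rightarrow> 'i \<Rightarrow> 'i \<Rightarrow> 'e \<Rightarrow> 'e tractor \<Rightarrow> 'e tractor" where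
  "tractor_trans M i j x (s, t, r) = (s, jacobian M i j x t, r)"

text \<open>The polarisation of \<open>2 s r + g(t,t)\<close>.\<close>

fun tractor_met :: "'e local_metric \<Rightarrow> 'e \<Rightarrow> 'e tractor \<Rightarrow> 'e tractor \<Rightarrow> real" where
  "tractor_met G x (s, t, r) (s', t', r') = s * r' + r * s' + G x t t'"

fun normal_conn ::
  "'e::euclidean_space local_metric \<Rightarrow> 'e \<Rightarrow> 'e \<Rightarrow> 'e tractor \<Rightarrow> 'e tractor" where
  "normal_conn G x u (\<sigma>, \<mu>, \<rho>) =
     (- G x u \<mu>,
      christoffel G x u \<mu> + \<rho> *\<^sub>R u + \<sigma> *\<^sub>R sharp G x (schouten G x u),
      - schouten G x u \<mu>)"

fun einstein_conn ::
  "'e::euclidean_space local_metric \<Rightarrow> real \<Rightarrow> 'e \<Rightarrow> 'e \<Rightarrow> 'e tractor \<Rightarrow> 'e tractor" where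
  "einstein_conn G \<mu> x u (s, t, r) =
     (- G x u t, christoffel G x u t + (r + \<mu> * s) *\<^sub>R u, - \<mu> * G x u t)"

text \<open>The standard tractor bundle with its metric and normal connection in the scale \<open>g\<close>.\<close>

definition normal_tractors ::
  "('i, 'p, 'e::euclidean_space) atlas \<Rightarrow> ('i, 'e) metric \<Rightarrow> ('i, 'e, 'e tractor) vbundle" where
  "normal_tractors M g =
     \<lparr> fib = (\<lambda>i x. UNIV), transition = tractor_trans M,
       met = (\<lambda>i. tractor_met (g i)), conn = (\<lambda>i. normal_conn (g i)) \<rparr>"

definition einstein_tractors ::
  "('i, 'p, 'e::euclidean_space) atlas \<Rightarrow> ('i, 'e) metric \<Rightarrow> real
   \<Rightarrow> ('i, 'e, 'e tractor) vbundle" where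
  "einstein_tractors M g \<mu> =
     \<lparr> fib = (\<lambda>i x. UNIV), transition = tractor_trans M,
       met = (\<lambda>i. tractor_met (g i)), conn = (\<lambda>i. einstein_conn (g i) \<mu>) \<rparr>"

definition canonical_tractor :: "'i \<Rightarrow> 'e \<Rightarrow> 'e::euclidean_space tractor" where
  "canonical_tractor i x = (0, 0, 1)"

definition einstein_tractor :: "real \<Rightarrow> 'i \<Rightarrow> 'e \<Rightarrow> 'e::euclidean_space tractor" where
  "einstein_tractor \<mu> i x = (1, 0, - \<mu>)"

lemma frechet_derivative_triple:
  assumes "s differentiable (at x)" "t differentiable (at x)" "r differentiable (at x)"
  shows "frechet_derivative (\<lambda>y. (s y, t y, r y)) (at x) u =
    (frechet_derivative s (at x) u, frechet_derivative t (at x) u, frechet_derivative r (at x) u)"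
proof -
  have "((\<lambda>y. (s y, t y, r y)) has_derivative
    (\<lambda>u. (frechet_derivative s (at x) u, frechet_derivative t (at x) u,
          frechet_derivative r (at x) u))) (at x)"
    using assms by (intro has_derivative_Pair) (simp_all add: frechet_derivative_works)
  from frechet_derivative_at[OF this] show ?thesis by (simp add: fun_eq_iff)
qed

lemma cov_deriv_normal_tractors:
  assumes "\<sigma> differentiable (at x)" "\<mu> differentiable (at x)" "\<rho> differentiable (at x)"
  shows "cov_deriv (normal_tractors M g) i (\<lambda>y. (\<sigma> y, \<mu> y, \<rho> y)) x u =
    (frechet_derivative \<sigma> (at x) u - g i x u (\<mu> x),
     (frechet_derivative \<mu> (at x) u + christoffel (g i) x u (\<mu> x))
       + \<rho> x *\<^sub>R u + \<sigma> x *\<^sub>R sharp (g i) x (schouten (g i) x u),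
     frechet_derivative \<rho> (at x) u - schouten (g i) x u (\<mu> x))"
  by (simp add: cov_deriv_def normal_tractors_def frechet_derivative_triple[OF assms] add.assoc)

lemma cov_deriv_einstein_tractors:
  assumes "s differentiable (at x)" "t differentiable (at x)" "r differentiable (at x)"
  shows "cov_deriv (einstein_tractors M g \<mu>) i (\<lambda>y. (s y, t y, r y)) x u =
    (frechet_derivative s (at x) u - g i x u (t x),
     (frechet_derivative t (at x) u + christoffel (g i) x u (t x)) + (r x + \<mu> * s x) *\<^sub>R u,
     frechet_derivative r (at x) u - \<mu> * g i x u (t x))"
  by (simp add: cov_deriv_def einstein_tractors_def frechet_derivative_triple[OF assms] add.assoc)

section \<open>Conformal manifolds\<close>

definition rescaling ::
  "('i, 'p, 'e::euclidean_space) atlas \<Rightarrow> ('p \<Rightarrow> real) \<Rightarrow> ('i, 'e) metric \<Rightarrow> ('i, 'e) metric \<Rightarrow> bool"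
  where
  "rescaling M \<omega> g g' \<longleftrightarrow> smooth_fun M \<omega> \<and>
     (\<forall>i\<in>charts M. \<forall>x\<in>cimg M i. \<forall>u v. g' i x u v = exp (2 * \<omega> (param M i x)) * g i x u v)"

definition conformal_class ::
  "('i, 'p, 'e::euclidean_space) atlas \<Rightarrow> ('i, 'e) metric \<Rightarrow> ('i, 'e) metric set" where
  "conformal_class M g = {g'. \<exists>\<omega>. rescaling M \<omega> g g'}"

text \<open>
  Sections of \<open>B \<otimes> \<E>[w]\<close> for a conformal class \<open>c\<close>: families of sections of \<open>B\<close>, one for each
  scale \<open>g \<in> c\<close>, with \<open>X\<^sub>g' = e\<^bsup>w\<omega>\<^esup> X\<^sub>g\<close>.
\<close>

definition weighted_section ::
  "('i, 'p, 'e::euclidean_space) atlas \<Rightarrow> ('i, 'e) metric set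
   \<Rightarrow> ('i, 'e, 'v::euclidean_space) vbundle \<Rightarrow> real
   \<Rightarrow> (('i, 'e) metric \<Rightarrow> 'i \<Rightarrow> 'e \<Rightarrow> 'v) \<Rightarrow> bool" where
  "weighted_section M c B w X \<longleftrightarrow>
     (\<forall>g\<in>c. \<forall>i\<in>charts M. smooth_on (cimg M i) (X g i) \<and>
        (\<forall>x\<in>cimg M i. X g i x \<in> fib B i x) \<and>
        (\<forall>j\<in>charts M. \<forall>x\<in>overlap M i j. X g j (change M i j x) = transition B i j x (X g i x))) \<and>
     (\<forall>g\<in>c. \<forall>g'\<in>c. \<forall>\<omega>. rescaling M \<omega> g g' \<longrightarrow>
        (\<forall>i\<in>charts M. \<forall>x\<in>cimg M i. X g' i x = exp (w * \<omega> (param M i x)) *\<^sub>R X g i x))"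

text \<open>
  The change of scale of standard tractors, \<open>a\<close> and \<open>\<Upsilon>\<close> being the values of \<open>\<omega>\<close> and \<open>d\<omega>\<close> at \<open>x\<close>.
  The exponential factors come from trivialising the densities by \<open>g'\<close> instead of \<open>g\<close>:
  \<open>\<sigma>\<close>, \<open>\<mu>\<^sub>a\<close>, \<open>\<rho>\<close> have weights 1, 1, -1, and therefore \<open>\<mu>\<^sup>a\<close> has weight -1.
\<close>

fun change_scale ::
  "'e local_metric \<Rightarrow> 'e \<Rightarrow> real \<Rightarrow> ('e \<Rightarrow> real) \<Rightarrow> 'e tractor \<Rightarrow> 'e::euclidean_space tractor" where
  "change_scale G x a \<Upsilon> (\<sigma>, \<mu>, \<rho>) =
     (exp a * \<sigma>,
      exp (- a) *\<^sub>R (\<mu> + \<sigma> *\<^sub>R sharp G x \<Upsilon>),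
      exp (- a) * (\<rho> - \<Upsilon> \<mu> - \<sigma> * \<Upsilon> (sharp G x \<Upsilon>) / 2))"

text \<open>
  \<open>B\<close>, with its metric and connection, is the normal standard tractor bundle of the conformal
  manifold \<open>(M, c)\<close>, and \<open>X\<close>, a section of \<open>B[1]\<close>, is its canonical tractor: each scale \<open>g \<in> c\<close>
  identifies \<open>B\<close> with the normal tractors in that scale and \<open>X\<close> with \<open>(0, 0, 1)\<close>, and the
  identifications in different scales are related by the change of scale.
\<close>

definition normal_standard_tractor_bundle ::
  "('i, 'p, 'e::euclidean_space) atlas \<Rightarrow> ('i, 'e) metric set
   \<Rightarrow> ('i, 'e, 'v::euclidean_space) vbundle \<Rightarrow> (('i, 'e) metric \<Rightarrow> 'i \<Rightarrow> 'e \<Rightarrow> 'v) \<Rightarrow> bool" where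
  "normal_standard_tractor_bundle M c B X \<longleftrightarrow>
     weighted_section M c B 1 X \<and>
     (\<exists>\<Phi>.
        (\<forall>g\<in>c. bundle_isomorphism M B (normal_tractors M g) (\<Phi> g) \<and>
           (\<forall>i\<in>charts M. \<forall>x\<in>cimg M i. \<Phi> g i x (X g i x) = canonical_tractor i x)) \<and>
        (\<forall>g\<in>c. \<forall>g'\<in>c. \<forall>\<omega>. rescaling M \<omega> g g' \<longrightarrow>
           (\<forall>i\<in>charts M. \<forall>x\<in>cimg M i. \<forall>v\<in>fib B i x.
              \<Phi> g' i x v =
              change_scale (g i) x (\<omega> (param M i x))
                (frechet_derivative (\<omega> \<circ> param M i) (at x)) (\<Phi> g i x v))))"

section \<open>Special Einstein products\<close>

text \<open>An Einstein manifold with its number \<open>\<mu>\<close>, which is free in dimension 1.\<close>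

definition einstein_manifold ::
  "('i, 'p::{t2_space,second_countable_topology}, 'e::euclidean_space) atlas
   \<Rightarrow> ('i, 'e) metric \<Rightarrow> real \<Rightarrow> bool" where
  "einstein_manifold M g \<mu> \<longleftrightarrow> smooth_manifold M \<and> einstein_metric M g \<and>
     (DIM('e) \<ge> 2 \<longrightarrow> (\<forall>i\<in>charts M. \<forall>x\<in>cimg M i.
        \<mu> = scalar_curvature (g i) x / (2 * real DIM('e) * (real DIM('e) - 1))))"

definition special_einstein_product ::
  "('i, 'p::{t2_space,second_countable_topology}, 'e::euclidean_space) atlas
   \<Rightarrow> ('i, 'e) metric \<Rightarrow> real
   \<Rightarrow> ('j, 'q::{t2_space,second_countable_topology}, 'f::euclidean_space) atlas
   \<Rightarrow> ('j, 'f) metric \<Rightarrow> real \<Rightarrow> bool" where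
  "special_einstein_product M\<^sub>1 g\<^sub>1 \<mu>\<^sub>1 M\<^sub>2 g\<^sub>2 \<mu>\<^sub>2 \<longleftrightarrow>
     einstein_manifold M\<^sub>1 g\<^sub>1 \<mu>\<^sub>1 \<and> einstein_manifold M\<^sub>2 g\<^sub>2 \<mu>\<^sub>2 \<and> DIM('e) + DIM('f) \<ge> 3 \<and>
     (\<forall>i\<in>charts M\<^sub>1. \<forall>x\<in>cimg M\<^sub>1 i. \<forall>j\<in>charts M\<^sub>2. \<forall>y\<in>cimg M\<^sub>2 j.
        let n\<^sub>1 = met (einstein_tractors M\<^sub>1 g\<^sub>1 \<mu>\<^sub>1) i x (einstein_tractor \<mu>\<^sub>1 i x) (einstein_tractor \<mu>\<^sub>1 i x);
            n\<^sub>2 = met (einstein_tractors M\<^sub>2 g\<^sub>2 \<mu>\<^sub>2) j y (einstein_tractor \<mu>\<^sub>2 j y) (einstein_tractor \<mu>\<^sub>2 j y)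
        in n\<^sub>1 = - n\<^sub>2 \<and> n\<^sub>1 \<noteq> 0)"

end

theory Submission
  imports Defs
begin

text \<open>
  Put \<open>\<mu> = \<mu>\<^sub>1 = - \<mu>\<^sub>2\<close>.  The Einstein tractor \<open>(1, 0, - \<mu>\<^sub>i)\<close> is orthogonal to \<open>(s, t, r)\<close> exactly when
  \<open>r = \<mu>\<^sub>i s\<close>, so that a pair of tractors orthogonal to the Einstein tractors is given by
  \<open>(s\<^sub>1, t\<^sub>1)\<close> and \<open>(s\<^sub>2, t\<^sub>2)\<close>.  In the scale of the product metric the identification with the standard
  tractors is the fibrewise linear map \<open>(s\<^sub>1 + s\<^sub>2, (t\<^sub>1, t\<^sub>2), \<mu> (s\<^sub>1 - s\<^sub>2))\<close>.  It preserves the metrics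
  because \<open>2 \<mu> s\<^sub>1\<^sup>2 - 2 \<mu> s\<^sub>2\<^sup>2 = 2 (s\<^sub>1 + s\<^sub>2) \<mu> (s\<^sub>1 - s\<^sub>2)\<close>, and it sends the pair of projected canonical
  tractors, \<open>(1 / (2 \<mu>), 0, 1 / 2)\<close> and \<open>(- 1 / (2 \<mu>), 0, 1 / 2)\<close>, to \<open>(0, 0, 1)\<close>.  It
  preserves the connections because the Schouten tensor of the product is \<open>\<mu> (g\<^sub>1 - g\<^sub>2)\<close>
  (\<open>schouten_product\<close>): this \<open>P\<close> satisfies \<open>Ric = (d - 2) P + J g\<close>, which determines it
  (\<open>schouten_unique\<close>), since the Ricci tensor of each factor is \<open>2 (m\<^sub>i - 1) \<mu>\<^sub>i g\<^sub>i\<close>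
  (\<open>ricci_of_einstein\<close>).  For factors of dimension 1 and 2, where the Einstein condition is not
  a condition on the Ricci tensor, that follows from the symmetries of the curvature tensor.

  For an arbitrary metric \<open>e\<^bsup>2\<omega>\<^esup> g\<close> of the conformal class the identification is followed by the change
  of scale.  That this intertwines the normal connections of the two scales
  (\<open>change_scale_conn\<close>) rests on the transformation of the Schouten tensor,
  \<open>P - \<nabla>\<Upsilon> + \<Upsilon> \<otimes> \<Upsilon> - \<bar>\<Upsilon>\<bar>\<^sup>2 g / 2\<close> with \<open>\<Upsilon> = d\<omega>\<close>
  (\<open>ricci_schouten_rescaled\<close>), which is read off from the Ricci tensor of the new metric, computed from the
  difference of the two Levi-Civita connections.  Changes of scale compose additively in \<open>\<omega>\<close> and
  \<open>\<Upsilon>\<close> (\<open>change_scale_compose\<close>), so that the identifications in any two scales are related as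
  required, and they commute with coordinate changes (\<open>change_scale_equivariant\<close>).

  The analytic input is that everything built from a metric by raising indices is again smooth
  (\<open>Ck_on_sharp\<close>), and that second derivatives commute (\<open>second_derivative_symmetric\<close>); the
  latter makes the Hessian of \<open>\<omega>\<close> symmetric and the curvature endomorphisms skew.
\<close>

section \<open>Smooth functions\<close>

lemma frechet_derivative_cong:
  assumes "open S" "x \<in> S" "\<And>y. y \<in> S \<Longrightarrow> f y = g y"
  shows "frechet_derivative f (at x) = frechet_derivative g (at x)"
proof -
  have "(f has_derivative F) (at x) \<longleftrightarrow> (g has_derivative F) (at x)" for F
    using has_derivative_transform_within_open[OF _ assms(1,2), of f F UNIV g]
      has_derivative_transform_within_open[OF _ assms(1,2), of g F UNIV f] assms(3) by auto
  then show ?thesis by (simp add: frechet_derivative_def)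
qed

lemma differentiable_cong:
  assumes "open S" "x \<in> S" "\<And>y. y \<in> S \<Longrightarrow> f y = g y" "f differentiable (at x)"
  shows "g differentiable (at x)"
  using has_derivative_transform_within_open[OF _ assms(1,2), of f _ UNIV g] assms(3,4)
  unfolding differentiable_def by auto

lemma Ck_on_cong:
  assumes "open S" "\<And>y. y \<in> S \<Longrightarrow> f y = g y" "Ck_on k S f"
  shows "Ck_on k S g"
  using assms(2,3)
proof (induction k arbitrary: f g)
  case 0
  then show ?case using continuous_on_cong[of S S f g] by simp
next
  case (Suc k)
  have "g differentiable (at x)" if "x \<in> S" for x
    using differentiable_cong[OF assms(1) that, of f g] Suc.prems that by auto
  moreover have "Ck_on k S (\<lambda>x. frechet_derivative g (at x) v)" for v
  proof (rule Suc.IH[of "\<lambda>x. frechet_derivative f (at x) v"])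
    show "frechet_derivative f (at y) v = frechet_derivative g (at y) v" if "y \<in> S" for y
      using frechet_derivative_cong[OF assms(1) that, of f g] Suc.prems(1) by simp
  qed (use Suc.prems in auto)
  ultimately show ?case by auto
qed

lemma Ck_on_derivative: "Ck_on (Suc k) S f \<Longrightarrow> Ck_on k S (\<lambda>x. frechet_derivative f (at x) v)"
  by simp

lemma Ck_on_Suc_imp_Ck_on: "Ck_on (Suc k) S f \<Longrightarrow> Ck_on k S f"
proof (induction k arbitrary: f)
  case 0
  then have "continuous (at x within S) f" if "x \<in> S" for x
    using that by (simp add: differentiable_imp_continuous_within differentiable_at_withinI)
  then show ?case by (simp add: continuous_on_eq_continuous_within)
next
  case (Suc k)
  have "Ck_on k S (\<lambda>x. frechet_derivative f (at x) v)" for v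
    by (intro Suc.IH Ck_on_derivative[OF Suc.prems])
  then show ?case using Suc.prems by simp
qed

text \<open>Unlike the definition, this asks for some derivative at each point of \<open>S\<close>, so that it can be fed
with the rules for \<open>has_derivative\<close>; it is how all closure properties below are proved.\<close>

lemma Ck_on_SucI:
  assumes "open S" "\<And>x. x \<in> S \<Longrightarrow> (f has_derivative f' x) (at x)"
    and "\<And>v. Ck_on k S (\<lambda>x. f' x v)"
  shows "Ck_on (Suc k) S f"
proof -
  have "frechet_derivative f (at x) = f' x" if "x \<in> S" for x
    using frechet_derivative_at[OF assms(2)[OF that]] by simp
  then have "Ck_on k S (\<lambda>x. frechet_derivative f (at x) v)" for v
    using Ck_on_cong[OF assms(1) _ assms(3)[of v]] by simp
  then show ?thesis using assms(2) by (auto simp: differentiable_def)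
qed

lemma Ck_on_has_derivative:
  "Ck_on (Suc k) S f \<Longrightarrow> x \<in> S \<Longrightarrow> (f has_derivative frechet_derivative f (at x)) (at x)"
  by (simp add: frechet_derivative_works)

lemma Ck_on_subset: "Ck_on k S f \<Longrightarrow> T \<subseteq> S \<Longrightarrow> Ck_on k T f"
  by (induction k arbitrary: f) (auto intro: continuous_on_subset)

lemma Ck_on_const: "open S \<Longrightarrow> Ck_on k S (\<lambda>x. c)"
proof (induction k arbitrary: c)
  case (Suc k)
  show ?case by (rule Ck_on_SucI[where f' = "\<lambda>x v. 0"]) (use Suc in auto)
qed simp

lemma Ck_on_bounded_linear:
  assumes "bounded_linear L" "open S" "Ck_on k S f"
  shows "Ck_on k S (\<lambda>x. L (f x))"
  using assms(3)
proof (induction k arbitrary: f)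
  case 0
  then show ?case by (auto intro: bounded_linear.continuous_on[OF assms(1)])
next
  case (Suc k)
  show ?case
    by (rule Ck_on_SucI[where f' = "\<lambda>x v. L (frechet_derivative f (at x) v)"])
      (auto intro!: bounded_linear.has_derivative[OF assms(1)] Ck_on_has_derivative[OF Suc.prems]
        Suc.IH Ck_on_derivative[OF Suc.prems] assms(2))
qed

lemma Ck_on_Pair:
  assumes "open S" "Ck_on k S f" "Ck_on k S g"
  shows "Ck_on k S (\<lambda>x. (f x, g x))"
  using assms(2,3)
proof (induction k arbitrary: f g)
  case 0
  then show ?case by (auto intro: continuous_on_Pair)
next
  case (Suc k)
  show ?case
    by (rule Ck_on_SucI[where f' = "\<lambda>x v. (frechet_derivative f (at x) v,
        frechet_derivative g (at x) v)"])
      (auto intro!: has_derivative_Pair Ck_on_has_derivative[OF Suc.prems(1)]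
        Ck_on_has_derivative[OF Suc.prems(2)] Suc.IH Ck_on_derivative[OF Suc.prems(1)]
        Ck_on_derivative[OF Suc.prems(2)] assms(1))
qed

lemma Ck_on_add:
  assumes "open S" "Ck_on k S f" "Ck_on k S g"
  shows "Ck_on k S (\<lambda>x. f x + g x)"
proof -
  have "bounded_linear (\<lambda>p::'b \<times> 'b. fst p + snd p)"
    by (intro bounded_linear_add bounded_linear_fst bounded_linear_snd)
  from Ck_on_bounded_linear[OF this assms(1) Ck_on_Pair[OF assms]] show ?thesis by simp
qed

lemma Ck_on_bounded_bilinear:
  assumes "bounded_bilinear B" "open S" "Ck_on k S f" "Ck_on k S g"
  shows "Ck_on k S (\<lambda>x. B (f x) (g x))"
  using assms(3,4)
proof (induction k arbitrary: f g)
  case 0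
  then show ?case by (auto intro: bounded_bilinear.continuous_on[OF assms(1)])
next
  case (Suc k)
  show ?case
  proof (rule Ck_on_SucI[where f' = "\<lambda>x v. B (f x) (frechet_derivative g (at x) v)
        + B (frechet_derivative f (at x) v) (g x)"])
    show "Ck_on k S (\<lambda>x. B (f x) (frechet_derivative g (at x) v)
        + B (frechet_derivative f (at x) v) (g x))" for v
      by (intro Ck_on_add Suc.IH Ck_on_derivative[OF Suc.prems(1)] Ck_on_derivative[OF Suc.prems(2)]
          Suc.prems[THEN Ck_on_Suc_imp_Ck_on] assms)
    show "((\<lambda>x. B (f x) (g x)) has_derivative (\<lambda>v. B (f x) (frechet_derivative g (at x) v)
        + B (frechet_derivative f (at x) v) (g x))) (at x)" if "x \<in> S" for x
      by (intro bounded_bilinear.FDERIV[OF assms(1)] Suc.prems[THEN Ck_on_has_derivative, OF that])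
  qed (rule assms)
qed

lemma Ck_on_exp:
  fixes f :: "'a::euclidean_space \<Rightarrow> real"
  assumes "open S" "Ck_on k S f"
  shows "Ck_on k S (\<lambda>x. exp (f x))"
  using assms(2)
proof (induction k arbitrary: f)
  case 0
  then show ?case by (auto intro: continuous_on_exp)
next
  case (Suc k)
  show ?case
  proof (rule Ck_on_SucI[where f' = "\<lambda>x v. frechet_derivative f (at x) v * exp (f x)"])
    show "((\<lambda>x. exp (f x)) has_derivative (\<lambda>v. frechet_derivative f (at x) v * exp (f x))) (at x)"
      if "x \<in> S" for x
      using has_derivative_exp[OF Ck_on_has_derivative[OF Suc.prems that]] by simp
    show "Ck_on k S (\<lambda>x. frechet_derivative f (at x) v * exp (f x))" for v
      by (intro Ck_on_bounded_bilinear[OF bounded_bilinear_mult] Suc.IH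
          Ck_on_derivative[OF Suc.prems] Suc.prems[THEN Ck_on_Suc_imp_Ck_on] assms)
  qed (use assms in auto)
qed

lemma Ck_on_linear_pullback:
  assumes "bounded_linear L" "open S" "L ` S \<subseteq> T" "Ck_on k T f"
  shows "Ck_on k S (\<lambda>x. f (L x))"
  using assms(4)
proof (induction k arbitrary: f)
  case 0
  then show ?case using assms
    by (auto intro: continuous_on_compose2[of T] linear_continuous_on)
next
  case (Suc k)
  show ?case
  proof (rule Ck_on_SucI[where f' = "\<lambda>x v. frechet_derivative f (at (L x)) (L v)"])
    show "((\<lambda>x. f (L x)) has_derivative (\<lambda>v. frechet_derivative f (at (L x)) (L v))) (at x)"
      if "x \<in> S" for x
    proof -
      have "(f has_derivative frechet_derivative f (at (L x))) (at (L x))"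
        using that assms(3) by (intro Ck_on_has_derivative[OF Suc.prems]) auto
      from has_derivative_compose[OF bounded_linear_imp_has_derivative[OF assms(1)] this]
      show ?thesis by simp
    qed
    show "Ck_on k S (\<lambda>x. frechet_derivative f (at (L x)) (L v))" for v
      by (intro Suc.IH Ck_on_derivative[OF Suc.prems])
  qed (rule assms)
qed

lemma smooth_on_cong:
  assumes "open S" "\<And>y. y \<in> S \<Longrightarrow> f y = g y" "smooth_on S f"
  shows "smooth_on S g"
  using assms Ck_on_cong unfolding smooth_on_def by blast

lemma smooth_on_subset: "smooth_on S f \<Longrightarrow> T \<subseteq> S \<Longrightarrow> smooth_on T f"
  using Ck_on_subset unfolding smooth_on_def by blast

lemma smooth_on_const: "open S \<Longrightarrow> smooth_on S (\<lambda>x. c)"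
  by (simp add: smooth_on_def Ck_on_const)

lemma smooth_on_bounded_linear:
  "bounded_linear L \<Longrightarrow> open S \<Longrightarrow> smooth_on S f \<Longrightarrow> smooth_on S (\<lambda>x. L (f x))"
  by (simp add: smooth_on_def Ck_on_bounded_linear)

lemma smooth_on_Pair:
  "open S \<Longrightarrow> smooth_on S f \<Longrightarrow> smooth_on S g \<Longrightarrow> smooth_on S (\<lambda>x. (f x, g x))"
  by (simp add: smooth_on_def Ck_on_Pair)

lemma smooth_on_add:
  "open S \<Longrightarrow> smooth_on S f \<Longrightarrow> smooth_on S g \<Longrightarrow> smooth_on S (\<lambda>x. f x + g x)"
  by (simp add: smooth_on_def Ck_on_add)

lemma smooth_on_bounded_bilinear:
  "bounded_bilinear B \<Longrightarrow> open S \<Longrightarrow> smooth_on S f \<Longrightarrow> smooth_on S g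
    \<Longrightarrow> smooth_on S (\<lambda>x. B (f x) (g x))"
  by (simp add: smooth_on_def Ck_on_bounded_bilinear)

lemmas smooth_on_mult = smooth_on_bounded_bilinear[OF bounded_bilinear_mult]
lemmas smooth_on_scaleR = smooth_on_bounded_bilinear[OF bounded_bilinear_scaleR]

lemma smooth_on_minus: "open S \<Longrightarrow> smooth_on S f \<Longrightarrow> smooth_on S (\<lambda>x. - f x)"
  by (rule smooth_on_bounded_linear[OF bounded_linear_minus[OF bounded_linear_ident]])

lemma smooth_on_diff:
  "open S \<Longrightarrow> smooth_on S f \<Longrightarrow> smooth_on S g \<Longrightarrow> smooth_on S (\<lambda>x. f x - g x)"
  using smooth_on_add[of S f "\<lambda>x. - g x"] smooth_on_minus[of S g] by simp

lemma smooth_on_exp: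
  fixes f :: "'a::euclidean_space \<Rightarrow> real"
  shows "open S \<Longrightarrow> smooth_on S f \<Longrightarrow> smooth_on S (\<lambda>x. exp (f x))"
  by (simp add: smooth_on_def Ck_on_exp)

lemma smooth_on_linear_pullback:
  "bounded_linear L \<Longrightarrow> open S \<Longrightarrow> L ` S \<subseteq> T \<Longrightarrow> smooth_on T f \<Longrightarrow> smooth_on S (\<lambda>x. f (L x))"
  by (simp add: smooth_on_def Ck_on_linear_pullback)

lemma smooth_on_frechet_derivative:
  "smooth_on S f \<Longrightarrow> smooth_on S (\<lambda>x. frechet_derivative f (at x) v)"
  using Ck_on_derivative unfolding smooth_on_def by blast

lemma smooth_on_imp_differentiable: "smooth_on S f \<Longrightarrow> x \<in> S \<Longrightarrow> f differentiable (at x)"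
  unfolding smooth_on_def using Ck_on.simps(2)[of 0 S f] by blast

lemma smooth_on_imp_has_derivative:
  "smooth_on S f \<Longrightarrow> x \<in> S \<Longrightarrow> (f has_derivative frechet_derivative f (at x)) (at x)"
  by (simp add: frechet_derivative_works[symmetric] smooth_on_imp_differentiable)

lemma smooth_on_imp_continuous_on: "smooth_on S f \<Longrightarrow> continuous_on S f"
  unfolding smooth_on_def using Ck_on.simps(1)[of S f] by blast

lemma linear_frechet_derivative_smooth:
  "smooth_on S f \<Longrightarrow> x \<in> S \<Longrightarrow> linear (frechet_derivative f (at x))"
  by (simp add: linear_frechet_derivative smooth_on_imp_differentiable)

text \<open>Two applications of the mean value theorem, first in the direction \<open>u\<close> and then in the direction
\<open>v\<close>.  The second difference on the left is symmetric in \<open>u\<close> and \<open>v\<close>.\<close>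

lemma second_difference_mean_value:
  fixes f :: "'a::euclidean_space \<Rightarrow> real"
  assumes f: "smooth_on S f" and "ball x e \<subseteq> S" and h: "0 < h" "h * (norm u + norm v) < e"
  shows "\<exists>p\<in>ball x e. f (x + h *\<^sub>R u + h *\<^sub>R v) - f (x + h *\<^sub>R v) - f (x + h *\<^sub>R u) + f x =
    h * h * frechet_derivative (\<lambda>y. frechet_derivative f (at y) u) (at p) v"
proof -
  have inside: "x + a *\<^sub>R u + b *\<^sub>R v \<in> ball x e" if "0 \<le> a" "a \<le> h" "0 \<le> b" "b \<le> h" for a b
  proof -
    have "norm (a *\<^sub>R u + b *\<^sub>R v) \<le> a * norm u + b * norm v"
      using that by (metis norm_triangle_ineq norm_scaleR abs_of_nonneg)
    also have "\<dots> \<le> h * (norm u + norm v)"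
      using that by (simp add: distrib_left add_mono mult_right_mono)
    finally have "norm (a *\<^sub>R u + b *\<^sub>R v) < e" using h by simp
    then show ?thesis by (simp add: dist_norm add.assoc norm_minus_commute del: minus_add_distrib)
  qed
  have deriv: "DERIV (\<lambda>a. F (y + a *\<^sub>R w)) a :> frechet_derivative F (at (y + a *\<^sub>R w)) w"
    if "smooth_on S F" "y + a *\<^sub>R w \<in> ball x e" for F :: "'a \<Rightarrow> real" and y w a
  proof -
    have "(F has_derivative frechet_derivative F (at (y + a *\<^sub>R w))) (at (y + a *\<^sub>R w))"
      using that assms(2) by (auto intro: smooth_on_imp_has_derivative)
    moreover have "((\<lambda>a. y + a *\<^sub>R w) has_derivative (\<lambda>t. t *\<^sub>R w)) (at a)"
      by (auto intro!: derivative_eq_intros)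
    ultimately have "((\<lambda>a. F (y + a *\<^sub>R w)) has_derivative
        (\<lambda>t. frechet_derivative F (at (y + a *\<^sub>R w)) (t *\<^sub>R w))) (at a)"
      by (rule has_derivative_compose[rotated])
    moreover have "linear (frechet_derivative F (at (y + a *\<^sub>R w)))"
      using that assms(2) by (auto intro: linear_frechet_derivative_smooth)
    then have "(\<lambda>t. frechet_derivative F (at (y + a *\<^sub>R w)) (t *\<^sub>R w))
        = (*) (frechet_derivative F (at (y + a *\<^sub>R w)) w)"
      by (simp add: linear_cmul fun_eq_iff mult.commute)
    ultimately show ?thesis by (simp add: has_field_derivative_def)
  qed
  let ?f = "\<lambda>y. frechet_derivative f (at y) u"
  have "\<exists>a>0. a < h \<and> (\<lambda>a. f (x + h *\<^sub>R v + a *\<^sub>R u) - f (x + a *\<^sub>R u)) h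
      - (\<lambda>a. f (x + h *\<^sub>R v + a *\<^sub>R u) - f (x + a *\<^sub>R u)) 0
      = (h - 0) * (?f (x + h *\<^sub>R v + a *\<^sub>R u) - ?f (x + a *\<^sub>R u))"
  proof (rule MVT2[OF h(1)], rule DERIV_diff)
    fix a :: real assume a: "0 \<le> a" "a \<le> h"
    show "DERIV (\<lambda>a. f (x + h *\<^sub>R v + a *\<^sub>R u)) a :> ?f (x + h *\<^sub>R v + a *\<^sub>R u)"
      using deriv[OF f, of "x + h *\<^sub>R v" a u] inside[of a h] a h by (simp add: ac_simps)
    show "DERIV (\<lambda>a. f (x + a *\<^sub>R u)) a :> ?f (x + a *\<^sub>R u)"
      using deriv[OF f, of x a u] inside[of a 0] a h by simp
  qed
  then obtain a where a: "0 < a" "a < h" and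
    eq1: "f (x + h *\<^sub>R u + h *\<^sub>R v) - f (x + h *\<^sub>R v) - f (x + h *\<^sub>R u) + f x
      = h * (?f (x + a *\<^sub>R u + h *\<^sub>R v) - ?f (x + a *\<^sub>R u))"
    by (auto simp: ac_simps algebra_simps)
  have "\<exists>b>0. b < h \<and> ?f (x + a *\<^sub>R u + h *\<^sub>R v) - ?f (x + a *\<^sub>R u + 0 *\<^sub>R v)
      = (h - 0) * frechet_derivative ?f (at (x + a *\<^sub>R u + b *\<^sub>R v)) v"
  proof (rule MVT2[OF h(1)])
    fix b :: real assume b: "0 \<le> b" "b \<le> h"
    show "DERIV (\<lambda>b. ?f (x + a *\<^sub>R u + b *\<^sub>R v)) b
        :> frechet_derivative ?f (at (x + a *\<^sub>R u + b *\<^sub>R v)) v"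
      using inside[of a b] a b by (intro deriv smooth_on_frechet_derivative f) auto
  qed
  then obtain b where b: "0 < b" "b < h" and
    eq2: "?f (x + a *\<^sub>R u + h *\<^sub>R v) - ?f (x + a *\<^sub>R u)
      = h * frechet_derivative ?f (at (x + a *\<^sub>R u + b *\<^sub>R v)) v"
    by auto
  show ?thesis
    using eq1 eq2 inside[of a b] a b by (intro bexI[of _ "x + a *\<^sub>R u + b *\<^sub>R v"]) auto
qed

text \<open>If the two mixed derivatives differed at \<open>x\<close>, then by continuity all values of the one near \<open>x\<close>
would differ from all values of the other; but both are equal to the same second difference,
divided by \<open>h\<^sup>2\<close>, at suitable points near \<open>x\<close>.\<close>

lemma second_derivative_symmetric:
  fixes f :: "'a::euclidean_space \<Rightarrow> real"
  assumes "smooth_on S f" "open S" "x \<in> S"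
  shows "frechet_derivative (\<lambda>y. frechet_derivative f (at y) u) (at x) v =
    frechet_derivative (\<lambda>y. frechet_derivative f (at y) v) (at x) u"
proof (rule ccontr)
  let ?A = "\<lambda>p. frechet_derivative (\<lambda>y. frechet_derivative f (at y) u) (at p) v"
  let ?B = "\<lambda>p. frechet_derivative (\<lambda>y. frechet_derivative f (at y) v) (at p) u"
  define d where "d = dist (?A x) (?B x) / 2"
  assume "?A x \<noteq> ?B x"
  then have "d > 0" by (simp add: d_def)
  have "continuous_on S ?A" "continuous_on S ?B"
    by (intro smooth_on_imp_continuous_on smooth_on_frechet_derivative assms)+
  then have "isCont ?A x" "isCont ?B x"
    using assms(2,3) by (auto simp: continuous_on_eq_continuous_at)
  then have "(?A \<longlongrightarrow> ?A x) (nhds x)" "(?B \<longlongrightarrow> ?B x) (nhds x)"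
    using tendsto_at_iff_tendsto_nhds[of ?A x] tendsto_at_iff_tendsto_nhds[of ?B x]
    unfolding isCont_def by blast+
  then have "eventually (\<lambda>p. dist (?A p) (?A x) < d \<and> dist (?B p) (?B x) < d) (nhds x)"
    using \<open>d > 0\<close> by (intro eventually_conj tendstoD)
  moreover have "eventually (\<lambda>p. p \<in> S) (nhds x)"
    using assms(2,3) by (simp add: eventually_nhds_in_open)
  ultimately have "eventually (\<lambda>p. p \<in> S \<and> dist (?A p) (?A x) < d \<and> dist (?B p) (?B x) < d) (nhds x)"
    by eventually_elim auto
  then obtain e where e: "e > 0"
    "\<And>p. dist p x < e \<Longrightarrow> p \<in> S \<and> dist (?A p) (?A x) < d \<and> dist (?B p) (?B x) < d"
    unfolding eventually_nhds_metric by blast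
  then have sub: "ball x e \<subseteq> S" by (auto simp: dist_commute)
  \<comment> \<open>The summand 1 only avoids a division by zero.\<close>
  define h where "h = e / (2 * (norm u + norm v + 1))"
  have pos: "norm u + norm v + 1 > 0" by (smt (verit) norm_ge_zero)
  then have "h > 0" using e by (simp add: h_def)
  have "h * (norm u + norm v) \<le> h * (norm u + norm v + 1)" using \<open>h > 0\<close> by (simp add: mult_left_mono)
  also have "\<dots> = e / 2" using pos by (simp add: h_def divide_simps)
  finally have small: "h * (norm u + norm v) < e" using e by simp
  obtain p where p: "p \<in> ball x e" "f (x + h *\<^sub>R u + h *\<^sub>R v) - f (x + h *\<^sub>R v) - f (x + h *\<^sub>R u) + f x
      = h * h * ?A p"
    using second_difference_mean_value[OF assms(1) sub \<open>h > 0\<close> small] by blast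
  obtain q where q: "q \<in> ball x e" "f (x + h *\<^sub>R v + h *\<^sub>R u) - f (x + h *\<^sub>R u) - f (x + h *\<^sub>R v) + f x
      = h * h * ?B q"
    using second_difference_mean_value[OF assms(1) sub \<open>h > 0\<close>, of v u] small
    by (metis add.commute)
  have comm: "x + h *\<^sub>R v + h *\<^sub>R u = x + h *\<^sub>R u + h *\<^sub>R v" by simp
  have "h * h * ?A p = h * h * ?B q" using p(2) q(2)[unfolded comm] by linarith
  then have "?A p = ?B q" using \<open>h > 0\<close> by simp
  moreover have "dist (?A x) (?A p) < d" "dist (?B q) (?B x) < d"
    using e(2)[of p] e(2)[of q] p(1) q(1) by (simp_all add: dist_commute)
  ultimately show False
    using dist_triangle[of "?A x" "?B x" "?A p"] unfolding d_def by simp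
qed

section \<open>Derivatives of families of linear forms\<close>

abbreviation (input) der :: "('a::real_normed_vector \<Rightarrow> 'b::real_normed_vector) \<Rightarrow> 'a \<Rightarrow> 'a \<Rightarrow> 'b" where
  "der f x \<equiv> frechet_derivative f (at x)"

lemma der_unique: "(f has_derivative f') (at x) \<Longrightarrow> der f x = f'"
  using frechet_derivative_at by metis

lemma linear_sum_Basis:
  fixes f :: "'a::euclidean_space \<Rightarrow> 'b::real_vector"
  assumes "linear f"
  shows "f v = (\<Sum>b\<in>Basis. (v \<bullet> b) *\<^sub>R f b)"
proof -
  have "f v = f (\<Sum>b\<in>Basis. (v \<bullet> b) *\<^sub>R b)" by (simp add: euclidean_representation)
  then show ?thesis using assms by (simp only: linear_sum linear_cmul o_def)
qed

text \<open>The Leibniz rule for a field of linear forms applied to a field of vectors, when the forms are only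
known through their values on constant vectors; the proof expands the vectors in the basis.\<close>

lemma form_has_derivative:
  fixes A :: "'a::euclidean_space \<Rightarrow> 'b::euclidean_space \<Rightarrow> real"
  assumes S: "open S" "x \<in> S" and lin: "\<And>y. y \<in> S \<Longrightarrow> linear (A y)"
    and diff: "\<And>w. (\<lambda>y. A y w) differentiable (at x)" and h: "(h has_derivative h') (at x)"
  shows "((\<lambda>y. A y (h y)) has_derivative (\<lambda>u. der (\<lambda>y. A y (h x)) x u + A x (h' u))) (at x)"
proof -
  have A: "((\<lambda>y. A y w) has_derivative der (\<lambda>y. A y w) x) (at x)" for w
    using diff frechet_derivative_works by blast
  have expand: "((\<lambda>y. A y (k y)) has_derivative
      (\<lambda>u. \<Sum>b\<in>Basis. (k x \<bullet> b) * der (\<lambda>y. A y b) x u + (k' u \<bullet> b) * A x b)) (at x)"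
    if k: "(k has_derivative k') (at x)" for k k'
  proof (rule has_derivative_transform_within_open[OF _ S])
    show "((\<lambda>y. \<Sum>b\<in>Basis. (k y \<bullet> b) * A y b) has_derivative
        (\<lambda>u. \<Sum>b\<in>Basis. (k x \<bullet> b) * der (\<lambda>y. A y b) x u + (k' u \<bullet> b) * A x b)) (at x)"
      by (intro has_derivative_sum has_derivative_mult has_derivative_inner_left k A)
    show "(\<Sum>b\<in>Basis. (k y \<bullet> b) * A y b) = A y (k y)" if "y \<in> S" for y
      using linear_sum_Basis[OF lin[OF that], of "k y"] by simp
  qed
  have "der (\<lambda>y. A y (h x)) x u = (\<Sum>b\<in>Basis. (h x \<bullet> b) * der (\<lambda>y. A y b) x u)" for u
    using der_unique[OF expand[OF has_derivative_const[of "h x"]]] by simp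
  moreover have "A x (h' u) = (\<Sum>b\<in>Basis. (h' u \<bullet> b) * A x b)" for u
    using linear_sum_Basis[OF lin[OF S(2)], of "h' u"] by simp
  ultimately show ?thesis using expand[OF h] by (simp add: sum.distrib)
qed

lemma Ck_on_form:
  fixes A :: "'a::euclidean_space \<Rightarrow> 'b::euclidean_space \<Rightarrow> real"
  assumes "open S" "\<And>y. y \<in> S \<Longrightarrow> linear (A y)"
    and "\<And>w. Ck_on k S (\<lambda>y. A y w)" "Ck_on k S h"
  shows "Ck_on k S (\<lambda>y. A y (h y))"
proof (rule Ck_on_cong[OF assms(1)])
  have sum: "Ck_on k S (\<lambda>y. \<Sum>b\<in>B. (h y \<bullet> b) * A y b)" if "finite B" for B
    using that
  proof (induction B rule: finite_induct)
    case empty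
    show ?case by (simp add: Ck_on_const assms)
  next
    case (insert b B)
    have "Ck_on k S (\<lambda>y. (h y \<bullet> b) * A y b + (\<Sum>b\<in>B. (h y \<bullet> b) * A y b))"
      by (intro Ck_on_add insert.IH Ck_on_bounded_bilinear[OF bounded_bilinear_mult] assms
          Ck_on_bounded_linear[OF bounded_linear_inner_left])
    then show ?case using insert by simp
  qed
  show "Ck_on k S (\<lambda>y. \<Sum>b\<in>Basis. (h y \<bullet> b) * A y b)" by (rule sum) simp
  show "(\<Sum>b\<in>Basis. (h y \<bullet> b) * A y b) = A y (h y)" if "y \<in> S" for y
    using linear_sum_Basis[OF assms(2)[OF that], of "h y"] by simp
qed

lemma smooth_on_form:
  fixes A :: "'a::euclidean_space \<Rightarrow> 'b::euclidean_space \<Rightarrow> real"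
  assumes "open S" "\<And>y. y \<in> S \<Longrightarrow> linear (A y)"
    and "\<And>w. smooth_on S (\<lambda>y. A y w)" "smooth_on S h"
  shows "smooth_on S (\<lambda>y. A y (h y))"
  using assms Ck_on_form unfolding smooth_on_def by blast

lemma linear_der_form:
  fixes A :: "'a::real_normed_vector \<Rightarrow> 'b::real_vector \<Rightarrow> 'c::real_normed_vector"
  assumes S: "open S" "x \<in> S" and lin: "\<And>y. y \<in> S \<Longrightarrow> linear (A y)"
    and diff: "\<And>w. (\<lambda>y. A y w) differentiable (at x)"
  shows "linear (\<lambda>w. der (\<lambda>y. A y w) x u)"
proof (rule linearI)
  have A: "((\<lambda>y. A y w) has_derivative der (\<lambda>y. A y w) x) (at x)" for w
    using diff frechet_derivative_works by blast
  fix w w' :: 'b and c :: real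
  have "((\<lambda>y. A y (w + w')) has_derivative
    (\<lambda>u. der (\<lambda>y. A y w) x u + der (\<lambda>y. A y w') x u)) (at x)"
    by (rule has_derivative_transform_within_open[OF has_derivative_add[OF A A] S])
      (simp add: linear_add[OF lin])
  then show "der (\<lambda>y. A y (w + w')) x u = der (\<lambda>y. A y w) x u + der (\<lambda>y. A y w') x u"
    using der_unique by metis
  have "((\<lambda>y. A y (c *\<^sub>R w)) has_derivative (\<lambda>u. c *\<^sub>R der (\<lambda>y. A y w) x u)) (at x)"
    by (rule has_derivative_transform_within_open[OF has_derivative_scaleR_right[OF A] S])
      (simp add: linear_cmul[OF lin])
  then show "der (\<lambda>y. A y (c *\<^sub>R w)) x u = c *\<^sub>R der (\<lambda>y. A y w) x u"
    using der_unique by metis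
qed

lemma der_has_derivative: "f differentiable (at x) \<Longrightarrow> (f has_derivative der f x) (at x)"
  using frechet_derivative_works by blast

lemma der_add:
  assumes "f differentiable (at x)" "g differentiable (at x)"
  shows "der (\<lambda>y. f y + g y) x u = der f x u + der g x u"
  by (rule fun_cong[OF der_unique]) (intro has_derivative_add der_has_derivative assms)

lemma der_bounded_linear:
  assumes "bounded_linear L" "f differentiable (at x)"
  shows "der (\<lambda>y. L (f y)) x u = L (der f x u)"
  by (rule fun_cong[OF der_unique])
    (intro bounded_linear.has_derivative[OF assms(1)] der_has_derivative assms)

lemmas der_scaleR_const = der_bounded_linear[OF bounded_linear_scaleR_right]

lemma has_derivative_compose_fst:
  assumes "h differentiable (at x)"
  shows "((\<lambda>p. h (fst p)) has_derivative (\<lambda>u. der h x (fst u))) (at (x, y))"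
proof -
  have "(fst has_derivative fst) (at (x, y))" by (rule has_derivative_fst[OF has_derivative_ident])
  from has_derivative_compose[OF this, of h "der h x"] show ?thesis
    using der_has_derivative[OF assms] by simp
qed

lemma has_derivative_compose_snd:
  assumes "h differentiable (at y)"
  shows "((\<lambda>p. h (snd p)) has_derivative (\<lambda>u. der h y (snd u))) (at (x, y))"
proof -
  have "(snd has_derivative snd) (at (x, y))" by (rule has_derivative_snd[OF has_derivative_ident])
  from has_derivative_compose[OF this, of h "der h y"] show ?thesis
    using der_has_derivative[OF assms] by simp
qed

lemma sum_linear_inner_Basis:
  fixes f :: "'a::euclidean_space \<Rightarrow> real"
  assumes "linear f"
  shows "(\<Sum>b\<in>Basis. f b * (v \<bullet> b)) = f v"
  using linear_sum_Basis[OF assms, of v] by (simp add: mult.commute)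

lemma sum_Basis_prod:
  fixes f :: "'a::euclidean_space \<times> 'b::euclidean_space \<Rightarrow> real"
  shows "(\<Sum>b\<in>Basis. f b) = (\<Sum>b\<in>Basis. f (b, 0)) + (\<Sum>b\<in>Basis. f (0, b))"
proof -
  have "inj_on (\<lambda>u. (u::'a, 0::'b)) Basis" "inj_on (\<lambda>u. (0::'a, u::'b)) Basis"
    by (auto intro!: inj_onI)
  then show ?thesis
    unfolding Basis_prod_def by (subst sum.union_disjoint) (auto simp: sum.reindex)
qed

section \<open>Inner products and raising of indices\<close>

definition inner_form :: "('e::euclidean_space \<Rightarrow> 'e \<Rightarrow> real) \<Rightarrow> bool" where
  "inner_form h \<longleftrightarrow> bilinear h \<and> (\<forall>u v. h u v = h v u) \<and> (\<forall>u. u \<noteq> 0 \<longrightarrow> h u u > 0)"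

lemma inner_form_bilinear: "inner_form h \<Longrightarrow> bilinear h"
  and inner_form_sym: "inner_form h \<Longrightarrow> h u v = h v u"
  and inner_form_pos: "inner_form h \<Longrightarrow> u \<noteq> 0 \<Longrightarrow> h u u > 0"
  by (auto simp: inner_form_def)

lemma inner_form_linear:
  assumes "inner_form h"
  shows "linear (h u)" "linear (\<lambda>u. h u v)"
  using inner_form_bilinear[OF assms] by (auto simp: bilinear_def)

lemma inner_form_eqI:
  assumes "inner_form h" "\<And>w. h z w = h z' w"
  shows "z = z'"
proof (rule ccontr)
  assume "z \<noteq> z'"
  then have "h (z - z') (z - z') > 0" using inner_form_pos[OF assms(1)] by simp
  moreover have "h (z - z') (z - z') = 0"
    using assms(2) by (simp add: linear_diff[OF inner_form_linear(2)[OF assms(1)]])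
  ultimately show False by simp
qed

text \<open>A non-degenerate form identifies the space with its dual: \<open>z \<mapsto> h z\<close>, read in the
basis, is an injective endomorphism and hence surjective.\<close>

lemma inner_form_represents:
  fixes h :: "'e::euclidean_space \<Rightarrow> 'e \<Rightarrow> real"
  assumes h: "inner_form h" and \<alpha>: "linear \<alpha>"
  shows "\<exists>z. \<forall>w. h z w = \<alpha> w"
proof -
  define L where "L z = (\<Sum>b\<in>Basis. h z b *\<^sub>R b)" for z
  have Lb: "L z \<bullet> b = h z b" if "b \<in> Basis" for z b
    using that by (simp add: L_def inner_sum_left inner_Basis if_distrib cong: if_cong)
  have "linear L"
    unfolding L_def
    by (rule linearI) (simp_all add: linear_add[OF inner_form_linear(2)[OF h]]
        linear_cmul[OF inner_form_linear(2)[OF h]] scaleR_add_left sum.distrib scaleR_sum_right)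
  moreover have "inj L"
  proof (rule injI, rule inner_form_eqI[OF h])
    fix z z' w assume "L z = L z'"
    then have "h z b = h z' b" if "b \<in> Basis" for b using Lb that by metis
    then show "h z w = h z' w"
      using linear_sum_Basis[OF inner_form_linear(1)[OF h], of z w]
        linear_sum_Basis[OF inner_form_linear(1)[OF h], of z' w] by simp
  qed
  ultimately have "surj L" by (rule linear_injective_imp_surjective) simp
  then obtain z where z: "L z = (\<Sum>b\<in>Basis. \<alpha> b *\<^sub>R b)" by (metis surjD)
  have "h z b = \<alpha> b" if "b \<in> Basis" for b
    using Lb[OF that, of z] that
    by (simp add: z inner_sum_left inner_Basis if_distrib cong: if_cong)
  then have "h z w = \<alpha> w" for w
    using linear_sum_Basis[OF inner_form_linear(1)[OF h], of z w] linear_sum_Basis[OF \<alpha>, of w]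
    by simp
  then show ?thesis by blast
qed

lemma sharp_eqI:
  assumes "inner_form (G x)" "\<And>w. G x z w = \<alpha> w"
  shows "sharp G x \<alpha> = z"
  unfolding sharp_def by (rule the_equality) (use assms inner_form_eqI in force)+

lemma sharp_works:
  assumes "inner_form (G x)" "linear \<alpha>"
  shows "G x (sharp G x \<alpha>) w = \<alpha> w"
  using inner_form_represents[OF assms] sharp_eqI[of G x _ \<alpha>, OF assms(1)] by metis

text \<open>The constant is the minimum of the form on the compact unit sphere.\<close>

lemma inner_form_coercive:
  fixes h :: "'e::euclidean_space \<Rightarrow> 'e \<Rightarrow> real"
  assumes "inner_form h"
  obtains c where "c > 0" "\<And>u. h u u \<ge> c * (norm u)\<^sup>2"
proof -
  have "bounded_bilinear h"
    using inner_form_bilinear[OF assms] bilinear_conv_bounded_bilinear by blast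
  then have "continuous_on (sphere 0 1) (\<lambda>u. h u u)"
    by (rule bounded_bilinear.continuous_on) (auto intro: continuous_intros)
  then obtain u0 where u0: "u0 \<in> sphere 0 1" "\<And>u. u \<in> sphere 0 1 \<Longrightarrow> h u0 u0 \<le> h u u"
    using continuous_attains_inf[of "sphere 0 1" "\<lambda>u. h u u"] by auto
  show thesis
  proof
    show "h u0 u0 > 0" using u0(1) by (intro inner_form_pos[OF assms]) auto
    show "h u0 u0 * (norm u)\<^sup>2 \<le> h u u" for u
    proof (cases "u = 0")
      case False
      then have "h u0 u0 \<le> h (u /\<^sub>R norm u) (u /\<^sub>R norm u)" by (intro u0) simp
      also have "\<dots> = h u u / (norm u)\<^sup>2"
        by (simp add: linear_cmul[OF inner_form_linear(1)[OF assms]]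
            linear_cmul[OF inner_form_linear(2)[OF assms]] power2_eq_square field_simps)
      finally show ?thesis using False by (simp add: field_simps)
    qed (simp add: linear_0[OF inner_form_linear(1)[OF assms]])
  qed
qed

lemma sharp_scaled:
  assumes "inner_form (G x)" "linear \<alpha>" "\<And>u v. G' x u v = exp (2 * a) * G x u v"
  shows "sharp G' x \<alpha> = exp (- 2 * a) *\<^sub>R sharp G x \<alpha>"
proof (rule sharp_eqI)
  have "G' x = (\<lambda>u v. exp (2 * a) * G x u v)" using assms(3) by blast
  then show "inner_form (G' x)"
    using assms(1) unfolding inner_form_def bilinear_def linear_iff by (simp add: algebra_simps)
  show "G' x (exp (- 2 * a) *\<^sub>R sharp G x \<alpha>) w = \<alpha> w" for w
    by (simp add: assms(3) linear_cmul[OF inner_form_linear(2)[OF assms(1)]] sharp_works[of G x, OF assms(1,2)]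
        flip: exp_add mult.assoc)
qed

lemma sharp_add:
  assumes "inner_form (G x)" "linear \<alpha>" "linear \<beta>"
  shows "sharp G x (\<lambda>v. \<alpha> v + \<beta> v) = sharp G x \<alpha> + sharp G x \<beta>"
  by (rule sharp_eqI[of G x, OF assms(1)])
    (simp add: linear_add[OF inner_form_linear(2)[OF assms(1)]] sharp_works[of G x, OF assms(1)] assms)

lemma sharp_zero: "inner_form (G x) \<Longrightarrow> sharp G x (\<lambda>v. 0) = 0"
  by (rule sharp_eqI) (simp_all add: linear_0[OF inner_form_linear(2)])

lemma sharp_pairing_sym:
  assumes "inner_form (G x)" "linear \<alpha>" "linear \<beta>"
  shows "\<alpha> (sharp G x \<beta>) = \<beta> (sharp G x \<alpha>)"
  using sharp_works[of G x, OF assms(1,2), of "sharp G x \<beta>"] sharp_works[of G x, OF assms(1,3), of "sharp G x \<alpha>"]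
    inner_form_sym[OF assms(1)] by metis

section \<open>Riemannian metrics on open sets\<close>

locale local_metric =
  fixes S :: "'e::euclidean_space set" and G :: "'e local_metric"
  assumes open_S: "open S"
    and form: "x \<in> S \<Longrightarrow> inner_form (G x)"
    and smooth: "smooth_on S (\<lambda>x. G x u v)"
begin

lemmas lin_right = inner_form_linear(1)[OF form]
  and lin_left = inner_form_linear(2)[OF form]
  and sym = inner_form_sym[OF form]
  and sharp = sharp_works[of G, OF form]
  and sharp_unique = sharp_eqI[of G, OF form]
  and form_eqI = inner_form_eqI[OF form]

text \<open>Uniform ellipticity near a point: the form at \<open>y\<close> is at least half as coercive as the form at \<open>x\<close>
once their coefficients are close, so that raising an index is bounded by the same constant for
all \<open>y\<close> near \<open>x\<close>.\<close>

lemma sharp_bounded: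
  assumes "x \<in> S"
  shows "\<exists>K. eventually (\<lambda>y. y \<in> S \<and>
    (\<forall>\<alpha>. linear \<alpha> \<longrightarrow> norm (sharp G y \<alpha>) \<le> K * (\<Sum>b\<in>Basis. \<bar>\<alpha> b\<bar>))) (nhds x)"
proof -
  obtain c where c: "c > 0" "\<And>u. G x u u \<ge> c * (norm u)\<^sup>2"
    using inner_form_coercive[OF form[OF assms]] by blast
  define \<epsilon> where "\<epsilon> y = (\<Sum>a\<in>Basis. \<Sum>b\<in>Basis. \<bar>G y a b - G x a b\<bar>)" for y
  have "continuous_on S \<epsilon>"
    unfolding \<epsilon>_def
    by (intro continuous_on_sum continuous_on_rabs continuous_on_diff continuous_on_const
        smooth_on_imp_continuous_on smooth)
  then have "isCont \<epsilon> x" using open_S assms by (simp add: continuous_on_eq_continuous_at)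
  then have "(\<epsilon> \<longlongrightarrow> 0) (nhds x)"
    using tendsto_at_iff_tendsto_nhds[of \<epsilon> x] by (simp add: isCont_def \<epsilon>_def)
  then have "eventually (\<lambda>y. dist (\<epsilon> y) 0 < c / 2) (nhds x)" by (rule tendstoD) (use c in simp)
  moreover have "eventually (\<lambda>y. y \<in> S) (nhds x)"
    using open_S assms by (simp add: eventually_nhds_in_open)
  ultimately have "eventually (\<lambda>y. y \<in> S \<and>
    (\<forall>\<alpha>. linear \<alpha> \<longrightarrow> norm (sharp G y \<alpha>) \<le> (2 / c) * (\<Sum>b\<in>Basis. \<bar>\<alpha> b\<bar>))) (nhds x)"
  proof eventually_elim
    case (elim y)
    show ?case
    proof (intro conjI allI impI)
      show "y \<in> S" by (rule elim)
      fix \<alpha> :: "'e \<Rightarrow> real" assume \<alpha>: "linear \<alpha>"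
      define z where "z = sharp G y \<alpha>"
      have expand: "G p z z = (\<Sum>a\<in>Basis. \<Sum>b\<in>Basis. (z \<bullet> a) * (z \<bullet> b) * G p a b)" if "p \<in> S" for p
      proof -
        have "G p z z = (\<Sum>a\<in>Basis. (z \<bullet> a) * G p a z)"
          using linear_sum_Basis[OF lin_left[OF that], of z z] by simp
        also have "\<dots> = (\<Sum>a\<in>Basis. (z \<bullet> a) * (\<Sum>b\<in>Basis. (z \<bullet> b) * G p a b))"
          by (intro sum.cong refl arg_cong2[of _ _ _ _ "(*)"])
            (use linear_sum_Basis[OF lin_right[OF that], of _ z] in simp)
        finally show ?thesis by (simp add: sum_distrib_left mult.assoc)
      qed
      have "\<bar>G y z z - G x z z\<bar>
        = \<bar>\<Sum>a\<in>Basis. \<Sum>b\<in>Basis. (z \<bullet> a) * (z \<bullet> b) * (G y a b - G x a b)\<bar>"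
        by (simp add: expand elim assms sum_subtractf right_diff_distrib)
      also have "\<dots> \<le> (\<Sum>a\<in>Basis. \<Sum>b\<in>Basis. (norm z)\<^sup>2 * \<bar>G y a b - G x a b\<bar>)"
      proof (intro order_trans[OF sum_abs] sum_mono)
        fix a b :: 'e assume "a \<in> Basis" "b \<in> Basis"
        then have "\<bar>z \<bullet> a\<bar> * \<bar>z \<bullet> b\<bar> \<le> norm z * norm z"
          by (intro mult_mono Basis_le_norm) auto
        then show "\<bar>(z \<bullet> a) * (z \<bullet> b) * (G y a b - G x a b)\<bar> \<le> (norm z)\<^sup>2 * \<bar>G y a b - G x a b\<bar>"
          by (auto simp: abs_mult power2_eq_square intro!: mult_right_mono)
      qed
      also have "\<dots> = (norm z)\<^sup>2 * \<epsilon> y" by (simp add: \<epsilon>_def sum_distrib_left)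
      also have "\<dots> \<le> (norm z)\<^sup>2 * (c / 2)" using elim by (intro mult_left_mono) auto
      finally have "\<bar>G y z z - G x z z\<bar> \<le> (norm z)\<^sup>2 * (c / 2)" .
      then have "G x z z - G y z z \<le> (norm z)\<^sup>2 * (c / 2)" by arith
      then have "c / 2 * (norm z)\<^sup>2 \<le> G y z z" using c(2)[of z] by (simp add: mult.commute)
      also have "G y z z = \<alpha> z" unfolding z_def by (rule sharp[OF elim(2) \<alpha>])
      also have "\<alpha> z = (\<Sum>b\<in>Basis. (z \<bullet> b) * \<alpha> b)" using linear_sum_Basis[OF \<alpha>, of z] by simp
      also have "\<dots> \<le> (\<Sum>b\<in>Basis. norm z * \<bar>\<alpha> b\<bar>)"
      proof (rule sum_mono)
        fix b :: 'e assume "b \<in> Basis"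
        then have "\<bar>z \<bullet> b\<bar> * \<bar>\<alpha> b\<bar> \<le> norm z * \<bar>\<alpha> b\<bar>" by (intro mult_right_mono Basis_le_norm) auto
        moreover have "(z \<bullet> b) * \<alpha> b \<le> \<bar>z \<bullet> b\<bar> * \<bar>\<alpha> b\<bar>"
          using abs_ge_self[of "(z \<bullet> b) * \<alpha> b"] by (simp only: abs_mult)
        ultimately show "(z \<bullet> b) * \<alpha> b \<le> norm z * \<bar>\<alpha> b\<bar>" by (rule order_trans[rotated])
      qed
      finally have "norm z * (c / 2 * norm z) \<le> norm z * (\<Sum>b\<in>Basis. \<bar>\<alpha> b\<bar>)"
        by (simp add: sum_distrib_left power2_eq_square mult_ac)
      then have "c / 2 * norm z \<le> (\<Sum>b\<in>Basis. \<bar>\<alpha> b\<bar>)"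
        by (cases "z = 0") (auto simp: sum_nonneg)
      then show "norm (sharp G y \<alpha>) \<le> 2 / c * (\<Sum>b\<in>Basis. \<bar>\<alpha> b\<bar>)"
        using c(1) by (simp add: z_def[symmetric] field_simps)
    qed
  qed
  then show ?thesis by blast
qed

lemma metric_differentiable:
  "x \<in> S \<Longrightarrow> (\<lambda>y. G y u v) differentiable (at x)"
  using smooth smooth_on_imp_differentiable by blast

text \<open>The difference between a raised form and any vector is itself a raised form.  Its components then
control that difference through the preceding bound.\<close>

lemma sharp_diff:
  assumes "x \<in> S" "linear \<alpha>"
  shows "linear (\<lambda>w. \<alpha> w - G x z w)" "sharp G x (\<lambda>w. \<alpha> w - G x z w) = sharp G x \<alpha> - z"
proof -
  show "linear (\<lambda>w. \<alpha> w - G x z w)" using assms lin_right by (intro linear_compose_sub) auto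
  show "sharp G x (\<lambda>w. \<alpha> w - G x z w) = sharp G x \<alpha> - z"
    by (rule sharp_unique[OF assms(1)]) (simp add: linear_diff[OF lin_left] sharp assms)
qed

lemma continuous_sharp:
  assumes "x \<in> S" and lin: "\<And>y. y \<in> S \<Longrightarrow> linear (\<alpha> y)" and cont: "\<And>w. isCont (\<lambda>y. \<alpha> y w) x"
  shows "isCont (\<lambda>y. sharp G y (\<alpha> y)) x"
proof -
  let ?z = "sharp G x (\<alpha> x)"
  obtain K where K: "eventually (\<lambda>y. y \<in> S \<and>
    (\<forall>\<alpha>. linear \<alpha> \<longrightarrow> norm (sharp G y \<alpha>) \<le> K * (\<Sum>b\<in>Basis. \<bar>\<alpha> b\<bar>))) (nhds x)"
    using sharp_bounded[OF assms(1)] by blast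
  have G: "isCont (\<lambda>y. G y u v) x" for u v
    using metric_differentiable[OF assms(1)] differentiable_imp_continuous_within by blast
  have "isCont (\<lambda>y. K * (\<Sum>b\<in>Basis. \<bar>\<alpha> y b - G y ?z b\<bar>)) x"
    by (intro continuous_intros cont G)
  then have "((\<lambda>y. K * (\<Sum>b\<in>Basis. \<bar>\<alpha> y b - G y ?z b\<bar>)) \<longlongrightarrow> 0) (at x)"
    by (simp add: isCont_def sharp[OF assms(1) lin[OF assms(1)]])
  moreover have "eventually (\<lambda>y. norm (sharp G y (\<alpha> y) - ?z) \<le>
      K * (\<Sum>b\<in>Basis. \<bar>\<alpha> y b - G y ?z b\<bar>)) (at x)"
    using filter_leD[OF at_within_le_nhds K]
  proof eventually_elim
    case (elim y)
    then have y: "y \<in> S" by blast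
    show ?case
      using elim sharp_diff(1)[OF y lin[OF y], of ?z]
      unfolding sharp_diff(2)[OF y lin[OF y], symmetric] by blast
  qed
  ultimately have "((\<lambda>y. sharp G y (\<alpha> y) - ?z) \<longlongrightarrow> 0) (at x)"
    by (rule Lim_null_comparison[rotated])
  then show ?thesis by (simp add: isCont_def LIM_zero_iff)
qed

lemma linear_der_metric:
  assumes "x \<in> S"
  shows "linear (\<lambda>w. der (\<lambda>y. G y v w) x u)" "linear (\<lambda>w. der (\<lambda>y. G y w v) x u)"
    "linear (der (\<lambda>y. G y v w) x)"
  by (intro linear_der_form[OF open_S assms] lin_right lin_left metric_differentiable assms
      linear_frechet_derivative; assumption)+

lemma der_metric_sym: "x \<in> S \<Longrightarrow> der (\<lambda>y. G y v w) x u = der (\<lambda>y. G y w v) x u"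
  using frechet_derivative_cong[OF open_S, of x "\<lambda>y. G y v w" "\<lambda>y. G y w v"] sym by simp

text \<open>Differentiating \<open>G (z, w) = \<alpha> w\<close> formally shows what the derivative of \<open>z\<close> must be; call it \<open>F\<close>.
The error of the linear approximation \<open>z + F (y - x)\<close> is a raised form, whose components vanish to
first order at \<open>x\<close> by the choice of \<open>F\<close>, and the local bound for raising indices applies.\<close>

lemma sharp_has_derivative:
  assumes x: "x \<in> S" and lin: "\<And>y. y \<in> S \<Longrightarrow> linear (\<alpha> y)"
    and diff: "\<And>w. (\<lambda>y. \<alpha> y w) differentiable (at x)"
  shows "((\<lambda>y. sharp G y (\<alpha> y)) has_derivative (\<lambda>u. sharp G x
    (\<lambda>w. der (\<lambda>y. \<alpha> y w) x u - der (\<lambda>y. G y (sharp G x (\<alpha> x)) w) x u))) (at x)"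
proof -
  define z where "z = sharp G x (\<alpha> x)"
  define \<beta> where "\<beta> u w = der (\<lambda>y. \<alpha> y w) x u - der (\<lambda>y. G y z w) x u" for u w
  have \<alpha>: "((\<lambda>y. \<alpha> y w) has_derivative der (\<lambda>y. \<alpha> y w) x) (at x)" for w
    using diff frechet_derivative_works by blast
  have lin\<alpha>: "linear (\<lambda>w. der (\<lambda>y. \<alpha> y w) x u)" for u
    by (rule linear_der_form[OF open_S x lin diff])
  have \<beta>: "linear (\<beta> u)" for u
    unfolding \<beta>_def by (intro linear_compose_sub lin\<alpha> linear_der_metric x)
  have \<beta>': "linear (\<lambda>u. \<beta> u w)" for w
    unfolding \<beta>_def
    by (intro linear_compose_sub linear_frechet_derivative diff metric_differentiable x)
  define F where "F u = sharp G x (\<beta> u)" for u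
  have GF: "G x (F u) w = \<beta> u w" for u w unfolding F_def by (rule sharp[OF x \<beta>])
  have "linear F"
    by (rule linearI; rule form_eqI[OF x])
      (simp_all add: GF linear_add[OF lin_left[OF x]] linear_cmul[OF lin_left[OF x]]
        linear_add[OF \<beta>'] linear_cmul[OF \<beta>'])
  then have F: "bounded_linear F" by (simp add: linear_conv_bounded_linear)
  \<comment> \<open>The form whose raised version is the error of the linear approximation.\<close>
  define \<phi> where "\<phi> y w = \<alpha> y w - G y (z + F (y - x)) w" for y w
  have "((\<lambda>y. \<phi> y w) has_derivative (\<lambda>u. 0)) (at x)" for w
  proof -
    have "((\<lambda>y. z + F (y - x)) has_derivative F) (at x)"
      by (rule derivative_eq_intros bounded_linear.has_derivative[OF F] refl)+ simp
    then have "((\<lambda>y. G y (z + F (y - x)) w) has_derivative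
        (\<lambda>u. der (\<lambda>y. G y (z + F (x - x)) w) x u + G x (F u) w)) (at x)"
      by (intro form_has_derivative[where A = "\<lambda>y u. G y u w", OF open_S x] lin_left
          metric_differentiable x)
    then have "((\<lambda>y. G y (z + F (y - x)) w) has_derivative
        (\<lambda>u. der (\<lambda>y. G y z w) x u + G x (F u) w)) (at x)"
      using linear_0[OF \<open>linear F\<close>] by simp
    from has_derivative_diff[OF \<alpha>[of w] this] show ?thesis
      by (simp add: \<phi>_def GF \<beta>_def)
  qed
  moreover have "\<phi> x w = 0" for w
    using linear_0[OF \<open>linear F\<close>] by (simp add: \<phi>_def z_def sharp[OF x lin[OF x]])
  ultimately have \<phi>0: "((\<lambda>y. \<phi> y w /\<^sub>R norm (y - x)) \<longlongrightarrow> 0) (at x)" for w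
    by (auto simp: has_derivative_def dest!: spec)
  obtain K where K: "eventually (\<lambda>y. y \<in> S \<and>
    (\<forall>\<alpha>. linear \<alpha> \<longrightarrow> norm (sharp G y \<alpha>) \<le> K * (\<Sum>b\<in>Basis. \<bar>\<alpha> b\<bar>))) (nhds x)"
    using sharp_bounded[OF x] by blast
  have "((\<lambda>y. K * (\<Sum>b\<in>Basis. \<bar>\<phi> y b /\<^sub>R norm (y - x)\<bar>)) \<longlongrightarrow> K * (\<Sum>b\<in>(Basis::'e set). \<bar>0\<bar>)) (at x)"
    by (intro tendsto_intros \<phi>0)
  then have "((\<lambda>y. K * (\<Sum>b\<in>Basis. \<bar>\<phi> y b /\<^sub>R norm (y - x)\<bar>)) \<longlongrightarrow> 0) (at x)" by simp
  moreover have "eventually (\<lambda>y. norm ((sharp G y (\<alpha> y) - sharp G x (\<alpha> x) - F (y - x)) /\<^sub>R norm (y - x))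
      \<le> K * (\<Sum>b\<in>Basis. \<bar>\<phi> y b /\<^sub>R norm (y - x)\<bar>)) (at x)"
    using filter_leD[OF at_within_le_nhds K]
  proof eventually_elim
    case (elim y)
    then have y: "y \<in> S" by blast
    have "norm (sharp G y (\<alpha> y) - (z + F (y - x))) \<le> K * (\<Sum>b\<in>Basis. \<bar>\<phi> y b\<bar>)"
      using elim sharp_diff(1)[OF y lin[OF y], of "z + F (y - x)"]
      unfolding \<phi>_def sharp_diff(2)[OF y lin[OF y], symmetric] by blast
    then have "norm (sharp G y (\<alpha> y) - (z + F (y - x))) / norm (y - x)
        \<le> K * (\<Sum>b\<in>Basis. \<bar>\<phi> y b\<bar>) / norm (y - x)"
      by (rule divide_right_mono) simp
    then show ?case
      by (simp add: z_def divide_inverse sum_distrib_left sum_distrib_right abs_mult mult_ac diff_diff_eq)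
  qed
  ultimately have "((\<lambda>y. (sharp G y (\<alpha> y) - sharp G x (\<alpha> x) - F (y - x)) /\<^sub>R norm (y - x)) \<longlongrightarrow> 0) (at x)"
    by (rule Lim_null_comparison[rotated])
  with F have "((\<lambda>y. sharp G y (\<alpha> y)) has_derivative F) (at x)"
    by (simp add: has_derivative_def Let_def netlimit_at_vector[of x])
  then show ?thesis unfolding F_def \<beta>_def z_def .
qed

text \<open>The derivative of a raised form is a raised form again, built from derivatives of the data and the
raised form itself, so the order of differentiability can be increased one step at a time.\<close>

lemma Ck_on_sharp:
  assumes "\<And>y. y \<in> S \<Longrightarrow> linear (\<alpha> y)" "\<And>w. Ck_on k S (\<lambda>y. \<alpha> y w)"
  shows "Ck_on k S (\<lambda>y. sharp G y (\<alpha> y))"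
  using assms
proof (induction k arbitrary: \<alpha>)
  case 0
  have "isCont (\<lambda>y. sharp G y (\<alpha> y)) x" if "x \<in> S" for x
    using 0 that open_S by (intro continuous_sharp) (auto simp: continuous_on_eq_continuous_at)
  then show ?case by (simp add: continuous_at_imp_continuous_on)
next
  case (Suc k)
  let ?z = "\<lambda>x. sharp G x (\<alpha> x)"
  let ?\<beta> = "\<lambda>u x w. der (\<lambda>y. \<alpha> y w) x u - der (\<lambda>y. G y (?z x) w) x u"
  have d: "((\<lambda>y. sharp G y (\<alpha> y)) has_derivative (\<lambda>u. sharp G x (?\<beta> u x))) (at x)" if "x \<in> S" for x
    using Suc.prems that by (intro sharp_has_derivative) auto
  have z: "Ck_on k S ?z" by (intro Suc.IH Suc.prems Ck_on_Suc_imp_Ck_on)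
  show ?case
  proof (rule Ck_on_SucI[OF open_S d])
    fix u
    show "Ck_on k S (\<lambda>x. sharp G x (?\<beta> u x))"
    proof (rule Suc.IH)
      fix w
      have "Ck_on k S (\<lambda>x. der (\<lambda>y. G y (?z x) w) x u)"
        by (rule Ck_on_form[where A = "\<lambda>x v. der (\<lambda>y. G y v w) x u"])
          (use smooth_on_frechet_derivative[OF smooth] in
            \<open>auto simp: smooth_on_def intro: open_S linear_der_metric z\<close>)
      then have "Ck_on k S (\<lambda>x. der (\<lambda>y. \<alpha> y w) x u + - 1 * der (\<lambda>y. G y (?z x) w) x u)"
        by (intro Ck_on_add Ck_on_bounded_linear[OF bounded_linear_mult_right] open_S
            Ck_on_derivative[OF Suc.prems(2)])
      then show "Ck_on k S (\<lambda>x. ?\<beta> u x w)" by simp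
    next
      fix x assume "x \<in> S"
      then show "linear (?\<beta> u x)"
        using Suc.prems by (intro linear_compose_sub linear_der_metric linear_der_form[OF open_S]) auto
    qed
  qed
qed

lemma smooth_sharp:
  assumes "\<And>y. y \<in> S \<Longrightarrow> linear (\<alpha> y)" "\<And>w. smooth_on S (\<lambda>y. \<alpha> y w)"
  shows "smooth_on S (\<lambda>y. sharp G y (\<alpha> y))"
  using assms Ck_on_sharp unfolding smooth_on_def by blast

lemma der_metric:
  assumes x: "x \<in> S" and h: "h differentiable (at x)" and k: "k differentiable (at x)"
  shows "der (\<lambda>y. G y (h y) (k y)) x u =
    der (\<lambda>y. G y (h x) (k x)) x u + G x (der h x u) (k x) + G x (h x) (der k x u)"
proof -
  have d: "(h has_derivative der h x) (at x)" "(k has_derivative der k x) (at x)"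
    using h k frechet_derivative_works by blast+
  have 1: "((\<lambda>y. G y w (k y)) has_derivative
      (\<lambda>u. der (\<lambda>y. G y w (k x)) x u + G x w (der k x u))) (at x)" for w
    by (rule form_has_derivative[OF open_S x lin_right metric_differentiable[OF x] d(2)])
  have 2: "(\<lambda>y. G y w (k y)) differentiable (at x)" for w
    by (rule differentiableI[OF 1])
  have "((\<lambda>y. G y (h y) (k y)) has_derivative
      (\<lambda>u. der (\<lambda>y. G y (h x) (k y)) x u + G x (der h x u) (k x))) (at x)"
    by (rule form_has_derivative[where A = "\<lambda>y w. G y w (k y)", OF open_S x lin_left 2 d(1)])
  then show ?thesis using der_unique[OF 1] by (simp add: der_unique)
qed

lemmas metric_simps = linear_add[OF lin_left] linear_add[OF lin_right] linear_cmul[OF lin_left]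
  linear_cmul[OF lin_right] linear_diff[OF lin_left] linear_diff[OF lin_right]
  linear_0[OF lin_left] linear_0[OF lin_right] linear_neg[OF lin_left] linear_neg[OF lin_right]

lemmas der_metric_simps = linear_add[OF linear_der_metric(1)] linear_add[OF linear_der_metric(2)]
  linear_add[OF linear_der_metric(3)] linear_cmul[OF linear_der_metric(1)]
  linear_cmul[OF linear_der_metric(2)] linear_cmul[OF linear_der_metric(3)]

lemma koszul_linear:
  assumes "x \<in> S"
  shows "linear (\<lambda>w. (der (\<lambda>y. G y v w) x u + der (\<lambda>y. G y u w) x v - der (\<lambda>y. G y u v) x w) / 2)"
  by (rule linearI) (simp_all add: der_metric_simps[OF assms] field_simps)

text \<open>The Koszul formula, with lowered index as usual; everything about the Levi-Civita connection is derived
from it.\<close>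

lemma koszul:
  assumes "x \<in> S"
  shows "G x (christoffel G x u v) w =
    (der (\<lambda>y. G y v w) x u + der (\<lambda>y. G y u w) x v - der (\<lambda>y. G y u v) x w) / 2"
  unfolding christoffel_def by (rule sharp[OF assms koszul_linear[OF assms]])

lemma christoffel_sym:
  assumes "x \<in> S"
  shows "christoffel G x u v = christoffel G x v u"
  by (rule form_eqI[OF assms])
    (simp add: koszul[OF assms] der_metric_sym[OF assms, of u v] add.commute)

lemma linear_christoffel_left:
  assumes "x \<in> S"
  shows "linear (\<lambda>u. christoffel G x u v)"
  by (rule linearI; rule form_eqI[OF assms])
    (simp_all add: metric_simps[OF assms] koszul[OF assms] der_metric_simps[OF assms] field_simps)

lemma linear_christoffel_right:
  assumes "x \<in> S"
  shows "linear (christoffel G x u)"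
  using linear_christoffel_left[OF assms, of u] by (simp only: christoffel_sym[OF assms, of _ u])

lemmas christoffel_simps = linear_add[OF linear_christoffel_left]
  linear_add[OF linear_christoffel_right] linear_cmul[OF linear_christoffel_left]
  linear_cmul[OF linear_christoffel_right] linear_diff[OF linear_christoffel_left]
  linear_diff[OF linear_christoffel_right] linear_0[OF linear_christoffel_left]
  linear_0[OF linear_christoffel_right]

lemma metric_compatible:
  assumes "x \<in> S"
  shows "der (\<lambda>y. G y v w) x u = G x (christoffel G x u v) w + G x v (christoffel G x u w)"
proof -
  have "G x v (christoffel G x u w) = G x (christoffel G x u w) v" using sym[OF assms] by simp
  then show ?thesis
    by (simp add: koszul[OF assms] der_metric_sym[OF assms, of w v] der_metric_sym[OF assms, of u v]
        der_metric_sym[OF assms, of u w] field_simps)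
qed

lemma smooth_christoffel: "smooth_on S (\<lambda>y. christoffel G y u v)"
proof -
  have "smooth_on S (\<lambda>y. sharp G y (\<lambda>w. (der (\<lambda>z. G z v w) y u + der (\<lambda>z. G z u w) y v
      - der (\<lambda>z. G z u v) y w) / 2))"
  proof (rule smooth_sharp[OF koszul_linear])
    fix w
    have "smooth_on S (\<lambda>y. (1/2) * (der (\<lambda>z. G z v w) y u + der (\<lambda>z. G z u w) y v
      - der (\<lambda>z. G z u v) y w))"
      by (intro smooth_on_mult smooth_on_const smooth_on_diff smooth_on_add open_S
          smooth_on_frechet_derivative smooth)
    then show "smooth_on S (\<lambda>y. (der (\<lambda>z. G z v w) y u + der (\<lambda>z. G z u w) y v
      - der (\<lambda>z. G z u v) y w) / 2)" by simp
  qed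
  then show ?thesis by (simp add: christoffel_def)
qed

lemma christoffel_differentiable: "x \<in> S \<Longrightarrow> (\<lambda>y. christoffel G y u v) differentiable (at x)"
  using smooth_christoffel smooth_on_imp_differentiable by blast

lemma linear_der_christoffel:
  assumes "x \<in> S"
  shows "linear (\<lambda>w. der (\<lambda>y. christoffel G y v w) x u)"
    "linear (\<lambda>v. der (\<lambda>y. christoffel G y v w) x u)"
    "linear (der (\<lambda>y. christoffel G y v w) x)"
  by (intro linear_der_form[OF open_S assms] linear_christoffel_left linear_christoffel_right
      christoffel_differentiable assms linear_frechet_derivative; assumption)+

lemma curvature_linear:
  assumes "x \<in> S"
  shows "linear (curvature G x u v)" "linear (\<lambda>v. curvature G x u v w)"
  unfolding curvature_def
  by (rule linearI;
      simp add: linear_add[OF linear_der_christoffel(1)[OF assms]]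
        linear_add[OF linear_der_christoffel(2)[OF assms]]
        linear_add[OF linear_der_christoffel(3)[OF assms]]
        linear_cmul[OF linear_der_christoffel(1)[OF assms]]
        linear_cmul[OF linear_der_christoffel(2)[OF assms]]
        linear_cmul[OF linear_der_christoffel(3)[OF assms]]
        christoffel_simps[OF assms] algebra_simps)+

lemma curvature_antisym: "curvature G x u v w = - curvature G x v u w"
  by (simp add: curvature_def)

text \<open>The metric is parallel: apply the two second derivatives to the function \<open>g (w, w)\<close> of the
point, for constant \<open>w\<close>, and use that they commute.\<close>

lemma curvature_skew:
  assumes x: "x \<in> S"
  shows "G x (curvature G x u v w) w = 0"
proof -
  let ?\<Gamma> = "christoffel G"
  have first: "der (\<lambda>y. G y w w) y v = G y (2 *\<^sub>R ?\<Gamma> y v w) w" if "y \<in> S" for v y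
    using metric_compatible[OF that, of w w v] sym[OF that, of w "?\<Gamma> y v w"]
    by (simp add: metric_simps[OF that])
  have "der (\<lambda>y. der (\<lambda>y. G y w w) y v) x u =
      2 * (G x (?\<Gamma> x u (?\<Gamma> x v w)) w + G x (?\<Gamma> x v w) (?\<Gamma> x u w)
        + G x (der (\<lambda>y. ?\<Gamma> y v w) x u) w)" for u v
  proof -
    have diff: "(\<lambda>y. 2 *\<^sub>R ?\<Gamma> y v w) differentiable (at x)"
      by (rule differentiableI[OF has_derivative_scaleR_right[OF
          der_has_derivative[OF christoffel_differentiable[OF x]]]])
    have "der (\<lambda>y. der (\<lambda>y. G y w w) y v) x u = der (\<lambda>y. G y (2 *\<^sub>R ?\<Gamma> y v w) w) x u"
      by (rule fun_cong[OF frechet_derivative_cong[OF open_S x first]])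
    also have "\<dots> = der (\<lambda>y. G y (2 *\<^sub>R ?\<Gamma> x v w) w) x u
        + G x (der (\<lambda>y. 2 *\<^sub>R ?\<Gamma> y v w) x u) w + G x (2 *\<^sub>R ?\<Gamma> x v w) (der (\<lambda>y. w) x u)"
      by (rule der_metric[OF x diff differentiable_const])
    also have "der (\<lambda>y. 2 *\<^sub>R ?\<Gamma> y v w) x u = 2 *\<^sub>R der (\<lambda>y. ?\<Gamma> y v w) x u"
      by (rule der_scaleR_const[OF christoffel_differentiable[OF x]])
    finally show ?thesis
      by (simp add: metric_compatible[OF x] metric_simps[OF x] christoffel_simps[OF x])
  qed
  from this[of v u] this[of u v] have
    "G x (?\<Gamma> x u (?\<Gamma> x v w)) w + G x (der (\<lambda>y. ?\<Gamma> y v w) x u) w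
      = G x (?\<Gamma> x v (?\<Gamma> x u w)) w + G x (der (\<lambda>y. ?\<Gamma> y u w) x v) w"
    using second_derivative_symmetric[OF smooth[of w w] open_S x, of u v]
      sym[OF x, of "?\<Gamma> x v w" "?\<Gamma> x u w"] by simp
  then show ?thesis
    by (simp add: curvature_def linear_add[OF lin_left[OF x]] linear_diff[OF lin_left[OF x]])
qed

lemma curvature_skew_adjoint:
  assumes x: "x \<in> S"
  shows "G x (curvature G x u v w) z = - G x (curvature G x u v z) w"
  using curvature_skew[OF x, of u v "w + z"] curvature_skew[OF x, of u v w] curvature_skew[OF x, of u v z]
  by (simp add: linear_add[OF lin_left[OF x]] linear_add[OF lin_right[OF x]]
      linear_add[OF curvature_linear(1)[OF x]])

lemma metric_trace_metric:
  assumes "x \<in> S"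
  shows "metric_trace G x (\<lambda>u v. k * G x u v) = k * real DIM('e)"
proof -
  have "sharp G x (\<lambda>v. k * G x u v) = k *\<^sub>R u" for u
    by (rule sharp_unique[OF assms]) (simp add: linear_cmul[OF lin_left[OF assms]])
  then show ?thesis by (simp add: metric_trace_def)
qed

text \<open>All vectors are multiples of one, and the curvature is antisymmetric in its first two arguments.\<close>

lemma ricci_dim_1:
  assumes x: "x \<in> S" and dim: "DIM('e) = 1"
  shows "ricci G x v w = 0"
proof -
  obtain e where e: "(Basis :: 'e set) = {e}" using dim card_1_singletonE by blast
  have v: "v = (v \<bullet> e) *\<^sub>R e" using euclidean_representation[of v] by (simp add: e)
  have "curvature G x e e w = 0" by (simp add: curvature_def)
  then have "curvature G x e v w = 0"
    by (subst v) (simp add: linear_cmul[OF curvature_linear(2)[OF x]])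
  then show ?thesis by (simp add: ricci_def e)
qed

text \<open>The curvature is given by the single endomorphism \<open>J = R (e\<^sub>1, e\<^sub>2)\<close>, which is skew for the metric and
therefore determined up to a factor \<open>l\<close> by the area form.  Solving for its matrix by Cramer's rule,
with the determinant \<open>D\<close> of the metric, gives the factor \<open>- l / D\<close>.\<close>

lemma ricci_dim_2:
  assumes x: "x \<in> S" and dim: "DIM('e) = 2"
  shows "\<exists>k. \<forall>v w. ricci G x v w = k * G x v w"
proof -
  obtain e\<^sub>1 e\<^sub>2 where e: "(Basis :: 'e set) = {e\<^sub>1, e\<^sub>2}" "e\<^sub>1 \<noteq> e\<^sub>2"
    using dim card_2_iff by metis
  then have ip: "e\<^sub>1 \<bullet> e\<^sub>1 = 1" "e\<^sub>2 \<bullet> e\<^sub>2 = 1" "e\<^sub>1 \<bullet> e\<^sub>2 = 0" "e\<^sub>2 \<bullet> e\<^sub>1 = 0"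
    by (metis inner_Basis insertI1 insertI2)+
  have rep: "(v \<bullet> e\<^sub>1) *\<^sub>R e\<^sub>1 + (v \<bullet> e\<^sub>2) *\<^sub>R e\<^sub>2 = v" for v
    using euclidean_representation[of v, unfolded e(1)] e(2) by simp
  define J where "J = curvature G x e\<^sub>1 e\<^sub>2"
  have linJ: "linear J" unfolding J_def by (rule curvature_linear[OF x])
  have J: "curvature G x e\<^sub>2 e\<^sub>1 w = - J w" for w
    unfolding J_def by (rule curvature_antisym)
  have zero: "curvature G x u u w = 0" for u w by (simp add: curvature_def)
  have ric: "ricci G x v w = (v \<bullet> e\<^sub>2) * (J w \<bullet> e\<^sub>1) - (v \<bullet> e\<^sub>1) * (J w \<bullet> e\<^sub>2)" for v w
  proof -
    have "curvature G x e\<^sub>1 v w = (v \<bullet> e\<^sub>2) *\<^sub>R J w"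
      by (subst rep[of v, symmetric]) (simp add: linear_add[OF curvature_linear(2)[OF x]]
          linear_cmul[OF curvature_linear(2)[OF x]] zero J_def)
    moreover have "curvature G x e\<^sub>2 v w = - (v \<bullet> e\<^sub>1) *\<^sub>R J w"
      by (subst rep[of v, symmetric]) (simp add: linear_add[OF curvature_linear(2)[OF x]]
          linear_cmul[OF curvature_linear(2)[OF x]] zero J)
    ultimately show ?thesis using e(2) by (simp add: ricci_def e(1))
  qed
  define E F H where "E = G x e\<^sub>1 e\<^sub>1" and "F = G x e\<^sub>1 e\<^sub>2" and "H = G x e\<^sub>2 e\<^sub>2"
  have Gexp: "G x v w = (v \<bullet> e\<^sub>1) * (w \<bullet> e\<^sub>1) * E + ((v \<bullet> e\<^sub>1) * (w \<bullet> e\<^sub>2) + (v \<bullet> e\<^sub>2) * (w \<bullet> e\<^sub>1)) * F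
      + (v \<bullet> e\<^sub>2) * (w \<bullet> e\<^sub>2) * H" for v w
  proof -
    have "G x v w = G x ((v \<bullet> e\<^sub>1) *\<^sub>R e\<^sub>1 + (v \<bullet> e\<^sub>2) *\<^sub>R e\<^sub>2) ((w \<bullet> e\<^sub>1) *\<^sub>R e\<^sub>1 + (w \<bullet> e\<^sub>2) *\<^sub>R e\<^sub>2)"
      using rep by metis
    then show ?thesis
      using sym[OF x, of e\<^sub>2 e\<^sub>1]
      by (simp add: linear_add[OF lin_left[OF x]] linear_add[OF lin_right[OF x]]
          linear_cmul[OF lin_left[OF x]] linear_cmul[OF lin_right[OF x]] E_def F_def H_def algebra_simps)
  qed
  define D where "D = E * H - F * F"
  have "D > 0"
  proof -
    have "H > 0" unfolding H_def using ip by (intro inner_form_pos[OF form[OF x]]) auto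
    have "0 < G x (H *\<^sub>R e\<^sub>1 - F *\<^sub>R e\<^sub>2) (H *\<^sub>R e\<^sub>1 - F *\<^sub>R e\<^sub>2)"
    proof (rule inner_form_pos[OF form[OF x]])
      show "H *\<^sub>R e\<^sub>1 - F *\<^sub>R e\<^sub>2 \<noteq> 0"
      proof
        assume "H *\<^sub>R e\<^sub>1 - F *\<^sub>R e\<^sub>2 = 0"
        then have "(H *\<^sub>R e\<^sub>1 - F *\<^sub>R e\<^sub>2) \<bullet> e\<^sub>1 = 0" by simp
        with \<open>H > 0\<close> show False by (simp add: inner_diff_left ip)
      qed
    qed
    also have "\<dots> = H * D" by (simp add: Gexp inner_diff_left ip D_def algebra_simps)
    finally show ?thesis using \<open>H > 0\<close> by (simp add: zero_less_mult_iff)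
  qed
  define l where "l = G x (J e\<^sub>1) e\<^sub>2"
  have sk: "G x (J e\<^sub>1) e\<^sub>1 = 0" "G x (J e\<^sub>2) e\<^sub>2 = 0" "G x (J e\<^sub>2) e\<^sub>1 = - l"
    using curvature_skew[OF x] curvature_skew_adjoint[OF x, of e\<^sub>1 e\<^sub>2 e\<^sub>2 e\<^sub>1] by (auto simp: J_def l_def)
  define a b a' b' where "a = J e\<^sub>1 \<bullet> e\<^sub>1" and "b = J e\<^sub>1 \<bullet> e\<^sub>2" and "a' = J e\<^sub>2 \<bullet> e\<^sub>1" and "b' = J e\<^sub>2 \<bullet> e\<^sub>2"
  have eqs: "a * E + b * F = 0" "a * F + b * H = l" "a' * E + b' * F = - l" "a' * F + b' * H = 0"
    using sk l_def by (simp_all add: Gexp[of "J e\<^sub>1"] Gexp[of "J e\<^sub>2"] ip a_def b_def a'_def b'_def)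
  have sol: "D * a = - l * F" "D * b = l * E" "D * a' = - l * H" "D * b' = l * F"
    using eqs unfolding D_def by algebra+
  have Jw: "J w \<bullet> e\<^sub>1 = (w \<bullet> e\<^sub>1) * a + (w \<bullet> e\<^sub>2) * a'" "J w \<bullet> e\<^sub>2 = (w \<bullet> e\<^sub>1) * b + (w \<bullet> e\<^sub>2) * b'" for w
  proof -
    have "J w = (w \<bullet> e\<^sub>1) *\<^sub>R J e\<^sub>1 + (w \<bullet> e\<^sub>2) *\<^sub>R J e\<^sub>2"
      by (subst rep[of w, symmetric]) (simp add: linear_add[OF linJ] linear_cmul[OF linJ])
    then show "J w \<bullet> e\<^sub>1 = (w \<bullet> e\<^sub>1) * a + (w \<bullet> e\<^sub>2) * a'" "J w \<bullet> e\<^sub>2 = (w \<bullet> e\<^sub>1) * b + (w \<bullet> e\<^sub>2) * b'"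
      by (simp_all add: inner_add_left a_def b_def a'_def b'_def)
  qed
  have "D * ricci G x v w = - l * G x v w" for v w
    unfolding ric Jw Gexp[of v w] using sol by algebra
  then have "ricci G x v w = - l / D * G x v w" for v w
    using \<open>D > 0\<close> by (metis (no_types, lifting) nonzero_mult_div_cancel_left order_less_irrefl
        times_divide_eq_left)
  then show ?thesis by blast
qed

text \<open>Two solutions differ by a multiple \<open>c\<close> of the metric.  Comparing the traces gives
\<open>(d - 2) c = - d c\<close>, hence \<open>c = 0\<close>.\<close>

lemma schouten_unique:
  assumes x: "x \<in> S" and dim: "DIM('e) \<ge> 3" and P: "\<And>u. linear (P u)"
    and ric: "\<And>u v. ricci G x u v = (real DIM('e) - 2) * P u v + metric_trace G x P * G x u v"
  shows "schouten G x = P"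
  unfolding schouten_def
proof (rule the_equality)
  show "\<forall>u v. ricci G x u v = (real DIM('e) - 2) * P u v + metric_trace G x P * G x u v"
    using ric by blast
  fix Q assume Q: "\<forall>u v. ricci G x u v = (real DIM('e) - 2) * Q u v + metric_trace G x Q * G x u v"
  define c where "c = (metric_trace G x P - metric_trace G x Q) / (real DIM('e) - 2)"
  have c: "(real DIM('e) - 2) * c = metric_trace G x P - metric_trace G x Q"
    using dim by (simp add: c_def)
  have Q_eq: "Q u v = P u v + c * G x u v" for u v
  proof -
    have "(real DIM('e) - 2) * Q u v + metric_trace G x Q * G x u v
        = (real DIM('e) - 2) * P u v + metric_trace G x P * G x u v"
      using Q ric by metis
    then have "(real DIM('e) - 2) * Q u v = (real DIM('e) - 2) * P u v
        + (metric_trace G x P - metric_trace G x Q) * G x u v"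
      by (simp add: algebra_simps)
    also have "\<dots> = (real DIM('e) - 2) * (P u v + c * G x u v)"
      by (simp add: distrib_left flip: c mult.assoc)
    finally show ?thesis using dim by simp
  qed
  have "sharp G x (Q u) = sharp G x (P u) + c *\<^sub>R u" for u
    by (rule sharp_unique[OF x]) (simp add: metric_simps[OF x] sharp[OF x P] Q_eq)
  then have "metric_trace G x Q = metric_trace G x P + c * real DIM('e)"
    by (simp add: metric_trace_def inner_add_left sum.distrib)
  with c have "c * (2 * real DIM('e) - 2) = 0" by (simp add: algebra_simps)
  with dim have "c = 0" by simp
  with Q_eq show "Q = P" by (simp add: fun_eq_iff)
qed

text \<open>Whatever the dimension, the Ricci tensor is a multiple of the metric, and taking the trace identifies the
factor.  In dimension 1 the factor is \<open>0\<close>, for every \<open>\<mu>\<close>.\<close>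

lemma ricci_of_einstein:
  assumes x: "x \<in> S"
    and einstein: "DIM('e) \<ge> 3 \<Longrightarrow> \<exists>k. \<forall>u v. ricci G x u v = k * G x u v"
    and \<mu>: "DIM('e) \<ge> 2 \<Longrightarrow> \<mu> = scalar_curvature G x / (2 * real DIM('e) * (real DIM('e) - 1))"
  shows "ricci G x u v = 2 * (real DIM('e) - 1) * \<mu> * G x u v"
proof (cases "DIM('e) = 1")
  case True
  then show ?thesis using ricci_dim_1[OF x] by simp
next
  case False
  moreover have "DIM('e) > 0" by (rule DIM_positive)
  ultimately have dim: "DIM('e) \<ge> 2" by linarith
  obtain k where k: "\<And>u v. ricci G x u v = k * G x u v"
    using einstein ricci_dim_2[OF x] dim by (metis le_antisym not_less_eq_eq numeral_2_eq_2 numeral_3_eq_3)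
  then have "ricci G x = (\<lambda>u v. k * G x u v)" by blast
  then have "scalar_curvature G x = k * real DIM('e)"
    using metric_trace_metric[OF x, of k] by (simp add: scalar_curvature_def)
  then have "\<mu> = k / (2 * (real DIM('e) - 1))" using \<mu>[OF dim] by simp
  then have "k = 2 * (real DIM('e) - 1) * \<mu>" using dim by simp
  then show ?thesis using k by simp
qed

end

lemma local_metric_subset:
  assumes "local_metric S G" "open N" "N \<subseteq> S"
  shows "local_metric N G"
proof (rule local_metric.intro)
  interpret local_metric S G by (rule assms)
  show "open N" by (rule assms)
  show "inner_form (G x)" if "x \<in> N" for x using form that assms(3) by blast
  show "smooth_on N (\<lambda>x. G x u v)" for u v by (rule smooth_on_subset[OF smooth assms(3)])
qed

section \<open>Conformal change of the metric\<close>

text \<open>The values of the second metric are prescribed on \<open>S\<close> only, because metrics of a conformal class are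
arbitrary outside the images of the charts.  The prefix \<open>hat\<close> refers to the second metric.\<close>

locale conformal_change = local_metric S G
  for S :: "'e::euclidean_space set" and G :: "'e local_metric" +
  fixes \<omega> :: "'e \<Rightarrow> real" and G' :: "'e local_metric"
  assumes smooth_\<omega>: "smooth_on S \<omega>"
    and rescaled: "x \<in> S \<Longrightarrow> G' x u v = exp (2 * \<omega> x) * G x u v"
begin

sublocale hat: local_metric S G'
proof
  show "open S" by (rule open_S)
  show "inner_form (G' x)" if "x \<in> S" for x
  proof -
    have "G' x = (\<lambda>u v. exp (2 * \<omega> x) * G x u v)" using rescaled[OF that] by blast
    then show ?thesis
      using form[OF that] unfolding inner_form_def bilinear_def linear_iff
      by (simp add: algebra_simps)
  qed
  show "smooth_on S (\<lambda>x. G' x u v)" for u v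
    by (rule smooth_on_cong[OF open_S, of "\<lambda>x. exp (2 * \<omega> x) * G x u v"])
      (auto simp: rescaled intro!: smooth_on_mult smooth_on_exp smooth smooth_on_const smooth_\<omega> open_S)
qed

definition grad where "grad x = sharp G x (der \<omega> x)"
definition hess where "hess x u v = der (\<lambda>y. der \<omega> y v) x u - der \<omega> x (christoffel G x u v)"
definition hess_sharp where "hess_sharp x u = sharp G x (hess x u)"

lemma linear_d\<omega>: "x \<in> S \<Longrightarrow> linear (der \<omega> x)"
  using linear_frechet_derivative_smooth smooth_\<omega> by blast

lemmas d\<omega>_simps = linear_add[OF linear_d\<omega>] linear_cmul[OF linear_d\<omega>] linear_diff[OF linear_d\<omega>]
  linear_0[OF linear_d\<omega>] linear_neg[OF linear_d\<omega>]

lemma metric_grad: "x \<in> S \<Longrightarrow> G x (grad x) w = der \<omega> x w"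
  unfolding grad_def by (rule sharp[OF _ linear_d\<omega>])

lemma metric_grad_right: "x \<in> S \<Longrightarrow> G x w (grad x) = der \<omega> x w"
  using metric_grad[of x w] sym[of x w "grad x"] by simp

lemma smooth_d\<omega>: "smooth_on S (\<lambda>y. der \<omega> y v)"
  by (rule smooth_on_frechet_derivative[OF smooth_\<omega>])

lemma smooth_grad: "smooth_on S grad"
proof -
  have "smooth_on S (\<lambda>y. sharp G y (der \<omega> y))"
    by (rule smooth_sharp[OF linear_d\<omega> smooth_d\<omega>])
  moreover have "grad = (\<lambda>y. sharp G y (der \<omega> y))" by (simp add: grad_def fun_eq_iff)
  ultimately show ?thesis by simp
qed

lemmas d\<omega>_differentiable = smooth_on_imp_differentiable[OF smooth_d\<omega>]
  and grad_differentiable = smooth_on_imp_differentiable[OF smooth_grad]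
  and \<omega>_differentiable = smooth_on_imp_differentiable[OF smooth_\<omega>]

lemma linear_hess:
  assumes "x \<in> S"
  shows "linear (hess x u)" "linear (\<lambda>u. hess x u v)"
proof -
  have "linear (\<lambda>v. der (\<lambda>y. der \<omega> y v) x u)"
    by (rule linear_der_form[OF open_S assms linear_d\<omega> d\<omega>_differentiable[OF assms]])
  moreover have "linear (\<lambda>u. der (\<lambda>y. der \<omega> y v) x u)"
    by (rule linear_frechet_derivative[OF d\<omega>_differentiable[OF assms]])
  ultimately show "linear (hess x u)" "linear (\<lambda>u. hess x u v)"
    unfolding hess_def linear_iff
    by (simp_all add: d\<omega>_simps[OF assms] christoffel_simps[OF assms] algebra_simps)
qed

lemma hess_sym: "x \<in> S \<Longrightarrow> hess x u v = hess x v u"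
  unfolding hess_def
  using second_derivative_symmetric[OF smooth_\<omega> open_S, of x v u] christoffel_sym[of x u v] by simp

lemma metric_hess_sharp: "x \<in> S \<Longrightarrow> G x (hess_sharp x u) w = hess x u w"
  unfolding hess_sharp_def by (rule sharp[OF _ linear_hess(1)])

text \<open>The covariant derivative of the gradient is the Hessian with one index raised.\<close>

lemma der_grad:
  assumes x: "x \<in> S"
  shows "der grad x u = hess_sharp x u - christoffel G x u (grad x)"
proof (rule form_eqI[OF x])
  fix w
  have "der (\<lambda>y. G y (grad y) w) x u = der (\<lambda>y. der \<omega> y w) x u"
    by (rule fun_cong[OF frechet_derivative_cong[OF open_S x metric_grad]])
  moreover have "der (\<lambda>y. G y (grad y) w) x u
      = der (\<lambda>y. G y (grad x) w) x u + G x (der grad x u) w + G x (grad x) (der (\<lambda>y. w) x u)"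
    by (rule der_metric[OF x grad_differentiable[OF x] differentiable_const])
  ultimately show "G x (der grad x u) w = G x (hess_sharp x u - christoffel G x u (grad x)) w"
    by (simp add: metric_compatible[OF x] metric_simps[OF x] metric_grad[OF x]
        metric_hess_sharp[OF x] hess_def)
qed

text \<open>The tensor by which the Levi-Civita connections of the two metrics differ.\<close>

definition christoffel_diff where
  "christoffel_diff x u v = der \<omega> x u *\<^sub>R v + der \<omega> x v *\<^sub>R u - G x u v *\<^sub>R grad x"

lemma der_rescaled:
  assumes x: "x \<in> S"
  shows "der (\<lambda>y. G' y v w) x u
    = exp (2 * \<omega> x) * (2 * der \<omega> x u * G x v w + der (\<lambda>y. G y v w) x u)"
proof -
  have "((\<lambda>y. exp (2 * \<omega> y) * G y v w) has_derivative
      (\<lambda>u. exp (2 * \<omega> x) * der (\<lambda>y. G y v w) x u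
        + (2 * der \<omega> x u * exp (2 * \<omega> x)) * G x v w)) (at x)"
    using der_has_derivative[OF \<omega>_differentiable[OF x]]
      der_has_derivative[OF metric_differentiable[OF x]]
    by (auto intro!: derivative_eq_intros)
  from has_derivative_transform_within_open[OF this open_S x, of "\<lambda>y. G' y v w"]
  have "((\<lambda>y. G' y v w) has_derivative
      (\<lambda>u. exp (2 * \<omega> x) * der (\<lambda>y. G y v w) x u
        + (2 * der \<omega> x u * exp (2 * \<omega> x)) * G x v w)) (at x)"
    by (simp add: rescaled)
  from fun_cong[OF der_unique[OF this], of u] show ?thesis by (simp add: algebra_simps)
qed

lemma christoffel_rescaled:
  assumes x: "x \<in> S"
  shows "christoffel G' x u v = christoffel G x u v + christoffel_diff x u v"
proof (rule hat.form_eqI[OF x])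
  fix w
  show "G' x (christoffel G' x u v) w = G' x (christoffel G x u v + christoffel_diff x u v) w"
    unfolding hat.koszul[OF x]
    by (simp add: der_rescaled[OF x] rescaled[OF x] metric_simps[OF x]
        koszul[OF x] christoffel_diff_def metric_grad[OF x] field_simps)
qed

text \<open>The covariant derivative of the difference tensor.  As the metric is parallel, only the Hessian of
\<open>\<omega>\<close> appears.\<close>

lemma der_christoffel_diff:
  assumes x: "x \<in> S"
  shows "der (\<lambda>y. christoffel_diff y v w) x u + christoffel G x u (christoffel_diff x v w)
      - christoffel_diff x (christoffel G x u v) w - christoffel_diff x v (christoffel G x u w)
    = hess x u v *\<^sub>R w + hess x u w *\<^sub>R v - G x v w *\<^sub>R hess_sharp x u" (is "?L = ?R")
proof -
  have "((\<lambda>y. der \<omega> y v *\<^sub>R w + der \<omega> y w *\<^sub>R v - G y v w *\<^sub>R grad y) has_derivative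
      (\<lambda>u. der (\<lambda>y. der \<omega> y v) x u *\<^sub>R w + der (\<lambda>y. der \<omega> y w) x u *\<^sub>R v
        - (G x v w *\<^sub>R der grad x u + der (\<lambda>y. G y v w) x u *\<^sub>R grad x))) (at x)"
    by (intro has_derivative_add has_derivative_diff has_derivative_scaleR
        has_derivative_scaleR_left der_has_derivative d\<omega>_differentiable[OF x]
        grad_differentiable[OF x] metric_differentiable[OF x])
  from fun_cong[OF der_unique[OF this], of u]
  have dC: "der (\<lambda>y. christoffel_diff y v w) x u =
      der (\<lambda>y. der \<omega> y v) x u *\<^sub>R w + der (\<lambda>y. der \<omega> y w) x u *\<^sub>R v
        - (G x v w *\<^sub>R der grad x u + der (\<lambda>y. G y v w) x u *\<^sub>R grad x)"
    unfolding christoffel_diff_def .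
  have "?L \<bullet> z = ?R \<bullet> z" for z
    unfolding dC
    by (simp add: der_grad[OF x] metric_compatible[OF x] christoffel_diff_def christoffel_simps[OF x]
        metric_simps[OF x] d\<omega>_simps[OF x] hess_def inner_add_left inner_diff_left algebra_simps)
  then show ?thesis using vector_eq_rdot by blast
qed

text \<open>The quadratic part of the change of curvature.  The contribution of the summand
\<open>d\<omega> (w) v\<close> of the inner difference tensor is symmetric in \<open>u\<close> and \<open>v\<close>, hence drops out, and
inserting the gradient into the difference tensor gives \<open>\<bar>d\<omega>\<bar>\<^sup>2\<close> times the identity.\<close>

lemma christoffel_diff_twice:
  assumes x: "x \<in> S"
  shows "christoffel_diff x u (christoffel_diff x v w) - christoffel_diff x v (christoffel_diff x u w)
    = (der \<omega> x v * der \<omega> x w) *\<^sub>R u - (der \<omega> x u * der \<omega> x w) *\<^sub>R v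
      + (G x v w * der \<omega> x u - G x u w * der \<omega> x v) *\<^sub>R grad x
      - der \<omega> x (grad x) *\<^sub>R (G x v w *\<^sub>R u - G x u w *\<^sub>R v)" (is "?L = ?R")
proof -
  have "?L \<bullet> z = ?R \<bullet> z" for z
    by (simp add: christoffel_diff_def metric_simps[OF x] d\<omega>_simps[OF x] metric_grad_right[OF x]
        sym[OF x, of v u] inner_add_left inner_diff_left algebra_simps)
  then show ?thesis using vector_eq_rdot by blast
qed

text \<open>For connections \<open>\<nabla>\<close> and \<open>\<nabla> + C\<close> the curvatures differ by the antisymmetrised sum of
\<open>\<nabla>C\<close> and \<open>C C\<close>; the torsion of \<open>\<nabla>\<close>, which would contribute as well, vanishes.\<close>

lemma curvature_rescaled:
  assumes x: "x \<in> S"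
  shows "curvature G' x u v w = curvature G x u v w
    + (hess x u w *\<^sub>R v - hess x v w *\<^sub>R u - G x v w *\<^sub>R hess_sharp x u + G x u w *\<^sub>R hess_sharp x v)
    + (der \<omega> x v * der \<omega> x w) *\<^sub>R u - (der \<omega> x u * der \<omega> x w) *\<^sub>R v
    + (G x v w * der \<omega> x u - G x u w * der \<omega> x v) *\<^sub>R grad x
    - der \<omega> x (grad x) *\<^sub>R (G x v w *\<^sub>R u - G x u w *\<^sub>R v)"
proof -
  have smooth_C: "smooth_on S (\<lambda>y. christoffel_diff y v w)" for v w
    unfolding christoffel_diff_def
    by (intro smooth_on_add smooth_on_diff smooth_on_scaleR smooth_d\<omega> smooth_on_const open_S
        smooth smooth_grad)
  have d: "der (\<lambda>y. christoffel G' y v w) x u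
      = der (\<lambda>y. christoffel G y v w) x u + der (\<lambda>y. christoffel_diff y v w) x u" for u v w
  proof -
    have "der (\<lambda>y. christoffel G' y v w) x u
        = der (\<lambda>y. christoffel G y v w + christoffel_diff y v w) x u"
      by (rule fun_cong[OF frechet_derivative_cong[OF open_S x christoffel_rescaled]])
    then show ?thesis
      by (simp add: der_add[OF christoffel_differentiable[OF x]
            smooth_on_imp_differentiable[OF smooth_C x]])
  qed
  have C_lin: "christoffel_diff x u (a + b) = christoffel_diff x u a + christoffel_diff x u b" for u a b
    by (simp add: christoffel_diff_def metric_simps[OF x] d\<omega>_simps[OF x] algebra_simps)
  have "curvature G' x u v w = curvature G x u v w
      + (der (\<lambda>y. christoffel_diff y v w) x u + christoffel G x u (christoffel_diff x v w)
        - christoffel_diff x (christoffel G x u v) w - christoffel_diff x v (christoffel G x u w))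
      - (der (\<lambda>y. christoffel_diff y u w) x v + christoffel G x v (christoffel_diff x u w)
        - christoffel_diff x (christoffel G x v u) w - christoffel_diff x u (christoffel G x v w))
      + (christoffel_diff x u (christoffel_diff x v w) - christoffel_diff x v (christoffel_diff x u w))"
    by (simp add: curvature_def d christoffel_rescaled[OF x] christoffel_simps[OF x] C_lin
        christoffel_sym[OF x, of v u])
  then show ?thesis
    unfolding der_christoffel_diff[OF x] christoffel_diff_twice[OF x]
    by (simp add: hess_sym[OF x, of v u])
qed

lemma ricci_rescaled:
  assumes x: "x \<in> S"
  shows "ricci G' x v w = ricci G x v w
    - (real DIM('e) - 2) * (hess x v w - der \<omega> x v * der \<omega> x w)
    - (metric_trace G x (hess x) + (real DIM('e) - 2) * der \<omega> x (grad x)) * G x v w"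
proof -
  have 1: "(\<Sum>b\<in>Basis. hess x b w * (v \<bullet> b)) = hess x v w" for v w
    by (rule sum_linear_inner_Basis[OF linear_hess(2)[OF x]])
  have 2: "(\<Sum>b\<in>Basis. G x b w * (v \<bullet> b)) = G x v w" for v w
    by (rule sum_linear_inner_Basis[OF lin_left[OF x]])
  have 3: "(\<Sum>b\<in>Basis. der \<omega> x b * (v \<bullet> b)) = der \<omega> x v" for v
    by (rule sum_linear_inner_Basis[OF linear_d\<omega>[OF x]])
  have 4: "metric_trace G x (hess x) = (\<Sum>b\<in>Basis. hess_sharp x b \<bullet> b)"
    by (simp add: metric_trace_def hess_sharp_def)
  have "ricci G' x v w = (\<Sum>b\<in>Basis. curvature G x b v w \<bullet> b + hess x b w * (v \<bullet> b)
      - hess x v w * (b \<bullet> b) - G x v w * (hess_sharp x b \<bullet> b) + G x b w * (hess_sharp x v \<bullet> b)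
      + der \<omega> x v * der \<omega> x w * (b \<bullet> b) - der \<omega> x w * (der \<omega> x b * (v \<bullet> b))
      + G x v w * (der \<omega> x b * (grad x \<bullet> b)) - der \<omega> x v * (G x b w * (grad x \<bullet> b))
      - der \<omega> x (grad x) * G x v w * (b \<bullet> b) + der \<omega> x (grad x) * (G x b w * (v \<bullet> b)))"
    unfolding ricci_def curvature_rescaled[OF x]
    by (intro sum.cong refl) (simp add: inner_add_left inner_diff_left algebra_simps)
  also have "\<dots> = ricci G x v w + hess x v w - real DIM('e) * hess x v w
      - G x v w * metric_trace G x (hess x) + hess x v w + real DIM('e) * (der \<omega> x v * der \<omega> x w)
      - der \<omega> x w * der \<omega> x v + G x v w * der \<omega> x (grad x) - der \<omega> x v * der \<omega> x w
      - real DIM('e) * (der \<omega> x (grad x) * G x v w) + der \<omega> x (grad x) * G x v w"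
    by (simp add: sum.distrib sum_subtractf 1 2 3 4 ricci_def metric_grad[OF x]
        metric_hess_sharp[OF x] flip: sum_distrib_left)
  finally show ?thesis by (simp add: algebra_simps)
qed

text \<open>The transformation law of the Schouten tensor, for an arbitrary bilinear form in place of the
Schouten tensor of \<open>G\<close>.\<close>

definition schouten_rescaled :: "'e \<Rightarrow> ('e \<Rightarrow> 'e \<Rightarrow> real) \<Rightarrow> 'e \<Rightarrow> 'e \<Rightarrow> real" where
  "schouten_rescaled x P u v = P u v - hess x u v + der \<omega> x u * der \<omega> x v
    - der \<omega> x (grad x) / 2 * G x u v"

lemma sharp_rescaled:
  assumes "x \<in> S" "linear \<alpha>"
  shows "sharp G' x \<alpha> = exp (- 2 * \<omega> x) *\<^sub>R sharp G x \<alpha>"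
  using assms rescaled by (intro sharp_scaled[of G x] form)

lemma linear_schouten_rescaled:
  assumes x: "x \<in> S" and P: "linear (P u)"
  shows "linear (schouten_rescaled x P u)"
  unfolding schouten_rescaled_def
  by (rule linearI) (simp_all add: linear_add[OF P] linear_cmul[OF P] linear_add[OF linear_hess(1)[OF x]]
    linear_cmul[OF linear_hess(1)[OF x]] metric_simps[OF x] d\<omega>_simps[OF x] algebra_simps)

lemma sharp_schouten_rescaled:
  assumes x: "x \<in> S" and P: "linear (P u)"
  shows "sharp G' x (schouten_rescaled x P u) = exp (- 2 * \<omega> x) *\<^sub>R
    (sharp G x (P u) - hess_sharp x u + der \<omega> x u *\<^sub>R grad x - (der \<omega> x (grad x) / 2) *\<^sub>R u)"
proof -
  have "linear (schouten_rescaled x P u)" using x P by (rule linear_schouten_rescaled)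
  then have "sharp G' x (schouten_rescaled x P u)
      = exp (- 2 * \<omega> x) *\<^sub>R sharp G x (schouten_rescaled x P u)"
    by (rule sharp_rescaled[OF x])
  also have "sharp G x (schouten_rescaled x P u) = sharp G x (P u) - hess_sharp x u
      + der \<omega> x u *\<^sub>R grad x - (der \<omega> x (grad x) / 2) *\<^sub>R u"
    by (rule sharp_unique[OF x]) (simp add: metric_simps[OF x] sharp[OF x P] metric_hess_sharp[OF x]
        metric_grad[OF x] schouten_rescaled_def)
  finally show ?thesis .
qed

text \<open>The defining equation of the Schouten tensor passes from \<open>G\<close> to the rescaled metric.\<close>

lemma ricci_schouten_rescaled:
  assumes x: "x \<in> S" and P: "\<And>u. linear (P u)"
    and ric: "\<And>u v. ricci G x u v = (real DIM('e) - 2) * P u v + metric_trace G x P * G x u v"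
  shows "ricci G' x u v = (real DIM('e) - 2) * schouten_rescaled x P u v
    + metric_trace G' x (schouten_rescaled x P) * G' x u v"
proof -
  have 3: "(\<Sum>b\<in>Basis. der \<omega> x b * (v \<bullet> b)) = der \<omega> x v" for v
    by (rule sum_linear_inner_Basis[OF linear_d\<omega>[OF x]])
  have 4: "metric_trace G x (hess x) = (\<Sum>b\<in>Basis. hess_sharp x b \<bullet> b)"
    by (simp add: metric_trace_def hess_sharp_def)
  have "metric_trace G' x (schouten_rescaled x P) = exp (- 2 * \<omega> x) *
      (\<Sum>b\<in>Basis. sharp G x (P b) \<bullet> b - hess_sharp x b \<bullet> b + der \<omega> x b * (grad x \<bullet> b)
        - der \<omega> x (grad x) / 2 * (b \<bullet> b))"
    unfolding metric_trace_def sharp_schouten_rescaled[OF x P] sum_distrib_left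
    by (intro sum.cong refl) (simp add: inner_add_left inner_diff_left)
  also have "\<dots> = exp (- 2 * \<omega> x) * (metric_trace G x P - metric_trace G x (hess x)
      + der \<omega> x (grad x) - real DIM('e) * (der \<omega> x (grad x) / 2))"
    by (simp add: sum.distrib sum_subtractf 3 4 metric_trace_def[of G x P])
  finally have tr: "metric_trace G' x (schouten_rescaled x P) * G' x u v =
      (exp (- 2 * \<omega> x) * exp (2 * \<omega> x)) * ((metric_trace G x P - metric_trace G x (hess x)
      + der \<omega> x (grad x) - real DIM('e) * (der \<omega> x (grad x) / 2)) * G x u v)"
    by (simp only: rescaled[OF x] mult_ac)
  have "exp (- 2 * \<omega> x) * exp (2 * \<omega> x) = 1" by (simp flip: exp_add)
  then show ?thesis
    unfolding ricci_rescaled[OF x] tr by (simp add: ric schouten_rescaled_def field_simps)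
qed

text \<open>The change of scale intertwines the normal connections.  The first slot is immediate; in the second
the Hessian produced by differentiating the gradient cancels against the one in the new Schouten
tensor, and in the third the same happens to the derivatives of \<open>d\<omega>\<close>.\<close>

lemma change_scale_conn:
  assumes x: "x \<in> S" and P: "schouten G x = P" "schouten G' x = schouten_rescaled x P" "linear (P u)"
    and s: "s differentiable (at x)"
  shows "der (\<lambda>y. change_scale G y (\<omega> y) (der \<omega> y) (s y)) x u
      + normal_conn G' x u (change_scale G x (\<omega> x) (der \<omega> x) (s x))
    = change_scale G x (\<omega> x) (der \<omega> x) (der s x u + normal_conn G x u (s x))"
proof -
  define \<sigma> \<mu> \<rho> where "\<sigma> y = fst (s y)" and "\<mu> y = fst (snd (s y))" and "\<rho> y = snd (snd (s y))" for y
  have s_eq: "s = (\<lambda>y. (\<sigma> y, \<mu> y, \<rho> y))" by (simp add: \<sigma>_def \<mu>_def \<rho>_def)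
  have ds: "(s has_derivative der s x) (at x)" by (rule der_has_derivative[OF s])
  have diff: "\<sigma> differentiable (at x)" "\<mu> differentiable (at x)" "\<rho> differentiable (at x)"
    unfolding \<sigma>_def \<mu>_def \<rho>_def
    by (rule differentiableI has_derivative_fst has_derivative_snd ds)+
  note d\<sigma> = der_has_derivative[OF diff(1)] and d\<mu> = der_has_derivative[OF diff(2)]
    and d\<rho> = der_has_derivative[OF diff(3)] and d\<omega> = der_has_derivative[OF \<omega>_differentiable[OF x]]
    and dg = der_has_derivative[OF grad_differentiable[OF x]]
  have d1: "((\<lambda>y. exp (\<omega> y) * \<sigma> y) has_derivative
      (\<lambda>u. exp (\<omega> x) * (der \<omega> x u * \<sigma> x + der \<sigma> x u))) (at x)"
    by (auto intro!: derivative_eq_intros d\<sigma> d\<omega> simp: algebra_simps)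
  have d2: "((\<lambda>y. exp (- \<omega> y) *\<^sub>R (\<mu> y + \<sigma> y *\<^sub>R grad y)) has_derivative
      (\<lambda>u. exp (- \<omega> x) *\<^sub>R (der \<mu> x u + \<sigma> x *\<^sub>R der grad x u + der \<sigma> x u *\<^sub>R grad x
        - der \<omega> x u *\<^sub>R (\<mu> x + \<sigma> x *\<^sub>R grad x)))) (at x)"
    by (auto intro!: derivative_eq_intros d\<sigma> d\<omega> d\<mu> dg simp: algebra_simps)
  have d\<Upsilon>: "((\<lambda>y. der \<omega> y (h y)) has_derivative
      (\<lambda>u. der (\<lambda>y. der \<omega> y (h x)) x u + der \<omega> x (h' u))) (at x)"
    if "(h has_derivative h') (at x)" for h h'
    by (rule form_has_derivative[OF open_S x linear_d\<omega> d\<omega>_differentiable[OF x] that])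
  have d3: "((\<lambda>y. exp (- \<omega> y) * (\<rho> y - der \<omega> y (\<mu> y) - \<sigma> y * der \<omega> y (grad y) / 2)) has_derivative
      (\<lambda>u. exp (- \<omega> x) * (der \<rho> x u - (der (\<lambda>y. der \<omega> y (\<mu> x)) x u + der \<omega> x (der \<mu> x u))
        - der \<sigma> x u * der \<omega> x (grad x) / 2
        - \<sigma> x * (der (\<lambda>y. der \<omega> y (grad x)) x u + der \<omega> x (der grad x u)) / 2
        - der \<omega> x u * (\<rho> x - der \<omega> x (\<mu> x) - \<sigma> x * der \<omega> x (grad x) / 2)))) (at x)"
    by (auto intro!: derivative_eq_intros d\<sigma> d\<omega> d\<rho> d\<Upsilon>[OF d\<mu>] d\<Upsilon>[OF dg] simp: field_simps)
  have cs: "change_scale G y (\<omega> y) (der \<omega> y) (s y) = (exp (\<omega> y) * \<sigma> y,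
      exp (- \<omega> y) *\<^sub>R (\<mu> y + \<sigma> y *\<^sub>R grad y),
      exp (- \<omega> y) * (\<rho> y - der \<omega> y (\<mu> y) - \<sigma> y * der \<omega> y (grad y) / 2))" for y
    by (simp add: s_eq grad_def)
  have ds_eq: "der s x u = (der \<sigma> x u, der \<mu> x u, der \<rho> x u)"
    unfolding s_eq by (rule frechet_derivative_triple[OF diff])
  have ee: "exp (2 * \<omega> x) * exp (- \<omega> x) = exp (\<omega> x)" "exp (\<omega> x) * exp (- 2 * \<omega> x) = exp (- \<omega> x)"
    by (simp_all flip: exp_add)
  define m where "m = \<mu> x + \<sigma> x *\<^sub>R grad x"
  have G'm: "G' x u (exp (- \<omega> x) *\<^sub>R m) = exp (\<omega> x) * G x u m"
    by (simp only: rescaled[OF x] metric_simps[OF x] ee flip: mult.assoc real_scaleR_def)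
      (simp add: ee(1))
  have \<Gamma>'m: "christoffel G' x u (exp (- \<omega> x) *\<^sub>R m)
      = exp (- \<omega> x) *\<^sub>R (christoffel G x u m + christoffel_diff x u m)"
    using linear_cmul[OF hat.linear_christoffel_right[OF x], of u "exp (- \<omega> x)" m]
    unfolding christoffel_rescaled[OF x, of u m] .
  have P'm: "schouten G' x u (exp (- \<omega> x) *\<^sub>R m) = exp (- \<omega> x) * schouten_rescaled x P u m"
    unfolding P(2) schouten_rescaled_def
    by (simp add: linear_cmul[OF P(3)] linear_cmul[OF linear_hess(1)[OF x]] metric_simps[OF x]
        d\<omega>_simps[OF x] algebra_simps)
  have P'sharp: "(exp (\<omega> x) * \<sigma> x) *\<^sub>R sharp G' x (schouten G' x u) = exp (- \<omega> x) *\<^sub>R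
      (\<sigma> x *\<^sub>R (sharp G x (P u) - hess_sharp x u + der \<omega> x u *\<^sub>R grad x
        - (der \<omega> x (grad x) / 2) *\<^sub>R u))"
  proof -
    have "exp (\<omega> x) * \<sigma> x * exp (- 2 * \<omega> x) = exp (- \<omega> x) * \<sigma> x"
      using ee(2) by (simp only: mult_ac)
    then show ?thesis
      unfolding P(2) sharp_schouten_rescaled[of x P u, OF x P(3)] scaleR_scaleR by (simp only:)
  qed
  define q where "q = \<rho> x - der \<omega> x (\<mu> x) - \<sigma> x * der \<omega> x (grad x) / 2"
  have 1: "exp (\<omega> x) * (der \<omega> x u * \<sigma> x + der \<sigma> x u) - exp (\<omega> x) * G x u m
      = exp (\<omega> x) * (der \<sigma> x u - G x u (\<mu> x))"
    by (simp add: m_def metric_simps[OF x] metric_grad_right[OF x] algebra_simps)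
  have "(der \<mu> x u + \<sigma> x *\<^sub>R der grad x u + der \<sigma> x u *\<^sub>R grad x - der \<omega> x u *\<^sub>R m
        + (christoffel G x u m + christoffel_diff x u m) + q *\<^sub>R u
        + \<sigma> x *\<^sub>R (sharp G x (P u) - hess_sharp x u + der \<omega> x u *\<^sub>R grad x
        - (der \<omega> x (grad x) / 2) *\<^sub>R u)) \<bullet> z
      = (der \<mu> x u + (christoffel G x u (\<mu> x) + \<rho> x *\<^sub>R u + \<sigma> x *\<^sub>R sharp G x (P u))
        + (der \<sigma> x u - G x u (\<mu> x)) *\<^sub>R grad x) \<bullet> z" for z
    by (simp add: der_grad[OF x] m_def q_def christoffel_diff_def christoffel_simps[OF x]
        metric_simps[OF x] metric_grad_right[OF x] d\<omega>_simps[OF x] inner_add_left inner_diff_left field_simps)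
  then have "der \<mu> x u + \<sigma> x *\<^sub>R der grad x u + der \<sigma> x u *\<^sub>R grad x - der \<omega> x u *\<^sub>R m
        + (christoffel G x u m + christoffel_diff x u m) + q *\<^sub>R u
        + \<sigma> x *\<^sub>R (sharp G x (P u) - hess_sharp x u + der \<omega> x u *\<^sub>R grad x
        - (der \<omega> x (grad x) / 2) *\<^sub>R u)
      = der \<mu> x u + (christoffel G x u (\<mu> x) + \<rho> x *\<^sub>R u + \<sigma> x *\<^sub>R sharp G x (P u))
        + (der \<sigma> x u - G x u (\<mu> x)) *\<^sub>R grad x"
    using vector_eq_rdot by blast
  from arg_cong[OF this, of "\<lambda>v. exp (- \<omega> x) *\<^sub>R v"]
  have 2: "exp (- \<omega> x) *\<^sub>R (der \<mu> x u + \<sigma> x *\<^sub>R der grad x u + der \<sigma> x u *\<^sub>R grad x - der \<omega> x u *\<^sub>R m)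
      + (exp (- \<omega> x) *\<^sub>R (christoffel G x u m + christoffel_diff x u m) + (exp (- \<omega> x) * q) *\<^sub>R u
        + exp (- \<omega> x) *\<^sub>R (\<sigma> x *\<^sub>R (sharp G x (P u) - hess_sharp x u + der \<omega> x u *\<^sub>R grad x
        - (der \<omega> x (grad x) / 2) *\<^sub>R u)))
      = exp (- \<omega> x) *\<^sub>R (der \<mu> x u + (christoffel G x u (\<mu> x) + \<rho> x *\<^sub>R u + \<sigma> x *\<^sub>R sharp G x (P u))
        + (der \<sigma> x u - G x u (\<mu> x)) *\<^sub>R grad x)"
    unfolding scaleR_add_right scaleR_scaleR by (simp only: add.assoc)
  have P_grad: "P u (grad x) = der \<omega> x (sharp G x (P u))"
    using sharp[OF x P(3), of "grad x"] by (simp add: metric_grad_right[OF x])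
  have "der \<rho> x u - (der (\<lambda>y. der \<omega> y (\<mu> x)) x u + der \<omega> x (der \<mu> x u))
        - der \<sigma> x u * der \<omega> x (grad x) / 2
        - \<sigma> x * (der (\<lambda>y. der \<omega> y (grad x)) x u + der \<omega> x (der grad x u)) / 2
        - der \<omega> x u * q - schouten_rescaled x P u m
      = (der \<rho> x u - P u (\<mu> x)) - der \<omega> x (der \<mu> x u + (christoffel G x u (\<mu> x) + \<rho> x *\<^sub>R u
          + \<sigma> x *\<^sub>R sharp G x (P u))) - (der \<sigma> x u - G x u (\<mu> x)) * der \<omega> x (grad x) / 2"
  proof -
    have "der (\<lambda>y. der \<omega> y v) x u = hess x u v + der \<omega> x (christoffel G x u v)" for v
      by (simp add: hess_def)
    moreover have "der \<omega> x (hess_sharp x u) = hess x u (grad x)"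
      using metric_hess_sharp[OF x, of u "grad x"] by (simp add: metric_grad_right[OF x])
    ultimately show ?thesis
      unfolding q_def m_def schouten_rescaled_def
      by (simp add: der_grad[OF x] linear_add[OF P(3)] linear_cmul[OF P(3)] P_grad
          linear_add[OF linear_hess(1)[OF x]] linear_cmul[OF linear_hess(1)[OF x]]
          metric_simps[OF x] metric_grad_right[OF x] d\<omega>_simps[OF x] field_simps)
  qed
  from arg_cong[OF this, of "\<lambda>v. exp (- \<omega> x) * v"]
  have 3: "exp (- \<omega> x) * (der \<rho> x u - (der (\<lambda>y. der \<omega> y (\<mu> x)) x u + der \<omega> x (der \<mu> x u))
        - der \<sigma> x u * der \<omega> x (grad x) / 2
        - \<sigma> x * (der (\<lambda>y. der \<omega> y (grad x)) x u + der \<omega> x (der grad x u)) / 2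
        - der \<omega> x u * q) + - (exp (- \<omega> x) * schouten_rescaled x P u m)
      = exp (- \<omega> x) * ((der \<rho> x u - P u (\<mu> x)) - der \<omega> x (der \<mu> x u + (christoffel G x u (\<mu> x)
          + \<rho> x *\<^sub>R u + \<sigma> x *\<^sub>R sharp G x (P u))) - (der \<sigma> x u - G x u (\<mu> x)) * der \<omega> x (grad x) / 2)"
    unfolding right_diff_distrib by linarith
  show ?thesis
    unfolding cs fun_cong[OF der_unique[OF has_derivative_Pair[OF d1 has_derivative_Pair[OF d2 d3]]], of u]
    unfolding ds_eq m_def[symmetric] q_def[symmetric]
    using 1 2 3 by (simp add: s_eq G'm \<Gamma>'m P'm P'sharp P(1) grad_def[symmetric] del: scaleR_add_right)
qed

end

section \<open>The change of scale of tractors\<close>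

text \<open>The law by which scale changes form a cocycle.  The second differential is raised with the
rescaled metric, which accounts for the powers of \<open>e\<^sup>a\<close>, and the two mixed terms
\<open>\<Upsilon> (Y')\<close> and \<open>\<Upsilon>' (Y)\<close> agree by the symmetry of the metric.\<close>

lemma change_scale_compose:
  assumes G: "inner_form (G x)" and \<Upsilon>: "linear \<Upsilon>" and \<Upsilon>': "linear \<Upsilon>'"
    and G': "\<And>u v. G' x u v = exp (2 * a) * G x u v"
  shows "change_scale G' x b \<Upsilon>' (change_scale G x a \<Upsilon> t)
    = change_scale G x (a + b) (\<lambda>v. \<Upsilon> v + \<Upsilon>' v) t"
proof (cases t)
  case (fields \<sigma> \<mu> \<rho>)
  define e f where "e = exp (- a)" and "f = exp (- b)"
  define Y Y' where "Y = sharp G x \<Upsilon>" and "Y' = sharp G x \<Upsilon>'"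
  have ef: "exp (- (a + b)) = e * f" "exp (- a - b) = e * f"
    by (simp_all add: e_def f_def flip: exp_add)
  have e: "exp a * e = 1" by (simp add: e_def flip: exp_add)
  have e2: "exp (- 2 * a) = e * e" by (simp add: e_def flip: exp_add)
  have Y': "sharp G' x \<Upsilon>' = (e * e) *\<^sub>R Y'"
    using sharp_scaled[of G x \<Upsilon>' G' a, OF G \<Upsilon>' G'] by (simp only: e2 Y'_def)
  \<comment> \<open>The factor of the new top slot absorbs one factor of the rescaled raised covector.\<close>
  have cancel: "exp a * \<sigma> * (e * e) = e * \<sigma>" using e by (metis mult.assoc mult.commute mult_1)
  have sum: "sharp G x (\<lambda>v. \<Upsilon> v + \<Upsilon>' v) = Y + Y'"
    using sharp_add[of G x, OF G \<Upsilon> \<Upsilon>'] by (simp add: Y_def Y'_def)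
  have sym: "\<Upsilon>' Y = \<Upsilon> Y'" using sharp_pairing_sym[of G x, OF G \<Upsilon> \<Upsilon>'] by (simp add: Y_def Y'_def)
  have 1: "f *\<^sub>R (e *\<^sub>R (\<mu> + \<sigma> *\<^sub>R Y) + (exp a * \<sigma>) *\<^sub>R (e * e) *\<^sub>R Y')
      = (e * f) *\<^sub>R (\<mu> + \<sigma> *\<^sub>R (Y + Y'))"
    unfolding scaleR_scaleR cancel by (simp add: algebra_simps)
  have 3: "exp a * \<sigma> * \<Upsilon>' ((e * e) *\<^sub>R Y') = e * \<sigma> * \<Upsilon>' Y'"
    by (simp add: linear_cmul[OF \<Upsilon>'] flip: cancel)
  have 2: "f * (e * (\<rho> - \<Upsilon> \<mu> - \<sigma> * \<Upsilon> Y / 2) - \<Upsilon>' (e *\<^sub>R (\<mu> + \<sigma> *\<^sub>R Y))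
        - exp a * \<sigma> * \<Upsilon>' ((e * e) *\<^sub>R Y') / 2)
      = (e * f) * (\<rho> - (\<Upsilon> \<mu> + \<Upsilon>' \<mu>) - \<sigma> * (\<Upsilon> (Y + Y') + \<Upsilon>' (Y + Y')) / 2)"
    unfolding 3 by (simp add: linear_add[OF \<Upsilon>'] linear_add[OF \<Upsilon>] linear_cmul[OF \<Upsilon>'] sym field_simps)
  show ?thesis
    using 1 2 by (simp add: fields Y' sum ef exp_add flip: e_def f_def Y_def)
qed

lemma change_scale_zero: "inner_form (G x) \<Longrightarrow> change_scale G x 0 (\<lambda>v. 0) t = t"
  by (cases t) (simp add: sharp_zero)

lemma linear_change_scale:
  assumes "linear \<Upsilon>"
  shows "linear (change_scale G x a \<Upsilon>)"
proof (rule linearI)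
  show "change_scale G x a \<Upsilon> (s + t) = change_scale G x a \<Upsilon> s + change_scale G x a \<Upsilon> t" for s t
    by (cases s; cases t) (simp add: linear_add[OF assms] algebra_simps add_divide_distrib)
  show "change_scale G x a \<Upsilon> (c *\<^sub>R t) = c *\<^sub>R change_scale G x a \<Upsilon> t" for c t
    by (cases t) (simp add: linear_cmul[OF assms] algebra_simps)
qed

lemma tractor_met_change_scale:
  assumes G: "inner_form (G x)" and \<Upsilon>: "linear \<Upsilon>" and G': "\<And>u v. G' x u v = exp (2 * a) * G x u v"
  shows "tractor_met G' x (change_scale G x a \<Upsilon> s) (change_scale G x a \<Upsilon> t) = tractor_met G x s t"
proof (cases s; cases t)
  fix \<sigma> \<mu> \<rho> \<sigma>' \<mu>' \<rho>' assume st: "s = (\<sigma>, \<mu>, \<rho>)" "t = (\<sigma>', \<mu>', \<rho>')"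
  define e Y where "e = exp (- a)" and "Y = sharp G x \<Upsilon>"
  have e: "exp a * e = 1" by (simp add: e_def flip: exp_add)
  have "exp (2 * a) * (e * (e * z)) = z" for z
    by (simp add: e_def flip: exp_add mult.assoc)
  then have 1: "G' x (e *\<^sub>R u) (e *\<^sub>R v) = G x u v" for u v
    by (simp add: G' linear_cmul[OF inner_form_linear(1)[OF G]] linear_cmul[OF inner_form_linear(2)[OF G]])
  have 2: "exp a * c * (e * d) = c * d" "e * c * (exp a * d) = c * d" for c d
    using e by (metis mult.assoc mult.commute mult_1)+
  have 3: "G x Y v = \<Upsilon> v" "G x v Y = \<Upsilon> v" for v
    using sharp_works[of G x, OF G \<Upsilon>] inner_form_sym[OF G] by (simp_all add: Y_def)
  show ?thesis
    unfolding st change_scale.simps tractor_met.simps Y_def[symmetric] e_def[symmetric] 1 2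
    by (simp add: linear_add[OF inner_form_linear(1)[OF G]] linear_add[OF inner_form_linear(2)[OF G]]
        linear_cmul[OF inner_form_linear(1)[OF G]] linear_cmul[OF inner_form_linear(2)[OF G]] 3
        linear_add[OF \<Upsilon>] linear_cmul[OF \<Upsilon>] field_simps)
qed

lemma change_scale_inverse:
  assumes G: "inner_form (G x)" and \<Upsilon>: "linear \<Upsilon>" and G': "\<And>u v. G' x u v = exp (2 * a) * G x u v"
  shows "change_scale G' x (- a) (\<lambda>v. - \<Upsilon> v) (change_scale G x a \<Upsilon> t) = t"
  using change_scale_compose[of G x \<Upsilon> "\<lambda>v. - \<Upsilon> v" G' a "- a" t, OF G \<Upsilon> _ G']
    change_scale_zero[of G x t, OF G]
  by (simp add: linear_compose_neg \<Upsilon>)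

lemma bij_change_scale:
  assumes G: "inner_form (G x)" and \<Upsilon>: "linear \<Upsilon>"
  shows "bij (change_scale G x a \<Upsilon>)"
proof -
  let ?G' = "\<lambda>x u v. exp (2 * a) * G x u v"
  have "inj (change_scale G x a \<Upsilon>)"
    by (rule inj_on_inverseI[of _ "change_scale ?G' x (- a) (\<lambda>v. - \<Upsilon> v)"])
      (rule change_scale_inverse[of G x \<Upsilon> ?G' a, OF G \<Upsilon> refl])
  moreover have "surj (change_scale G x a \<Upsilon>)"
    by (rule linear_injective_imp_surjective[OF linear_change_scale[OF \<Upsilon>] calculation]) simp
  ultimately show ?thesis by (simp add: bij_def)
qed

text \<open>An isometry \<open>J\<close> that carries the covector \<open>\<Upsilon>\<close> to \<open>\<Upsilon>'\<close> also carries the raised covectors to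
each other.  It will be the Jacobian of a coordinate change.\<close>

lemma change_scale_equivariant:
  fixes J :: "'e::euclidean_space \<Rightarrow> 'e"
  assumes G: "inner_form (G x)" and H: "inner_form (H y)" and J: "linear J"
    and iso: "\<And>u v. H y (J u) (J v) = G x u v"
    and \<Upsilon>: "linear \<Upsilon>" and \<Upsilon>J: "\<And>v. \<Upsilon>' (J v) = \<Upsilon> v"
  shows "change_scale H y a \<Upsilon>' (\<sigma>, J \<mu>, \<rho>) =
    (exp a * \<sigma>, J (exp (- a) *\<^sub>R (\<mu> + \<sigma> *\<^sub>R sharp G x \<Upsilon>)),
      exp (- a) * (\<rho> - \<Upsilon> \<mu> - \<sigma> * \<Upsilon> (sharp G x \<Upsilon>) / 2))"
proof -
  have "inj J"
  proof (rule injI)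
    fix u v assume "J u = J v"
    then have "G x u w = G x v w" for w using iso[of u w] iso[of v w] by simp
    then show "u = v" by (rule inner_form_eqI[OF G])
  qed
  then have surj: "surj J" using linear_injective_imp_surjective[OF J] by simp
  have "sharp H y \<Upsilon>' = J (sharp G x \<Upsilon>)"
  proof (rule sharp_eqI[of H y, OF H])
    fix w obtain v where "w = J v" using surj by blast
    then show "H y (J (sharp G x \<Upsilon>)) w = \<Upsilon>' w" by (simp add: iso \<Upsilon>J sharp_works[of G x, OF G \<Upsilon>])
  qed
  then show ?thesis by (simp add: \<Upsilon>J linear_add[OF J] linear_cmul[OF J])
qed

lemma conformal_change_subset:
  assumes "conformal_change S G \<omega> G'" "open N" "N \<subseteq> S"
  shows "conformal_change N G \<omega> G'"
proof -
  interpret conformal_change S G \<omega> G' by (rule assms)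
  show ?thesis
    by (intro conformal_change.intro conformal_change_axioms.intro
        local_metric_subset[OF local_metric_axioms] assms smooth_on_subset[OF smooth_\<omega>] rescaled subsetD[OF assms(3)])
qed

context conformal_change begin

lemma smooth_change_scale:
  assumes "smooth_on S t"
  shows "smooth_on S (\<lambda>y. change_scale G y (\<omega> y) (der \<omega> y) (t y))"
proof -
  have 1: "smooth_on S (\<lambda>y. fst (t y))"
    by (rule smooth_on_bounded_linear[OF bounded_linear_fst open_S assms])
  have 0: "smooth_on S (\<lambda>y. snd (t y))"
    by (rule smooth_on_bounded_linear[OF bounded_linear_snd open_S assms])
  have 2: "smooth_on S (\<lambda>y. fst (snd (t y)))"
    by (rule smooth_on_bounded_linear[OF bounded_linear_fst open_S 0])
  have 3: "smooth_on S (\<lambda>y. snd (snd (t y)))"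
    by (rule smooth_on_bounded_linear[OF bounded_linear_snd open_S 0])
  have form: "smooth_on S (\<lambda>y. der \<omega> y (h y))" if "smooth_on S h" for h
    by (rule smooth_on_form[OF open_S linear_d\<omega> smooth_d\<omega> that])
  have "smooth_on S (\<lambda>y. (exp (\<omega> y) * fst (t y),
      exp (- \<omega> y) *\<^sub>R (fst (snd (t y)) + fst (t y) *\<^sub>R grad y),
      exp (- \<omega> y) * (snd (snd (t y)) - der \<omega> y (fst (snd (t y)))
        - (1 / 2) * (fst (t y) * der \<omega> y (grad y)))))"
    by (intro smooth_on_Pair smooth_on_mult[OF open_S] smooth_on_scaleR[OF open_S] smooth_on_add
        smooth_on_diff smooth_on_exp smooth_on_minus smooth_on_const open_S smooth_\<omega> 1 2 3
        form[OF 2] form[OF smooth_grad] smooth_grad)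
  moreover have "change_scale G y (\<omega> y) (der \<omega> y) (t y) = (exp (\<omega> y) * fst (t y),
      exp (- \<omega> y) *\<^sub>R (fst (snd (t y)) + fst (t y) *\<^sub>R grad y),
      exp (- \<omega> y) * (snd (snd (t y)) - der \<omega> y (fst (snd (t y)))
        - (1 / 2) * (fst (t y) * der \<omega> y (grad y))))" for y
    by (cases "t y") (simp add: grad_def)
  ultimately show ?thesis by simp
qed

lemma conformal_change_inverse: "conformal_change S G' (\<lambda>y. - \<omega> y) G"
  by (intro conformal_change.intro hat.local_metric_axioms conformal_change_axioms.intro
      smooth_on_minus open_S smooth_\<omega>) (simp add: rescaled flip: exp_add mult.assoc)

text \<open>The inverse of a change of scale is the change of scale for \<open>- \<omega>\<close>, taken from the rescaled metric.\<close>

lemma smooth_change_scale_iff: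
  "smooth_on S (\<lambda>y. change_scale G y (\<omega> y) (der \<omega> y) (t y)) \<longleftrightarrow> smooth_on S t"
proof
  interpret inv: conformal_change S G' "\<lambda>y. - \<omega> y" G by (rule conformal_change_inverse)
  have d: "der (\<lambda>y. - \<omega> y) x = (\<lambda>v. - der \<omega> x v)" if "x \<in> S" for x
    by (rule der_unique, rule has_derivative_minus, rule der_has_derivative, rule \<omega>_differentiable[OF that])
  assume "smooth_on S (\<lambda>y. change_scale G y (\<omega> y) (der \<omega> y) (t y))"
  from inv.smooth_change_scale[OF this] show "smooth_on S t"
    by (rule smooth_on_cong[OF open_S, rotated])
      (simp add: d change_scale_inverse[of G _ _ G', OF form linear_d\<omega> rescaled])
qed (rule smooth_change_scale)

end

section \<open>Products of metrics\<close>

text \<open>The product metric in a pair of charts.\<close>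

definition product_local :: "'e local_metric \<Rightarrow> 'f local_metric \<Rightarrow> ('e \<times> 'f) local_metric" where
  "product_local G H = (\<lambda>(x, y) (u, v) (u', v'). G x u u' + H y v v')"

lemma product_local_simp [simp]:
  "product_local G H (x, y) (u, v) (u', v') = G x u u' + H y v v'"
  by (simp add: product_local_def)

locale product_local_metric =
  m1: local_metric S\<^sub>1 G\<^sub>1 + m2: local_metric S\<^sub>2 G\<^sub>2
  for S\<^sub>1 :: "'e::euclidean_space set" and G\<^sub>1
    and S\<^sub>2 :: "'f::euclidean_space set" and G\<^sub>2
begin

lemma product_local_split:
  "product_local G\<^sub>1 G\<^sub>2 p u v = G\<^sub>1 (fst p) (fst u) (fst v) + G\<^sub>2 (snd p) (snd u) (snd v)"
  by (simp add: product_local_def case_prod_beta)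

sublocale local_metric "S\<^sub>1 \<times> S\<^sub>2" "product_local G\<^sub>1 G\<^sub>2"
proof
  show open_prod: "open (S\<^sub>1 \<times> S\<^sub>2)" by (intro open_Times m1.open_S m2.open_S)
  show "inner_form (product_local G\<^sub>1 G\<^sub>2 p)" if "p \<in> S\<^sub>1 \<times> S\<^sub>2" for p
  proof -
    have p: "fst p \<in> S\<^sub>1" "snd p \<in> S\<^sub>2" using that by auto
    have nonneg: "G\<^sub>1 (fst p) u u \<ge> 0" "G\<^sub>2 (snd p) v v \<ge> 0" for u v
      using inner_form_pos[OF m1.form[OF p(1)], of u] inner_form_pos[OF m2.form[OF p(2)], of v]
        m1.metric_simps(7)[OF p(1)] m2.metric_simps(7)[OF p(2)] by (cases "u = 0"; cases "v = 0"; force)+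
    have "product_local G\<^sub>1 G\<^sub>2 p u u > 0" if "u \<noteq> 0" for u
    proof (cases "fst u = 0")
      case True
      with that have "snd u \<noteq> 0" by (simp add: prod_eq_iff)
      then show ?thesis
        using inner_form_pos[OF m2.form[OF p(2)]] nonneg(1) by (simp add: product_local_split add_nonneg_pos)
    next
      case False
      then show ?thesis
        using inner_form_pos[OF m1.form[OF p(1)]] nonneg(2) by (simp add: product_local_split add_pos_nonneg)
    qed
    moreover have "bilinear (product_local G\<^sub>1 G\<^sub>2 p)"
      unfolding bilinear_def linear_iff product_local_split
      by (simp add: m1.metric_simps[OF p(1)] m2.metric_simps[OF p(2)] algebra_simps)
    moreover have "product_local G\<^sub>1 G\<^sub>2 p u v = product_local G\<^sub>1 G\<^sub>2 p v u" for u v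
      using m1.sym[OF p(1)] m2.sym[OF p(2)] by (simp add: product_local_split)
    ultimately show ?thesis by (simp add: inner_form_def)
  qed
  show "smooth_on (S\<^sub>1 \<times> S\<^sub>2) (\<lambda>p. product_local G\<^sub>1 G\<^sub>2 p u v)" for u v
    unfolding product_local_split
    by (intro smooth_on_add open_prod
        smooth_on_linear_pullback[OF bounded_linear_fst open_prod _ m1.smooth]
        smooth_on_linear_pullback[OF bounded_linear_snd open_prod _ m2.smooth]) auto
qed

lemma christoffel_product:
  assumes "x \<in> S\<^sub>1" "y \<in> S\<^sub>2"
  shows "christoffel (product_local G\<^sub>1 G\<^sub>2) (x, y) (u, u') (v, v')
    = (christoffel G\<^sub>1 x u v, christoffel G\<^sub>2 y u' v')"
proof (rule form_eqI[of "(x, y)"])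
  show xy: "(x, y) \<in> S\<^sub>1 \<times> S\<^sub>2" using assms by simp
  have d: "der (\<lambda>p. product_local G\<^sub>1 G\<^sub>2 p (v, v') (w, w')) (x, y) (u, u')
      = der (\<lambda>z. G\<^sub>1 z v w) x u + der (\<lambda>z. G\<^sub>2 z v' w') y u'" for u u' v v' w w'
  proof -
    have "((\<lambda>p. product_local G\<^sub>1 G\<^sub>2 p (v, v') (w, w')) has_derivative
        (\<lambda>u. der (\<lambda>z. G\<^sub>1 z v w) x (fst u) + der (\<lambda>z. G\<^sub>2 z v' w') y (snd u))) (at (x, y))"
      unfolding product_local_split fst_conv snd_conv
      by (intro has_derivative_add has_derivative_compose_fst[OF m1.metric_differentiable[OF assms(1)]]
          has_derivative_compose_snd[OF m2.metric_differentiable[OF assms(2)]])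
    from fun_cong[OF der_unique[OF this], of "(u, u')"] show ?thesis by simp
  qed
  show "product_local G\<^sub>1 G\<^sub>2 (x, y) (christoffel (product_local G\<^sub>1 G\<^sub>2) (x, y) (u, u') (v, v')) w
    = product_local G\<^sub>1 G\<^sub>2 (x, y) (christoffel G\<^sub>1 x u v, christoffel G\<^sub>2 y u' v') w" for w
    by (cases w) (simp add: koszul[OF xy] d m1.koszul[OF assms(1)] m2.koszul[OF assms(2)] field_simps)
qed

lemma curvature_product:
  assumes "x \<in> S\<^sub>1" "y \<in> S\<^sub>2"
  shows "curvature (product_local G\<^sub>1 G\<^sub>2) (x, y) (u, u') (v, v') (w, w')
    = (curvature G\<^sub>1 x u v w, curvature G\<^sub>2 y u' v' w')"
proof -
  have d: "der (\<lambda>p. christoffel (product_local G\<^sub>1 G\<^sub>2) p (v, v') (w, w')) (x, y) (u, u')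
    = (der (\<lambda>z. christoffel G\<^sub>1 z v w) x u, der (\<lambda>z. christoffel G\<^sub>2 z v' w') y u')" for u u' v v' w w'
  proof -
    have "der (\<lambda>p. christoffel (product_local G\<^sub>1 G\<^sub>2) p (v, v') (w, w')) (x, y)
        = der (\<lambda>p. (christoffel G\<^sub>1 (fst p) v w, christoffel G\<^sub>2 (snd p) v' w')) (x, y)"
      by (rule frechet_derivative_cong[OF open_S]) (use assms christoffel_product in auto)
    also have "\<dots> = (\<lambda>u. (der (\<lambda>z. christoffel G\<^sub>1 z v w) x (fst u), der (\<lambda>z. christoffel G\<^sub>2 z v' w') y (snd u)))"
      by (intro der_unique has_derivative_Pair has_derivative_compose_fst[OF m1.christoffel_differentiable[OF assms(1)]]
          has_derivative_compose_snd[OF m2.christoffel_differentiable[OF assms(2)]])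
    finally show ?thesis by simp
  qed
  show ?thesis by (simp add: curvature_def d christoffel_product[OF assms])
qed

lemma ricci_product:
  assumes "x \<in> S\<^sub>1" "y \<in> S\<^sub>2"
  shows "ricci (product_local G\<^sub>1 G\<^sub>2) (x, y) (v, v') (w, w') = ricci G\<^sub>1 x v w + ricci G\<^sub>2 y v' w'"
  by (simp add: ricci_def sum_Basis_prod curvature_product[OF assms])

text \<open>The trace of \<open>\<mu> (g\<^sub>1 - g\<^sub>2)\<close> is \<open>\<mu> (m\<^sub>1 - m\<^sub>2)\<close>.  Hence \<open>(d - 2) P + J g\<close> has the coefficient
\<open>(m\<^sub>1 + m\<^sub>2 - 2) + (m\<^sub>1 - m\<^sub>2) = 2 (m\<^sub>1 - 1)\<close> at \<open>\<mu> g\<^sub>1\<close> and \<open>- 2 (m\<^sub>2 - 1)\<close> at \<open>\<mu> g\<^sub>2\<close>.\<close>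

lemma schouten_product:
  assumes x: "x \<in> S\<^sub>1" and y: "y \<in> S\<^sub>2" and dim: "DIM('e) + DIM('f) \<ge> 3"
    and r1: "\<And>u v. ricci G\<^sub>1 x u v = 2 * (real DIM('e) - 1) * \<mu> * G\<^sub>1 x u v"
    and r2: "\<And>u v. ricci G\<^sub>2 y u v = 2 * (real DIM('f) - 1) * (- \<mu>) * G\<^sub>2 y u v"
  defines "P \<equiv> \<lambda>(u, u') (v, v'). \<mu> * (G\<^sub>1 x u v - G\<^sub>2 y u' v')"
  shows "schouten (product_local G\<^sub>1 G\<^sub>2) (x, y) = P" "linear (P u)"
    "sharp (product_local G\<^sub>1 G\<^sub>2) (x, y) (P (v, v')) = (\<mu> *\<^sub>R v, - \<mu> *\<^sub>R v')"
    "ricci (product_local G\<^sub>1 G\<^sub>2) (x, y) a b = (real DIM('e \<times> 'f) - 2) * P a b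
      + metric_trace (product_local G\<^sub>1 G\<^sub>2) (x, y) P * product_local G\<^sub>1 G\<^sub>2 (x, y) a b"
proof -
  have xy: "(x, y) \<in> S\<^sub>1 \<times> S\<^sub>2" using x y by simp
  show lin: "linear (P u)" for u
    unfolding P_def linear_iff
    by (auto simp: case_prod_beta m1.metric_simps[OF x] m2.metric_simps[OF y] algebra_simps)
  show sh: "sharp (product_local G\<^sub>1 G\<^sub>2) (x, y) (P (v, v')) = (\<mu> *\<^sub>R v, - \<mu> *\<^sub>R v')" for v v'
    by (rule sharp_unique[OF xy])
      (auto simp: P_def m1.metric_simps[OF x] m2.metric_simps[OF y] algebra_simps)
  have tr: "metric_trace (product_local G\<^sub>1 G\<^sub>2) (x, y) P = \<mu> * (real DIM('e) - real DIM('f))"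
    by (simp add: metric_trace_def sum_Basis_prod sh sum_negf algebra_simps)
  show ric: "ricci (product_local G\<^sub>1 G\<^sub>2) (x, y) a b = (real DIM('e \<times> 'f) - 2) * P a b
      + metric_trace (product_local G\<^sub>1 G\<^sub>2) (x, y) P * product_local G\<^sub>1 G\<^sub>2 (x, y) a b" for a b
    unfolding tr
    by (cases a; cases b) (simp add: ricci_product[OF x y] r1 r2 P_def algebra_simps)
  show "schouten (product_local G\<^sub>1 G\<^sub>2) (x, y) = P"
    by (rule schouten_unique[OF xy _ lin ric]) (use dim in simp)
qed

end

section \<open>Charts and products of charts\<close>

lemma overlap_imp_cimg: "x \<in> overlap M i j \<Longrightarrow> x \<in> cimg M i"
  by (auto simp: overlap_def cimg_def)

text \<open>The properties of an atlas that the comparison of local representatives uses.  They pass to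
products easily.\<close>

locale charted_space =
  fixes M :: "('i, 'p, 'e::euclidean_space) atlas"
  assumes inj_coord: "i \<in> charts M \<Longrightarrow> inj_on (coord M i) (cdom M i)"
    and open_cimg: "i \<in> charts M \<Longrightarrow> open (cimg M i)"
    and open_overlap: "i \<in> charts M \<Longrightarrow> j \<in> charts M \<Longrightarrow> open (overlap M i j)"
    and change_differentiable:
      "i \<in> charts M \<Longrightarrow> j \<in> charts M \<Longrightarrow> x \<in> overlap M i j \<Longrightarrow> change M i j differentiable (at x)"
begin

lemma param_coord: "i \<in> charts M \<Longrightarrow> p \<in> cdom M i \<Longrightarrow> param M i (coord M i p) = p"
  by (simp add: param_def inj_coord inv_into_f_f)

lemma param_in: "x \<in> cimg M i \<Longrightarrow> param M i x \<in> cdom M i"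
  by (simp add: param_def cimg_def inv_into_into)

lemma coord_param: "x \<in> cimg M i \<Longrightarrow> coord M i (param M i x) = x"
  by (simp add: param_def cimg_def f_inv_into_f)

lemma overlap_iff:
  assumes "i \<in> charts M"
  shows "x \<in> overlap M i j \<longleftrightarrow> x \<in> cimg M i \<and> param M i x \<in> cdom M j"
  using param_coord[OF assms] coord_param[of x i] param_in[of x i]
  unfolding overlap_def cimg_def by force

lemma change_in_cimg: "i \<in> charts M \<Longrightarrow> x \<in> overlap M i j \<Longrightarrow> change M i j x \<in> cimg M j"
  by (simp add: overlap_iff change_def cimg_def)

lemma param_change:
  "i \<in> charts M \<Longrightarrow> j \<in> charts M \<Longrightarrow> x \<in> overlap M i j \<Longrightarrow> param M j (change M i j x) = param M i x"
  by (simp add: overlap_iff change_def param_coord)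

lemma jacobian_works:
  "i \<in> charts M \<Longrightarrow> j \<in> charts M \<Longrightarrow> x \<in> overlap M i j
    \<Longrightarrow> (change M i j has_derivative jacobian M i j x) (at x)"
  unfolding jacobian_def by (rule der_has_derivative[OF change_differentiable])

lemma linear_jacobian:
  "i \<in> charts M \<Longrightarrow> j \<in> charts M \<Longrightarrow> x \<in> overlap M i j \<Longrightarrow> linear (jacobian M i j x)"
  using has_derivative_linear jacobian_works by blast

text \<open>The chain rule: the differential of a function is a covector field.\<close>

lemma differential_change:
  assumes ij: "i \<in> charts M" "j \<in> charts M" and x: "x \<in> overlap M i j" and f: "smooth_fun M f"
  shows "der (f \<circ> param M j) (change M i j x) (jacobian M i j x v) = der (f \<circ> param M i) x v"
proof -
  have "(f \<circ> param M j) differentiable (at (change M i j x))"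
    using f ij(2) change_in_cimg[OF ij(1) x] smooth_on_imp_differentiable
    unfolding smooth_fun_def by blast
  then have "((f \<circ> param M j) has_derivative der (f \<circ> param M j) (change M i j x)) (at (change M i j x))"
    by (rule der_has_derivative)
  from has_derivative_compose[OF jacobian_works[OF ij x] this]
  have "((\<lambda>y. (f \<circ> param M j) (change M i j y)) has_derivative
      (\<lambda>v. der (f \<circ> param M j) (change M i j x) (jacobian M i j x v))) (at x)" .
  then have "((f \<circ> param M i) has_derivative
      (\<lambda>v. der (f \<circ> param M j) (change M i j x) (jacobian M i j x v))) (at x)"
    by (rule has_derivative_transform_within_open[OF _ open_overlap[OF ij] x])
      (simp add: param_change[OF ij])
  from der_unique[OF this] show ?thesis by simp
qed

end

lemma smooth_manifold_charted_space:
  assumes "smooth_manifold M"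
  shows "charted_space M"
proof
  fix i assume i: "i \<in> charts M"
  have h: "homeomorphism (cdom M i) (cimg M i) (coord M i) (param M i)"
    and o: "open (cdom M i)" "open (cimg M i)"
    using assms i unfolding smooth_manifold_def by auto
  show "inj_on (coord M i) (cdom M i)"
    using h by (auto simp: homeomorphism_def intro: inj_on_inverseI)
  show "open (cimg M i)" by (rule o)
  fix j assume j: "j \<in> charts M"
  have "open (cdom M j)" using assms j unfolding smooth_manifold_def by auto
  then have "openin (top_of_set (cdom M i)) (cdom M i \<inter> cdom M j)"
    by (simp add: openin_open_Int)
  from homeomorphism_imp_open_map[OF h this] show op: "open (overlap M i j)"
    unfolding overlap_def using o(2) by (simp add: openin_open_eq)
  show "change M i j differentiable (at x)" if "x \<in> overlap M i j" for x
    using assms i j that smooth_on_imp_differentiable unfolding smooth_manifold_def by blast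
qed

locale product_charted_space = M1: charted_space M\<^sub>1 + M2: charted_space M\<^sub>2
  for M\<^sub>1 :: "('i, 'p, 'e::euclidean_space) atlas" and M\<^sub>2 :: "('j, 'q, 'f::euclidean_space) atlas"
begin

lemma charts_product: "charts (product_manifold M\<^sub>1 M\<^sub>2) = charts M\<^sub>1 \<times> charts M\<^sub>2"
  and cdom_product: "cdom (product_manifold M\<^sub>1 M\<^sub>2) (i, j) = cdom M\<^sub>1 i \<times> cdom M\<^sub>2 j"
  and coord_product: "coord (product_manifold M\<^sub>1 M\<^sub>2) (i, j) = map_prod (coord M\<^sub>1 i) (coord M\<^sub>2 j)"
  by (simp_all add: product_manifold_def)

lemma cimg_product: "cimg (product_manifold M\<^sub>1 M\<^sub>2) (i, j) = cimg M\<^sub>1 i \<times> cimg M\<^sub>2 j"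
  by (auto simp: cimg_def cdom_product coord_product)

lemma overlap_product:
  "overlap (product_manifold M\<^sub>1 M\<^sub>2) (i, j) (i', j') = overlap M\<^sub>1 i i' \<times> overlap M\<^sub>2 j j'"
  by (simp add: overlap_def cdom_product coord_product Times_Int_Times map_prod_surj_on[OF refl refl])

lemma inj_coord_product:
  "i \<in> charts M\<^sub>1 \<Longrightarrow> j \<in> charts M\<^sub>2 \<Longrightarrow>
    inj_on (coord (product_manifold M\<^sub>1 M\<^sub>2) (i, j)) (cdom (product_manifold M\<^sub>1 M\<^sub>2) (i, j))"
  by (simp add: cdom_product coord_product map_prod_inj_on M1.inj_coord M2.inj_coord)

lemma param_product:
  assumes "i \<in> charts M\<^sub>1" "j \<in> charts M\<^sub>2" "x \<in> cimg M\<^sub>1 i" "y \<in> cimg M\<^sub>2 j"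
  shows "param (product_manifold M\<^sub>1 M\<^sub>2) (i, j) (x, y) = (param M\<^sub>1 i x, param M\<^sub>2 j y)"
  unfolding param_def[of "product_manifold M\<^sub>1 M\<^sub>2"]
  by (rule inv_into_f_eq[OF inj_coord_product[OF assms(1,2)]])
    (simp_all add: cdom_product coord_product M1.param_in M2.param_in M1.coord_param M2.coord_param assms)

lemma change_product:
  assumes "i \<in> charts M\<^sub>1" "j \<in> charts M\<^sub>2" "x \<in> cimg M\<^sub>1 i" "y \<in> cimg M\<^sub>2 j"
  shows "change (product_manifold M\<^sub>1 M\<^sub>2) (i, j) (i', j') (x, y) = (change M\<^sub>1 i i' x, change M\<^sub>2 j j' y)"
  by (simp add: change_def param_product assms coord_product)

lemma change_product_has_derivative:
  assumes "i \<in> charts M\<^sub>1" "j \<in> charts M\<^sub>2" "i' \<in> charts M\<^sub>1" "j' \<in> charts M\<^sub>2"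
    and "x \<in> overlap M\<^sub>1 i i'" "y \<in> overlap M\<^sub>2 j j'"
  shows "(change (product_manifold M\<^sub>1 M\<^sub>2) (i, j) (i', j') has_derivative
    (\<lambda>u. (jacobian M\<^sub>1 i i' x (fst u), jacobian M\<^sub>2 j j' y (snd u)))) (at (x, y))"
proof (rule has_derivative_transform_within_open)
  show "((\<lambda>p. (change M\<^sub>1 i i' (fst p), change M\<^sub>2 j j' (snd p))) has_derivative
    (\<lambda>u. (jacobian M\<^sub>1 i i' x (fst u), jacobian M\<^sub>2 j j' y (snd u)))) (at (x, y))"
    unfolding jacobian_def
    by (intro has_derivative_Pair has_derivative_compose_fst has_derivative_compose_snd
        M1.change_differentiable M2.change_differentiable assms)
  show "open (overlap M\<^sub>1 i i' \<times> overlap M\<^sub>2 j j')"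
    by (intro open_Times M1.open_overlap M2.open_overlap assms)
  show "(x, y) \<in> overlap M\<^sub>1 i i' \<times> overlap M\<^sub>2 j j'" using assms by simp
qed (auto simp: change_product overlap_imp_cimg assms)

lemma jacobian_product:
  assumes "i \<in> charts M\<^sub>1" "j \<in> charts M\<^sub>2" "i' \<in> charts M\<^sub>1" "j' \<in> charts M\<^sub>2"
    and "x \<in> overlap M\<^sub>1 i i'" "y \<in> overlap M\<^sub>2 j j'"
  shows "jacobian (product_manifold M\<^sub>1 M\<^sub>2) (i, j) (i', j') (x, y) (u, v)
    = (jacobian M\<^sub>1 i i' x u, jacobian M\<^sub>2 j j' y v)"
  using der_unique[OF change_product_has_derivative[OF assms]]
  by (simp add: jacobian_def[of "product_manifold M\<^sub>1 M\<^sub>2"])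

sublocale charted_space "product_manifold M\<^sub>1 M\<^sub>2"
proof
  fix k assume k: "k \<in> charts (product_manifold M\<^sub>1 M\<^sub>2)"
  obtain i j where ij: "k = (i, j)" "i \<in> charts M\<^sub>1" "j \<in> charts M\<^sub>2"
    using k by (auto simp: charts_product)
  show "inj_on (coord (product_manifold M\<^sub>1 M\<^sub>2) k) (cdom (product_manifold M\<^sub>1 M\<^sub>2) k)"
    using inj_coord_product ij by simp
  show "open (cimg (product_manifold M\<^sub>1 M\<^sub>2) k)"
    using ij by (simp add: cimg_product open_Times M1.open_cimg M2.open_cimg)
  fix l assume l: "l \<in> charts (product_manifold M\<^sub>1 M\<^sub>2)"
  obtain i' j' where ij': "l = (i', j')" "i' \<in> charts M\<^sub>1" "j' \<in> charts M\<^sub>2"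
    using l by (auto simp: charts_product)
  show "open (overlap (product_manifold M\<^sub>1 M\<^sub>2) k l)"
    using ij ij' by (simp add: overlap_product open_Times M1.open_overlap M2.open_overlap)
  show "change (product_manifold M\<^sub>1 M\<^sub>2) k l differentiable (at p)"
    if "p \<in> overlap (product_manifold M\<^sub>1 M\<^sub>2) k l" for p
    using that ij ij' change_product_has_derivative[THEN differentiableI, of i j i' j']
    by (cases p) (auto simp: overlap_product)
qed

end

lemma riemannian_metric_local_metric:
  assumes "charted_space M" "riemannian_metric M g" "i \<in> charts M"
  shows "local_metric (cimg M i) (g i)"
proof
  show "open (cimg M i)" by (rule charted_space.open_cimg[OF assms(1,3)])
  show "inner_form (g i x)" if "x \<in> cimg M i" for x
    using assms(2,3) that unfolding riemannian_metric_def inner_form_def by blast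
  show "smooth_on (cimg M i) (\<lambda>x. g i x u v)" for u v
    using assms(2,3) unfolding riemannian_metric_def by blast
qed

section \<open>Special Einstein products\<close>

locale special_product =
  fixes M\<^sub>1 :: "('i, 'p::{t2_space,second_countable_topology}, 'e::euclidean_space) atlas"
    and M\<^sub>2 :: "('j, 'q::{t2_space,second_countable_topology}, 'f::euclidean_space) atlas"
    and g\<^sub>1 :: "('i, 'e) metric" and g\<^sub>2 :: "('j, 'f) metric"
    and \<mu>\<^sub>1 \<mu>\<^sub>2 :: real
  assumes special: "special_einstein_product M\<^sub>1 g\<^sub>1 \<mu>\<^sub>1 M\<^sub>2 g\<^sub>2 \<mu>\<^sub>2"
begin

abbreviation "M \<equiv> product_manifold M\<^sub>1 M\<^sub>2"
abbreviation "g \<equiv> product_metric g\<^sub>1 g\<^sub>2"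
abbreviation "c \<equiv> conformal_class M g"
abbreviation "P\<^sub>1 \<equiv> perp (einstein_tractors M\<^sub>1 g\<^sub>1 \<mu>\<^sub>1) (einstein_tractor \<mu>\<^sub>1)"
abbreviation "P\<^sub>2 \<equiv> perp (einstein_tractors M\<^sub>2 g\<^sub>2 \<mu>\<^sub>2) (einstein_tractor \<mu>\<^sub>2)"
abbreviation "T \<equiv> direct_sum (pullback_fst P\<^sub>1) (pullback_snd P\<^sub>2)"

lemma manifolds: "smooth_manifold M\<^sub>1" "smooth_manifold M\<^sub>2"
  and einstein: "einstein_metric M\<^sub>1 g\<^sub>1" "einstein_metric M\<^sub>2 g\<^sub>2"
  and dim: "DIM('e) + DIM('f) \<ge> 3"
  using special by (auto simp: special_einstein_product_def einstein_manifold_def)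

lemma riemannian: "riemannian_metric M\<^sub>1 g\<^sub>1" "riemannian_metric M\<^sub>2 g\<^sub>2"
  using einstein by (auto simp: einstein_metric_def)

sublocale product_charted_space M\<^sub>1 M\<^sub>2
  by (intro product_charted_space.intro smooth_manifold_charted_space manifolds)

lemma local_metrics:
  "i \<in> charts M\<^sub>1 \<Longrightarrow> local_metric (cimg M\<^sub>1 i) (g\<^sub>1 i)" "j \<in> charts M\<^sub>2 \<Longrightarrow> local_metric (cimg M\<^sub>2 j) (g\<^sub>2 j)"
  by (intro riemannian_metric_local_metric[OF M1.charted_space_axioms riemannian(1)]
      riemannian_metric_local_metric[OF M2.charted_space_axioms riemannian(2)]; assumption)+

text \<open>The tractors \<open>I\<^sub>i\<close> have squared length \<open>- 2 \<mu>\<^sub>i\<close>.  The condition on the lengths is imposed at pairs of points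
of charts; there is such a pair since manifolds are not empty.\<close>

lemma \<mu>: "\<mu>\<^sub>2 = - \<mu>\<^sub>1" "\<mu>\<^sub>1 \<noteq> 0" "\<mu>\<^sub>2 \<noteq> 0"
proof -
  obtain i x j y where "i \<in> charts M\<^sub>1" "x \<in> cimg M\<^sub>1 i" "j \<in> charts M\<^sub>2" "y \<in> cimg M\<^sub>2 j"
  proof -
    obtain p :: 'p and q :: 'q where True by blast
    have "p \<in> (\<Union>i\<in>charts M\<^sub>1. cdom M\<^sub>1 i)" "q \<in> (\<Union>j\<in>charts M\<^sub>2. cdom M\<^sub>2 j)"
      using manifolds unfolding smooth_manifold_def by auto
    then show thesis using that unfolding cimg_def by blast
  qed
  moreover from this have "g\<^sub>1 i x 0 0 = 0" "g\<^sub>2 j y 0 0 = 0"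
    using local_metric.metric_simps(7)[OF local_metrics(1)] local_metric.metric_simps(7)[OF local_metrics(2)]
    by auto
  ultimately show "\<mu>\<^sub>2 = - \<mu>\<^sub>1" "\<mu>\<^sub>1 \<noteq> 0" "\<mu>\<^sub>2 \<noteq> 0"
    using special
    by (force simp: special_einstein_product_def einstein_tractors_def einstein_tractor_def Let_def)+
qed

lemma ricci_factors:
  "i \<in> charts M\<^sub>1 \<Longrightarrow> x \<in> cimg M\<^sub>1 i \<Longrightarrow> ricci (g\<^sub>1 i) x u v = 2 * (real DIM('e) - 1) * \<mu>\<^sub>1 * g\<^sub>1 i x u v"
  "j \<in> charts M\<^sub>2 \<Longrightarrow> y \<in> cimg M\<^sub>2 j \<Longrightarrow> ricci (g\<^sub>2 j) y u' v' = 2 * (real DIM('f) - 1) * \<mu>\<^sub>2 * g\<^sub>2 j y u' v'"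
proof -
  assume i: "i \<in> charts M\<^sub>1" and x: "x \<in> cimg M\<^sub>1 i"
  have "DIM('e) \<ge> 3 \<Longrightarrow> \<exists>k. \<forall>u v. ricci (g\<^sub>1 i) x u v = k * g\<^sub>1 i x u v"
    using einstein(1) i x unfolding einstein_metric_def by blast
  moreover have "DIM('e) \<ge> 2 \<Longrightarrow> \<mu>\<^sub>1 = scalar_curvature (g\<^sub>1 i) x / (2 * real DIM('e) * (real DIM('e) - 1))"
    using special i x unfolding special_einstein_product_def einstein_manifold_def by blast
  ultimately show "ricci (g\<^sub>1 i) x u v = 2 * (real DIM('e) - 1) * \<mu>\<^sub>1 * g\<^sub>1 i x u v"
    by (rule local_metric.ricci_of_einstein[OF local_metrics(1)[OF i] x])
next
  assume j: "j \<in> charts M\<^sub>2" and y: "y \<in> cimg M\<^sub>2 j"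
  have "DIM('f) \<ge> 3 \<Longrightarrow> \<exists>k. \<forall>u v. ricci (g\<^sub>2 j) y u v = k * g\<^sub>2 j y u v"
    using einstein(2) j y unfolding einstein_metric_def by blast
  moreover have "DIM('f) \<ge> 2 \<Longrightarrow> \<mu>\<^sub>2 = scalar_curvature (g\<^sub>2 j) y / (2 * real DIM('f) * (real DIM('f) - 1))"
    using special j y unfolding special_einstein_product_def einstein_manifold_def by blast
  ultimately show "ricci (g\<^sub>2 j) y u' v' = 2 * (real DIM('f) - 1) * \<mu>\<^sub>2 * g\<^sub>2 j y u' v'"
    by (rule local_metric.ricci_of_einstein[OF local_metrics(2)[OF j] y])
qed

lemma metric_product_chart: "g (i, j) = product_local (g\<^sub>1 i) (g\<^sub>2 j)"
  by (simp add: product_metric_def product_local_def)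

lemma product_local_metric_chart:
  "i \<in> charts M\<^sub>1 \<Longrightarrow> j \<in> charts M\<^sub>2 \<Longrightarrow> product_local_metric (cimg M\<^sub>1 i) (g\<^sub>1 i) (cimg M\<^sub>2 j) (g\<^sub>2 j)"
  by (intro product_local_metric.intro local_metrics)

lemma local_metric_product:
  assumes "k \<in> charts M"
  shows "local_metric (cimg M k) (g k)"
proof -
  obtain i j where k: "k = (i, j)" "i \<in> charts M\<^sub>1" "j \<in> charts M\<^sub>2"
    using assms by (auto simp: charts_product)
  interpret product_local_metric "cimg M\<^sub>1 i" "g\<^sub>1 i" "cimg M\<^sub>2 j" "g\<^sub>2 j"
    by (rule product_local_metric_chart[OF k(2,3)])
  show ?thesis using local_metric_axioms by (simp add: k cimg_product metric_product_chart)
qed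

lemma inner_form_product: "k \<in> charts M \<Longrightarrow> x \<in> cimg M k \<Longrightarrow> inner_form (g k x)"
  using local_metric.form[OF local_metric_product] .

fun schouten_chart :: "'i \<times> 'j \<Rightarrow> 'e \<times> 'f \<Rightarrow> 'e \<times> 'f \<Rightarrow> 'e \<times> 'f \<Rightarrow> real" where
  "schouten_chart (i, j) (x, y) (u, u') (v, v') = \<mu>\<^sub>1 * (g\<^sub>1 i x u v - g\<^sub>2 j y u' v')"

lemma schouten_chart_works:
  assumes "k \<in> charts M" "p \<in> cimg M k"
  shows "schouten (g k) p = schouten_chart k p" "linear (schouten_chart k p u)"
    "sharp (g k) p (schouten_chart k p u) = (\<mu>\<^sub>1 *\<^sub>R fst u, - \<mu>\<^sub>1 *\<^sub>R snd u)"
    "ricci (g k) p a b = (real DIM('e \<times> 'f) - 2) * schouten_chart k p a b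
      + metric_trace (g k) p (schouten_chart k p) * g k p a b"
proof -
  obtain i j where k: "k = (i, j)" "i \<in> charts M\<^sub>1" "j \<in> charts M\<^sub>2"
    using assms by (auto simp: charts_product)
  obtain x y where p: "p = (x, y)" "x \<in> cimg M\<^sub>1 i" "y \<in> cimg M\<^sub>2 j"
    using assms by (auto simp: cimg_product k)
  interpret product_local_metric "cimg M\<^sub>1 i" "g\<^sub>1 i" "cimg M\<^sub>2 j" "g\<^sub>2 j"
    by (rule product_local_metric_chart[OF k(2,3)])
  have eq: "schouten_chart k p = (\<lambda>(u, u') (v, v'). \<mu>\<^sub>1 * (g\<^sub>1 i x u v - g\<^sub>2 j y u' v'))"
    by (auto simp: fun_eq_iff k p)
  have r1: "ricci (g\<^sub>1 i) x u v = 2 * (real DIM('e) - 1) * \<mu>\<^sub>1 * g\<^sub>1 i x u v" for u v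
    by (rule ricci_factors(1)[OF k(2) p(2)])
  have r2: "ricci (g\<^sub>2 j) y u v = 2 * (real DIM('f) - 1) * (- \<mu>\<^sub>1) * g\<^sub>2 j y u v" for u v
    using ricci_factors(2)[OF k(3) p(3)] by (simp only: \<mu>(1))
  note s = schouten_product[OF p(2,3) dim r1 r2]
  show "schouten (g k) p = schouten_chart k p"
    unfolding eq unfolding k(1) p(1) metric_product_chart by (rule s(1))
  show "linear (schouten_chart k p u)"
    unfolding eq by (rule s(2))
  show "sharp (g k) p (schouten_chart k p u) = (\<mu>\<^sub>1 *\<^sub>R fst u, - \<mu>\<^sub>1 *\<^sub>R snd u)"
    unfolding eq unfolding k(1) p(1) metric_product_chart using s(3)[of "fst u" "snd u"] by simp
  show "ricci (g k) p a b = (real DIM('e \<times> 'f) - 2) * schouten_chart k p a b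
      + metric_trace (g k) p (schouten_chart k p) * g k p a b"
    unfolding eq unfolding k(1) p(1) metric_product_chart by (rule s(4))
qed

text \<open>The identification in the scale of the product metric, and its inverse on the pairs of tractors that are
orthogonal to the Einstein tractors.\<close>

fun base_iso :: "'e tractor \<times> 'f tractor \<Rightarrow> ('e \<times> 'f) tractor" where
  "base_iso ((s\<^sub>1, t\<^sub>1, r\<^sub>1), (s\<^sub>2, t\<^sub>2, r\<^sub>2)) = (s\<^sub>1 + s\<^sub>2, (t\<^sub>1, t\<^sub>2), \<mu>\<^sub>1 * (s\<^sub>1 - s\<^sub>2))"

fun base_inv :: "('e \<times> 'f) tractor \<Rightarrow> 'e tractor \<times> 'f tractor" where
  "base_inv (\<sigma>, (t\<^sub>1, t\<^sub>2), \<rho>) =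
    (((\<sigma> + \<rho> / \<mu>\<^sub>1) / 2, t\<^sub>1, \<mu>\<^sub>1 * ((\<sigma> + \<rho> / \<mu>\<^sub>1) / 2)), ((\<sigma> - \<rho> / \<mu>\<^sub>1) / 2, t\<^sub>2, - \<mu>\<^sub>1 * ((\<sigma> - \<rho> / \<mu>\<^sub>1) / 2)))"

text \<open>The fibre of the bundle at every point of every chart: orthogonality to the Einstein tractor does not
involve the metric of the factor.\<close>

definition complement :: "('e tractor \<times> 'f tractor) set" where
  "complement = {(a, b). snd (snd a) = \<mu>\<^sub>1 * fst a \<and> snd (snd b) = - \<mu>\<^sub>1 * fst b}"

lemma in_complement [simp]:
  "((s\<^sub>1, t\<^sub>1, r\<^sub>1), (s\<^sub>2, t\<^sub>2, r\<^sub>2)) \<in> complement \<longleftrightarrow> r\<^sub>1 = \<mu>\<^sub>1 * s\<^sub>1 \<and> r\<^sub>2 = - \<mu>\<^sub>1 * s\<^sub>2"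
  by (simp add: complement_def)

lemma linear_base_iso: "linear base_iso"
  by (rule linearI) (auto simp: algebra_simps)

lemma linear_base_inv: "linear base_inv"
  by (rule linearI) (auto simp: field_simps)

lemma base_inv_base_iso: "v \<in> complement \<Longrightarrow> base_inv (base_iso v) = v"
  using \<mu> by (cases v rule: base_iso.cases) (simp add: field_simps)

lemma base_iso_base_inv: "base_iso (base_inv v) = v"
  using \<mu> by (cases v rule: base_inv.cases) (simp add: field_simps)

lemma base_inv_in: "base_inv v \<in> complement"
  by (cases v rule: base_inv.cases) simp

lemma subspace_complement: "subspace complement"
  by (auto simp: subspace_def zero_prod_def algebra_simps)

lemma bij_base_iso: "bij_betw base_iso complement UNIV"
  by (rule bij_betw_byWitness[of _ base_inv])
    (use base_inv_base_iso base_iso_base_inv base_inv_in in blast)+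

lemma fib_perp:
  "i \<in> charts M\<^sub>1 \<Longrightarrow> x \<in> cimg M\<^sub>1 i \<Longrightarrow> a \<in> fib P\<^sub>1 i x \<longleftrightarrow> snd (snd a) = \<mu>\<^sub>1 * fst a"
  "j \<in> charts M\<^sub>2 \<Longrightarrow> y \<in> cimg M\<^sub>2 j \<Longrightarrow> b \<in> fib P\<^sub>2 j y \<longleftrightarrow> snd (snd b) = \<mu>\<^sub>2 * fst b"
  using local_metric.metric_simps(7)[OF local_metrics(1)] local_metric.metric_simps(7)[OF local_metrics(2)]
  by (cases a; cases b; simp add: perp_def einstein_tractors_def einstein_tractor_def)+

lemma fib_T:
  assumes "k \<in> charts M" "p \<in> cimg M k"
  shows "fib T k p = complement"
proof -
  obtain i j where k: "k = (i, j)" "i \<in> charts M\<^sub>1" "j \<in> charts M\<^sub>2"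
    using assms by (auto simp: charts_product)
  obtain x y where p: "p = (x, y)" "x \<in> cimg M\<^sub>1 i" "y \<in> cimg M\<^sub>2 j"
    using assms by (auto simp: cimg_product k)
  show ?thesis
    using fib_perp(1)[OF k(2) p(2)] fib_perp(2)[OF k(3) p(3)]
    by (auto simp: \<mu>(1) k p direct_sum_def pullback_fst_def pullback_snd_def complement_def)
qed

lemma base_iso_met:
  assumes "v \<in> complement" "w \<in> complement"
  shows "tractor_met (g k) p (base_iso v) (base_iso w) = met T k p v w"
proof -
  obtain i j x y where kp: "k = (i, j)" "p = (x, y)" by (cases k; cases p)
  show ?thesis
    using assms \<mu> by (cases v rule: base_iso.cases; cases w rule: base_iso.cases)
      (simp add: kp direct_sum_def pullback_fst_def pullback_snd_def perp_def einstein_tractors_def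
        metric_product_chart field_simps)
qed

text \<open>Write \<open>u = (u\<^sub>1, u\<^sub>2)\<close>.  In the middle slot the Einstein connections contribute \<open>(2 \<mu> s\<^sub>1 u\<^sub>1, - 2 \<mu> s\<^sub>2 u\<^sub>2)\<close>, which
is \<open>\<rho> u\<close> plus \<open>\<sigma>\<close> times the raised Schouten tensor at \<open>u\<close>, that is
\<open>\<mu> (s\<^sub>1 - s\<^sub>2) (u\<^sub>1, u\<^sub>2) + (s\<^sub>1 + s\<^sub>2) \<mu> (u\<^sub>1, - u\<^sub>2)\<close>.\<close>

lemma base_iso_conn:
  assumes k: "k \<in> charts M" and p: "p \<in> cimg M k" and v: "v \<in> complement"
  shows "conn T k p u v \<in> complement" "base_iso (conn T k p u v) = normal_conn (g k) p u (base_iso v)"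
proof -
  obtain i j where k': "k = (i, j)" "i \<in> charts M\<^sub>1" "j \<in> charts M\<^sub>2"
    using k by (auto simp: charts_product)
  obtain x y where p': "p = (x, y)" "x \<in> cimg M\<^sub>1 i" "y \<in> cimg M\<^sub>2 j"
    using p by (auto simp: cimg_product k')
  interpret product_local_metric "cimg M\<^sub>1 i" "g\<^sub>1 i" "cimg M\<^sub>2 j" "g\<^sub>2 j"
    by (rule product_local_metric_chart[OF k'(2,3)])
  obtain s\<^sub>1 t\<^sub>1 r\<^sub>1 s\<^sub>2 t\<^sub>2 r\<^sub>2 where v': "v = ((s\<^sub>1, t\<^sub>1, r\<^sub>1), (s\<^sub>2, t\<^sub>2, r\<^sub>2))" by (cases v rule: base_iso.cases)
  obtain u\<^sub>1 u\<^sub>2 where u: "u = (u\<^sub>1, u\<^sub>2)" by (cases u)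
  have c: "conn T k p u v = (einstein_conn (g\<^sub>1 i) \<mu>\<^sub>1 x u\<^sub>1 (s\<^sub>1, t\<^sub>1, r\<^sub>1), einstein_conn (g\<^sub>2 j) \<mu>\<^sub>2 y u\<^sub>2 (s\<^sub>2, t\<^sub>2, r\<^sub>2))"
    by (simp add: k' p' v' u direct_sum_def pullback_fst_def pullback_snd_def perp_def einstein_tractors_def)
  show "conn T k p u v \<in> complement" unfolding c by (simp add: \<mu>(1))
  have r: "r\<^sub>1 = \<mu>\<^sub>1 * s\<^sub>1" "r\<^sub>2 = - \<mu>\<^sub>1 * s\<^sub>2" using v by (auto simp: v')
  have "normal_conn (g k) p u (base_iso v) = (- g k p u (t\<^sub>1, t\<^sub>2),
      christoffel (g k) p u (t\<^sub>1, t\<^sub>2) + (\<mu>\<^sub>1 * (s\<^sub>1 - s\<^sub>2)) *\<^sub>R u + (s\<^sub>1 + s\<^sub>2) *\<^sub>R (\<mu>\<^sub>1 *\<^sub>R u\<^sub>1, - \<mu>\<^sub>1 *\<^sub>R u\<^sub>2),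
      - schouten_chart k p u (t\<^sub>1, t\<^sub>2))"
    unfolding v' base_iso.simps normal_conn.simps schouten_chart_works(1)[OF k p]
      schouten_chart_works(3)[OF k p] by (simp add: u)
  also have "\<dots> = base_iso (conn T k p u v)"
    unfolding c by (simp add: k' p' u metric_product_chart christoffel_product[OF p'(2,3)] r \<mu>(1) algebra_simps
        flip: scaleR_add_left)
  finally show "base_iso (conn T k p u v) = normal_conn (g k) p u (base_iso v)" ..
qed

lemma point_in_chart:
  obtains k x where "k \<in> charts M" "x \<in> cimg M k" "param M k x = p"
proof -
  have "fst p \<in> (\<Union>i\<in>charts M\<^sub>1. cdom M\<^sub>1 i)" "snd p \<in> (\<Union>j\<in>charts M\<^sub>2. cdom M\<^sub>2 j)"
    using manifolds unfolding smooth_manifold_def by auto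
  then obtain i j where "i \<in> charts M\<^sub>1" "j \<in> charts M\<^sub>2" "p \<in> cdom M (i, j)"
    by (auto simp: cdom_product mem_Times_iff)
  then show thesis
    using that[of "(i, j)" "coord M (i, j) p"] param_coord[of "(i, j)" p]
    by (simp add: charts_product cimg_def)
qed

text \<open>The logarithmic conformal factor relative to the product metric.  The choice is harmless: by
\<open>rescaling_scale_add\<close> below, such a factor is unique.\<close>

definition scale where "scale g' = (SOME \<omega>. rescaling M \<omega> g g')"

lemma rescaling_scale: "g' \<in> c \<Longrightarrow> rescaling M (scale g') g g'"
  using someI_ex[of "\<lambda>\<omega>. rescaling M \<omega> g g'"] by (simp add: conformal_class_def scale_def)

lemma rescaling_scale_add:
  assumes "g' \<in> c" "g'' \<in> c" "rescaling M \<omega> g' g''"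
  shows "scale g'' p = scale g' p + \<omega> p"
proof -
  obtain k x where k: "k \<in> charts M" and x: "x \<in> cimg M k" and p: "param M k x = p"
    by (rule point_in_chart)
  obtain b :: "'e \<times> 'f" where "b \<in> Basis" using nonempty_Basis by blast
  then have pos: "g k x b b > 0"
    using inner_form_pos[OF inner_form_product[OF k x], of b] by (simp add: nonzero_Basis)
  have "exp (2 * scale g'' p) * g k x b b = exp (2 * \<omega> p) * (exp (2 * scale g' p) * g k x b b)"
    using rescaling_scale[OF assms(1)] rescaling_scale[OF assms(2)] assms(3) k x p
    unfolding rescaling_def by metis
  then have "exp (2 * scale g'' p) = exp (2 * \<omega> p) * exp (2 * scale g' p)"
    using pos by simp
  then have "exp (2 * scale g'' p) = exp (2 * \<omega> p + 2 * scale g' p)" by (simp only: exp_add)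
  then show ?thesis by simp
qed

lemma rescaling_self: "rescaling M (\<lambda>p. 0) g g"
  using open_cimg by (simp add: rescaling_def smooth_fun_def o_def smooth_on_const)

lemma self_in_class: "g \<in> c"
  using rescaling_self by (auto simp: conformal_class_def)

lemma scale_self: "scale g p = 0"
  using rescaling_scale_add[OF self_in_class self_in_class rescaling_scale[OF self_in_class], of p] by simp

lemma conformal_change_chart:
  assumes "g' \<in> c" "k \<in> charts M"
  shows "conformal_change (cimg M k) (g k) (scale g' \<circ> param M k) (g' k)"
  using rescaling_scale[OF assms(1)] assms(2)
  by (intro conformal_change.intro local_metric_product conformal_change_axioms.intro)
    (auto simp: rescaling_def smooth_fun_def)

text \<open>The identification in the scale of an arbitrary metric of the conformal class.\<close>

definition iso :: "('i \<times> 'j, 'e \<times> 'f) metric \<Rightarrow> 'i \<times> 'j \<Rightarrow> 'e \<times> 'f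
    \<Rightarrow> 'e tractor \<times> 'f tractor \<Rightarrow> ('e \<times> 'f) tractor" where
  "iso g' k x v = change_scale (g k) x ((scale g' \<circ> param M k) x) (der (scale g' \<circ> param M k) x) (base_iso v)"

text \<open>The projections of the two canonical tractors, written with \<open>\<mu>\<^sub>1 = - \<mu>\<^sub>2\<close>.\<close>

definition canonical_pair :: "'e tractor \<times> 'f tractor" where
  "canonical_pair = ((1 / (2 * \<mu>\<^sub>1), 0, 1 / 2), (- (1 / (2 * \<mu>\<^sub>1)), 0, 1 / 2))"

definition canonical :: "('i \<times> 'j, 'e \<times> 'f) metric \<Rightarrow> 'i \<times> 'j \<Rightarrow> 'e \<times> 'f \<Rightarrow> 'e tractor \<times> 'f tractor" where
  "canonical g' k x = exp (scale g' (param M k x)) *\<^sub>R canonical_pair"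

lemma canonical_pair_in: "canonical_pair \<in> complement"
  using \<mu>(2) by (simp add: canonical_pair_def)

lemma base_iso_canonical_pair: "base_iso canonical_pair = (0, 0, 1)"
  using \<mu>(2) by (simp add: canonical_pair_def zero_prod_def)

lemma transition_T:
  assumes k: "k \<in> charts M" and l: "l \<in> charts M" and x: "x \<in> overlap M k l" and v: "v \<in> complement"
  shows "transition T k l x v \<in> complement"
    "base_iso (transition T k l x v) = tractor_trans M k l x (base_iso v)"
proof -
  obtain i j where k': "k = (i, j)" "i \<in> charts M\<^sub>1" "j \<in> charts M\<^sub>2"
    using k by (auto simp: charts_product)
  obtain i' j' where l': "l = (i', j')" "i' \<in> charts M\<^sub>1" "j' \<in> charts M\<^sub>2"
    using l by (auto simp: charts_product)
  obtain y z where x': "x = (y, z)" "y \<in> overlap M\<^sub>1 i i'" "z \<in> overlap M\<^sub>2 j j'"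
    using x by (cases x) (auto simp: k' l' overlap_product)
  show "transition T k l x v \<in> complement"
    "base_iso (transition T k l x v) = tractor_trans M k l x (base_iso v)"
    using v by (cases v rule: base_iso.cases; simp add: k' l' x' direct_sum_def pullback_fst_def
        pullback_snd_def perp_def einstein_tractors_def jacobian_product)+
qed

lemma metric_invariant:
  assumes k: "k \<in> charts M" and l: "l \<in> charts M" and x: "x \<in> overlap M k l"
  shows "g l (change M k l x) (jacobian M k l x u) (jacobian M k l x v) = g k x u v"
proof -
  obtain i j where k': "k = (i, j)" "i \<in> charts M\<^sub>1" "j \<in> charts M\<^sub>2"
    using k by (auto simp: charts_product)
  obtain i' j' where l': "l = (i', j')" "i' \<in> charts M\<^sub>1" "j' \<in> charts M\<^sub>2"
    using l by (auto simp: charts_product)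
  obtain y z where x': "x = (y, z)" "y \<in> overlap M\<^sub>1 i i'" "z \<in> overlap M\<^sub>2 j j'"
    using x by (cases x) (auto simp: k' l' overlap_product)
  have "g\<^sub>1 i' (change M\<^sub>1 i i' y) (jacobian M\<^sub>1 i i' y a) (jacobian M\<^sub>1 i i' y b) = g\<^sub>1 i y a b" for a b
    using riemannian(1) k' l' x' unfolding riemannian_metric_def by blast
  moreover have "g\<^sub>2 j' (change M\<^sub>2 j j' z) (jacobian M\<^sub>2 j j' z a) (jacobian M\<^sub>2 j j' z b) = g\<^sub>2 j z a b" for a b
    using riemannian(2) k' l' x' unfolding riemannian_metric_def by blast
  ultimately show ?thesis
    by (cases u; cases v) (simp add: k' l' x' jacobian_product change_product
        overlap_imp_cimg[OF x'(2)] overlap_imp_cimg[OF x'(3)] metric_product_chart)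
qed

lemma iso_transition:
  assumes g': "g' \<in> c" and k: "k \<in> charts M" and l: "l \<in> charts M" and x: "x \<in> overlap M k l"
    and v: "v \<in> complement"
  shows "iso g' l (change M k l x) (transition T k l x v) = tractor_trans M k l x (iso g' k x v)"
proof -
  have xk: "x \<in> cimg M k" by (rule overlap_imp_cimg[OF x])
  have xl: "change M k l x \<in> cimg M l" by (rule change_in_cimg[OF k x])
  interpret conformal_change "cimg M k" "g k" "scale g' \<circ> param M k" "g' k"
    by (rule conformal_change_chart[OF g' k])
  obtain \<sigma> \<mu> \<rho> where b: "base_iso v = (\<sigma>, \<mu>, \<rho>)" by (cases "base_iso v")
  have "smooth_fun M (scale g')" using rescaling_scale[OF g'] by (simp add: rescaling_def)
  then have d: "der (scale g' \<circ> param M l) (change M k l x) (jacobian M k l x w)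
      = der (scale g' \<circ> param M k) x w" for w
    by (rule differential_change[OF k l x])
  have a: "(scale g' \<circ> param M l) (change M k l x) = (scale g' \<circ> param M k) x"
    by (simp add: param_change[OF k l x])
  show ?thesis
    unfolding iso_def transition_T(2)[OF k l x v] b tractor_trans.simps a
    by (subst change_scale_equivariant[where J = "jacobian M k l x" and G = "g k" and x = x
          and H = "g l" and y = "change M k l x" and \<Upsilon> = "der (scale g' \<circ> param M k) x"
          and \<Upsilon>' = "der (scale g' \<circ> param M l) (change M k l x)",
          OF inner_form_product[OF k xk] inner_form_product[OF l xl] linear_jacobian[OF k l x]
            metric_invariant[OF k l x] linear_d\<omega>[OF xk] d]) simp
qed

lemma iso_linear_isometry:
  assumes g': "g' \<in> c" and k: "k \<in> charts M" and x: "x \<in> cimg M k"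
  shows "linear (iso g' k x)" "bij_betw (iso g' k x) complement UNIV"
    "v \<in> complement \<Longrightarrow> w \<in> complement \<Longrightarrow>
      tractor_met (g' k) x (iso g' k x v) (iso g' k x w) = met T k x v w"
proof -
  interpret conformal_change "cimg M k" "g k" "scale g' \<circ> param M k" "g' k"
    by (rule conformal_change_chart[OF g' k])
  have eq: "iso g' k x = change_scale (g k) x ((scale g' \<circ> param M k) x) (der (scale g' \<circ> param M k) x) \<circ> base_iso"
    by (simp add: fun_eq_iff iso_def)
  show "linear (iso g' k x)"
    unfolding eq by (rule linear_compose[OF linear_base_iso linear_change_scale[OF linear_d\<omega>[OF x]]])
  show "bij_betw (iso g' k x) complement UNIV"
    unfolding eq by (rule bij_betw_trans[OF bij_base_iso bij_change_scale[of "g k" x, OF form[OF x] linear_d\<omega>[OF x]]])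
  show "tractor_met (g' k) x (iso g' k x v) (iso g' k x w) = met T k x v w"
    if "v \<in> complement" "w \<in> complement"
    unfolding iso_def base_iso_met[OF that, symmetric]
    by (rule tractor_met_change_scale[of "g k" x _ "g' k", OF form[OF x] linear_d\<omega>[OF x] rescaled[OF x]])
qed

lemma smooth_base_iso_iff:
  assumes "open N" "\<And>x. x \<in> N \<Longrightarrow> s x \<in> complement"
  shows "smooth_on N (\<lambda>x. base_iso (s x)) \<longleftrightarrow> smooth_on N s"
proof
  assume "smooth_on N (\<lambda>x. base_iso (s x))"
  then have "smooth_on N (\<lambda>x. base_inv (base_iso (s x)))"
    using smooth_on_bounded_linear[OF _ assms(1)] linear_base_inv linear_conv_bounded_linear by blast
  then show "smooth_on N s"
    by (rule smooth_on_cong[OF assms(1), rotated]) (simp add: base_inv_base_iso assms(2))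
next
  assume "smooth_on N s"
  then show "smooth_on N (\<lambda>x. base_iso (s x))"
    using smooth_on_bounded_linear[OF _ assms(1)] linear_base_iso linear_conv_bounded_linear by blast
qed

lemma smooth_iso_iff:
  assumes g': "g' \<in> c" and k: "k \<in> charts M" and N: "open N" "N \<subseteq> cimg M k"
    and s: "\<And>x. x \<in> N \<Longrightarrow> s x \<in> complement"
  shows "smooth_on N s \<longleftrightarrow> smooth_on N (\<lambda>x. iso g' k x (s x))"
proof -
  interpret conformal_change N "g k" "scale g' \<circ> param M k" "g' k"
    by (rule conformal_change_subset[OF conformal_change_chart[OF g' k] N])
  show ?thesis
    unfolding iso_def smooth_change_scale_iff using smooth_base_iso_iff[OF N(1), of s] s by simp
qed

text \<open>\<open>base_inv \<circ> base_iso\<close> is a linear projection onto the complement, and linear maps commute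
with differentiation.\<close>

lemma derivative_in_complement:
  assumes N: "open N" "x \<in> N" and s: "\<And>y. y \<in> N \<Longrightarrow> s y \<in> complement" and d: "s differentiable (at x)"
  shows "der s x u \<in> complement"
proof -
  define L where "L v = base_inv (base_iso v)" for v
  have "linear L" unfolding L_def using linear_compose[OF linear_base_iso linear_base_inv] by (simp add: o_def)
  then have L: "bounded_linear L" by (simp add: linear_conv_bounded_linear)
  have "der s x u = der (\<lambda>y. L (s y)) x u"
    by (rule fun_cong[OF frechet_derivative_cong[OF N]]) (simp add: L_def base_inv_base_iso s)
  also have "\<dots> = L (der s x u)" by (rule der_bounded_linear[OF L d])
  finally show ?thesis using base_inv_in by (metis L_def)
qed

text \<open>Both steps of the identification intertwine the connections: the first is constant in the coordinates,
so that only the connection forms matter, and the second is the change of scale.\<close>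

lemma iso_cov_deriv:
  assumes g': "g' \<in> c" and k: "k \<in> charts M" and N: "open N" "N \<subseteq> cimg M k"
    and s: "\<And>x. x \<in> N \<Longrightarrow> s x \<in> complement" and s_smooth: "smooth_on N s" and x: "x \<in> N"
  shows "cov_deriv T k s x u \<in> complement"
    "iso g' k x (cov_deriv T k s x u) = cov_deriv (normal_tractors M g') k (\<lambda>y. iso g' k y (s y)) x u"
proof -
  interpret conformal_change "cimg M k" "g k" "scale g' \<circ> param M k" "g' k"
    by (rule conformal_change_chart[OF g' k])
  have xk: "x \<in> cimg M k" using x N by blast
  have ds: "s differentiable (at x)" by (rule smooth_on_imp_differentiable[OF s_smooth x])
  note conn = base_iso_conn[OF k xk s[OF x]]
  show "cov_deriv T k s x u \<in> complement"
    unfolding cov_deriv_def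
    by (rule subspace_add[OF subspace_complement derivative_in_complement[OF N(1) x s ds] conn(1)])
  have b: "bounded_linear base_iso" using linear_base_iso by (simp add: linear_conv_bounded_linear)
  have db: "(\<lambda>y. base_iso (s y)) differentiable (at x)"
    using bounded_linear.has_derivative[OF b der_has_derivative[OF ds]] by (rule differentiableI)
  note S = schouten_chart_works[OF k xk]
  have S': "schouten (g' k) x = schouten_rescaled x (schouten_chart k x)"
  proof (rule hat.schouten_unique[OF xk])
    show "DIM('e \<times> 'f) \<ge> 3" using dim by simp
    show "linear (schouten_rescaled x (schouten_chart k x) u)" for u
      by (rule linear_schouten_rescaled[of x "schouten_chart k x" u, OF xk S(2)])
    show "ricci (g' k) x u v = (real DIM('e \<times> 'f) - 2) * schouten_rescaled x (schouten_chart k x) u v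
        + metric_trace (g' k) x (schouten_rescaled x (schouten_chart k x)) * g' k x u v" for u v
      by (rule ricci_schouten_rescaled[of x "schouten_chart k x", OF xk S(2) S(4)])
  qed
  have "base_iso (cov_deriv T k s x u)
      = der (\<lambda>y. base_iso (s y)) x u + normal_conn (g k) x u (base_iso (s x))"
    unfolding cov_deriv_def linear_add[OF linear_base_iso] conn(2) der_bounded_linear[OF b ds] ..
  then show "iso g' k x (cov_deriv T k s x u) = cov_deriv (normal_tractors M g') k (\<lambda>y. iso g' k y (s y)) x u"
    unfolding iso_def using change_scale_conn[OF xk S(1) S' S(2) db, of u]
    by (simp add: cov_deriv_def normal_tractors_def)
qed

lemma iso_bundle_isomorphism:
  assumes g': "g' \<in> c"
  shows "bundle_isomorphism M T (normal_tractors M g') (iso g')"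
proof -
  have fib: "fib T k x = complement" if "k \<in> charts M" "x \<in> cimg M k" for k x
    using fib_T that .
  show ?thesis
    unfolding bundle_isomorphism_def
  proof (intro conjI ballI allI impI)
    fix k x assume k: "k \<in> charts M" and x: "x \<in> cimg M k"
    note lin = iso_linear_isometry[OF g' k x]
    show "subspace (fib T k x)" by (simp add: fib k x subspace_complement)
    show "iso g' k x (a *\<^sub>R v + b *\<^sub>R w) = a *\<^sub>R iso g' k x v + b *\<^sub>R iso g' k x w" for a b v w
      by (simp add: linear_add[OF lin(1)] linear_cmul[OF lin(1)])
    show "bij_betw (iso g' k x) (fib T k x) (fib (normal_tractors M g') k x)"
      using lin(2) by (simp add: fib k x normal_tractors_def)
    show "met (normal_tractors M g') k x (iso g' k x v) (iso g' k x w) = met T k x v w"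
      if "v \<in> fib T k x" "w \<in> fib T k x" for v w
      using lin(3) that by (simp add: fib k x normal_tractors_def)
  next
    fix k l x v assume k: "k \<in> charts M" and l: "l \<in> charts M" and x: "x \<in> overlap M k l"
      and "v \<in> fib T k x"
    then have v: "v \<in> complement" using fib[OF k overlap_imp_cimg[OF x]] by simp
    show "transition T k l x v \<in> fib T l (change M k l x)"
      using transition_T(1)[OF k l x v] fib[OF l change_in_cimg[OF k x]] by simp
    show "iso g' l (change M k l x) (transition T k l x v) = transition (normal_tractors M g') k l x (iso g' k x v)"
      using iso_transition[OF g' k l x v] by (simp add: normal_tractors_def)
  next
    fix k N s assume k: "k \<in> charts M" and "open N \<and> N \<subseteq> cimg M k \<and> (\<forall>x\<in>N. s x \<in> fib T k x)"
    then have N: "open N" "N \<subseteq> cimg M k" and "\<forall>x\<in>N. s x \<in> fib T k x" by auto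
    then have s: "s x \<in> complement" if "x \<in> N" for x
      using fib[OF k, of x] that by blast
    show "smooth_on N s \<longleftrightarrow> smooth_on N (\<lambda>x. iso g' k x (s x))"
      by (rule smooth_iso_iff[OF g' k N]) (rule s)
    fix x u assume "smooth_on N s" and x: "x \<in> N"
    have cov: "cov_deriv T k s x u \<in> complement"
      "iso g' k x (cov_deriv T k s x u) = cov_deriv (normal_tractors M g') k (\<lambda>y. iso g' k y (s y)) x u"
      using iso_cov_deriv[OF g' k N _ \<open>smooth_on N s\<close> x] s by blast+
    show "cov_deriv T k s x u \<in> fib T k x" using cov(1) fib[OF k, of x] x N(2) by auto
    show "iso g' k x (cov_deriv T k s x u) = cov_deriv (normal_tractors M g') k (\<lambda>y. iso g' k y (s y)) x u"
      by (rule cov(2))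
  qed
qed

lemma iso_canonical:
  assumes "g' \<in> c" "k \<in> charts M" "x \<in> cimg M k"
  shows "iso g' k x (canonical g' k x) = canonical_tractor k x"
proof -
  interpret conformal_change "cimg M k" "g k" "scale g' \<circ> param M k" "g' k"
    by (rule conformal_change_chart[OF assms(1,2)])
  show ?thesis
    by (simp add: iso_def canonical_def linear_cmul[OF linear_base_iso] base_iso_canonical_pair
        canonical_tractor_def d\<omega>_simps[OF assms(3)] flip: exp_add)
qed

lemma iso_change_scale:
  assumes g': "g' \<in> c" and g'': "g'' \<in> c" and \<omega>: "rescaling M \<omega> g' g''"
    and k: "k \<in> charts M" and x: "x \<in> cimg M k"
  shows "iso g'' k x v = change_scale (g' k) x (\<omega> (param M k x)) (der (\<omega> \<circ> param M k) x) (iso g' k x v)"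
proof -
  interpret conformal_change "cimg M k" "g k" "scale g' \<circ> param M k" "g' k"
    by (rule conformal_change_chart[OF g' k])
  have "smooth_on (cimg M k) (\<omega> \<circ> param M k)"
    using \<omega> k by (simp add: rescaling_def smooth_fun_def)
  then have d: "(\<omega> \<circ> param M k) differentiable (at x)" using x smooth_on_imp_differentiable by blast
  have "scale g'' \<circ> param M k = (\<lambda>y. (scale g' \<circ> param M k) y + (\<omega> \<circ> param M k) y)"
    by (simp add: fun_eq_iff rescaling_scale_add[OF g' g'' \<omega>])
  then have d'': "der (scale g'' \<circ> param M k) x
      = (\<lambda>v. der (scale g' \<circ> param M k) x v + der (\<omega> \<circ> param M k) x v)"
    using der_add[OF \<omega>_differentiable[OF x] d] by (intro ext) (simp only:)
  show ?thesis
    unfolding iso_def d''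
    using change_scale_compose[of "g k" x "der (scale g' \<circ> param M k) x" "der (\<omega> \<circ> param M k) x" "g' k",
        OF form[OF x] linear_d\<omega>[OF x] linear_frechet_derivative[OF d] rescaled[OF x]]
    by (simp add: rescaling_scale_add[OF g' g'' \<omega>])
qed

text \<open>A coordinate change does not affect a tractor with vanishing middle slot, and the conformal factors add
up under composition.\<close>

lemma canonical_weighted_section: "weighted_section M c T 1 canonical"
  unfolding weighted_section_def
proof (intro conjI ballI allI impI)
  fix g' k assume g': "g' \<in> c" and k: "k \<in> charts M"
  have "smooth_on (cimg M k) (scale g' \<circ> param M k)"
    using rescaling_scale[OF g'] k by (simp add: rescaling_def smooth_fun_def)
  then show "smooth_on (cimg M k) (canonical g' k)"
    unfolding canonical_def[abs_def]
    by (intro smooth_on_scaleR smooth_on_exp smooth_on_const open_cimg k) (simp add: o_def)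
  have mem: "canonical g' k x \<in> complement" for k x
    unfolding canonical_def by (rule subspace_scale[OF subspace_complement canonical_pair_in])
  then show "canonical g' k x \<in> fib T k x" if "x \<in> cimg M k" for x
    using fib_T[OF k that] by simp
  show "canonical g' l (change M k l x) = transition T k l x (canonical g' k x)"
    if l: "l \<in> charts M" and x: "x \<in> overlap M k l" for l x
  proof -
    have "base_iso (transition T k l x (canonical g' k x)) = base_iso (canonical g' k x)"
      using transition_T(2)[OF k l x mem] linear_0[OF linear_jacobian[OF k l x]]
      by (simp add: canonical_def linear_cmul[OF linear_base_iso] base_iso_canonical_pair)
    then have "transition T k l x (canonical g' k x) = canonical g' k x"
      using base_inv_base_iso[OF mem] base_inv_base_iso[OF transition_T(1)[OF k l x mem]] by metis
    then show ?thesis by (simp add: canonical_def param_change[OF k l x])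
  qed
next
  fix g' g'' \<omega> k x assume "g' \<in> c" "g'' \<in> c" "rescaling M \<omega> g' g''"
  then show "canonical g'' k x = exp (1 * \<omega> (param M k x)) *\<^sub>R canonical g' k x"
    by (simp add: canonical_def rescaling_scale_add exp_add mult.commute)
qed

text \<open>The component of \<open>(0, 0, 1)\<close> along \<open>I = (1, 0, - \<mu>)\<close> is \<open>- I / (2 \<mu>)\<close>.  Testing orthogonality with
\<open>(1, 0, \<mu>)\<close> and \<open>(0, t, 0)\<close> shows that no other vector qualifies.\<close>

lemma orth_proj_canonical:
  assumes G: "inner_form (G x)" and \<mu>: "\<mu> \<noteq> 0" and W: "\<And>a. a \<in> W \<longleftrightarrow> snd (snd a) = \<mu> * fst a"
  shows "orth_proj (tractor_met G x) W (0, 0, 1) = (1 / (2 * \<mu>), 0, 1 / 2)"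
  unfolding orth_proj_def
proof (rule the_equality)
  show "(1 / (2 * \<mu>), 0, 1 / 2) \<in> W \<and>
      (\<forall>z\<in>W. tractor_met G x ((0, 0, 1) - (1 / (2 * \<mu>), 0, 1 / 2)) z = 0)"
    using \<mu> by (auto simp: W linear_0[OF inner_form_linear(2)[OF G]])
  fix w assume w: "w \<in> W \<and> (\<forall>z\<in>W. tractor_met G x ((0, 0, 1) - w) z = 0)"
  obtain s t r where w': "w = (s, t, r)" by (cases w)
  have r: "r = \<mu> * s" using w W w' by auto
  have orth: "tractor_met G x ((0, 0, 1) - w) z = 0" if "z \<in> W" for z using w that by blast
  have "s = 1 / (2 * \<mu>)"
    using orth[of "(1, 0, \<mu>)"] \<mu> by (simp add: W w' r linear_0[OF inner_form_linear(1)[OF G]] field_simps)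
  moreover have "t = 0"
  proof (rule ccontr)
    assume "t \<noteq> 0"
    then have "G x t t > 0" by (rule inner_form_pos[OF G])
    moreover have "G x t t = 0"
      using orth[of "(0, t, 0)"] by (simp add: W w' linear_neg[OF inner_form_linear(2)[OF G]])
    ultimately show False by simp
  qed
  ultimately show "w = (1 / (2 * \<mu>), 0, 1 / 2)" using \<mu> by (simp add: w' r)
qed

end

theorem proposition2p13:
  fixes M\<^sub>1 :: "('i, 'p::{t2_space,second_countable_topology}, 'e::euclidean_space) atlas"
    and M\<^sub>2 :: "('j, 'q::{t2_space,second_countable_topology}, 'f::euclidean_space) atlas"
    and g\<^sub>1 :: "('i, 'e) metric" and g\<^sub>2 :: "('j, 'f) metric"
    and \<mu>\<^sub>1 \<mu>\<^sub>2 :: real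
  assumes "special_einstein_product M\<^sub>1 g\<^sub>1 \<mu>\<^sub>1 M\<^sub>2 g\<^sub>2 \<mu>\<^sub>2"
  shows
    "let M = product_manifold M\<^sub>1 M\<^sub>2;
         g = product_metric g\<^sub>1 g\<^sub>2;
         c = conformal_class M g;
         P\<^sub>1 = perp (einstein_tractors M\<^sub>1 g\<^sub>1 \<mu>\<^sub>1) (einstein_tractor \<mu>\<^sub>1);
         P\<^sub>2 = perp (einstein_tractors M\<^sub>2 g\<^sub>2 \<mu>\<^sub>2) (einstein_tractor \<mu>\<^sub>2);
         T = direct_sum (pullback_fst P\<^sub>1) (pullback_snd P\<^sub>2);
         X\<^sub>1 = (\<lambda>i x. orth_proj (met P\<^sub>1 i x) (fib P\<^sub>1 i x) (canonical_tractor i x));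
         X\<^sub>2 = (\<lambda>j y. orth_proj (met P\<^sub>2 j y) (fib P\<^sub>2 j y) (canonical_tractor j y))
     in \<exists>X. normal_standard_tractor_bundle M c T X \<and>
            (\<forall>i\<in>charts M\<^sub>1. \<forall>x\<in>cimg M\<^sub>1 i. \<forall>j\<in>charts M\<^sub>2. \<forall>y\<in>cimg M\<^sub>2 j.
               X g (i, j) (x, y) = (X\<^sub>1 i x, X\<^sub>2 j y))"
proof -
  interpret special_product M\<^sub>1 M\<^sub>2 g\<^sub>1 g\<^sub>2 \<mu>\<^sub>1 \<mu>\<^sub>2 by (rule special_product.intro) fact
  have "normal_standard_tractor_bundle M c T canonical"
    unfolding normal_standard_tractor_bundle_def
    using canonical_weighted_section iso_bundle_isomorphism iso_canonical iso_change_scale by blast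
  moreover have "canonical g (i, j) (x, y) =
      (orth_proj (met P\<^sub>1 i x) (fib P\<^sub>1 i x) (canonical_tractor i x),
       orth_proj (met P\<^sub>2 j y) (fib P\<^sub>2 j y) (canonical_tractor j y))"
    if i: "i \<in> charts M\<^sub>1" and x: "x \<in> cimg M\<^sub>1 i" and j: "j \<in> charts M\<^sub>2" and y: "y \<in> cimg M\<^sub>2 j" for i x j y
  proof -
    have "orth_proj (tractor_met (g\<^sub>1 i) x) (fib P\<^sub>1 i x) (0, 0, 1) = (1 / (2 * \<mu>\<^sub>1), 0, 1 / 2)"
      by (rule orth_proj_canonical[of "g\<^sub>1 i" x, OF local_metric.form[OF local_metrics(1)[OF i] x] \<mu>(2) fib_perp(1)[OF i x]])
    moreover have "orth_proj (tractor_met (g\<^sub>2 j) y) (fib P\<^sub>2 j y) (0, 0, 1) = (1 / (2 * \<mu>\<^sub>2), 0, 1 / 2)"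
      by (rule orth_proj_canonical[of "g\<^sub>2 j" y, OF local_metric.form[OF local_metrics(2)[OF j] y] \<mu>(3) fib_perp(2)[OF j y]])
    moreover have "met P\<^sub>1 i x = tractor_met (g\<^sub>1 i) x" "met P\<^sub>2 j y = tractor_met (g\<^sub>2 j) y"
      by (simp_all add: perp_def einstein_tractors_def)
    ultimately show ?thesis
      by (simp add: canonical_def scale_self canonical_pair_def canonical_tractor_def \<mu>(1))
  qed
  ultimately show ?thesis unfolding Let_def by blast
qed

end
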